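(* Let $d\in\mathbb{N}$ (so $d\ge 1$) and let $f:\mathbb{C}^2\to\mathbb{C}^2$ be a regular polynomial map of degree $d$, with leading homogeneous part $\hat f$. For any compact set $K\subset\mathbb{C}^2$, $$ d(f^{-1}(K)) = |\mathrm{Res}(\hat f)|^{-1/(2d^2)}\, d(K)^{1/d}, $$ where $d(\cdot)$ applied to a compact set denotes the Fekete–Leja transfinite diameter in $\mathbb{C}^2$.
   Context: Regular map: $f=(f_1,f_2)$ is a regular polynomial map of degree $d$ if $f_1,f_2\in\mathbb{C}[z_1,z_2]$ have degree-$d$ homogeneous parts $\hat f_1(z)=a_dz_1^d+a_{d-1}z_1^{d-1}z_2+\cdots+a_0z_2^d$, $\hat f_2(z)=b_dz_1^d+b_{d-1}z_1^{d-1}z_2+\cdots+b_0z_2^d$ (all other terms of $f_1,f_2$ having degree $<d$), and $\hat f=(\hat f_1,\hat f_2)$ satisfies $\hat f^{-1}(0,0)=\{(0,0)\}$. Resultant: $\mathrm{Res}(\hat f)=\mathrm{Res}(\hat f_1,\hat f_2)$ is the determinant of the $2d\times 2d$ Sylvester matrix whose first $d$ rows are the successive right shifts of $(a_d,a_{d-1},\ldots,a_0,0,\ldots,0)$ (shifted by $0,1,\ldots,d-1$ places) and whose last $d$ rows are the successive right shifts of $(b_d,b_{d-1},\ldots,b_0,0,\ldots,0)$. Fekete–Leja transfinite diameter in $\mathbb{C}^2$: list the monomials $z^\alpha$, $\alpha\in\mathbb{N}_0^2$, as $\mathbf{e}_1,\mathbf{e}_2,\ldots$ in an order compatible with total degree.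 Let $m_k$ be the number of monomials of degree at most $k$, and $l_k=\sum_{\nu=1}^k\nu(m_\nu-m_{\nu-1})$. For compact $E\subset\mathbb{C}^2$ put $\mathrm{Van}_n(E)=\max\{|\det[\mathbf{e}_j(\zeta_k)]_{j,k=1}^n| : \zeta_1,\ldots,\zeta_n\in E\}$. Then $d(E)=\limsup_{n\to\infty}(\mathrm{Van}_{m_n}(E))^{1/l_n}$. *)

theory Defs
  imports
    Complex_Main
    "HOL-Library.Poly_Mapping"
    "HOL-Library.Nat_Bijection"
    "HOL-Library.Extended_Real"
    "Jordan_Normal_Form.Determinant"
begin

section \<open>Monomials and polynomials in two complex variables\<close>

text \<open>
  An element of \<open>\<complex>[z\<^sub>1, z\<^sub>2]\<close> is its finitely supported family of coefficients, indexed by the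
  exponents \<open>\<alpha> \<in> \<nat> \<times> \<nat>\<close>.
\<close>

type_synonym bipoly = "(nat \<times> nat) \<Rightarrow>\<^sub>0 complex"

definition total_deg :: "nat \<times> nat \<Rightarrow> nat" where
  "total_deg \<alpha> = fst \<alpha> + snd \<alpha>"

definition monomial_at :: "nat \<times> nat \<Rightarrow> complex \<times> complex \<Rightarrow> complex" where
  "monomial_at \<alpha> z = fst z ^ fst \<alpha> * snd z ^ snd \<alpha>"

definition bipoly_eval :: "bipoly \<Rightarrow> complex \<times> complex \<Rightarrow> complex" where
  "bipoly_eval p z = (\<Sum>\<alpha>\<in>Poly_Mapping.keys p. Poly_Mapping.lookup p \<alpha> * monomial_at \<alpha> z)"

definition poly_map :: "bipoly \<Rightarrow> bipoly \<Rightarrow> complex \<times> complex \<Rightarrow> complex \<times> complex" where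
  "poly_map p q z = (bipoly_eval p z, bipoly_eval q z)"


section \<open>Leading homogeneous parts and regular maps\<close>

text \<open>\<open>top_coeff d p k\<close> is the coefficient of \<open>z\<^sub>1\<^sup>k z\<^sub>2\<^sup>d\<^sup>-\<^sup>k\<close> in \<open>p\<close>, for \<open>k \<le> d\<close>.\<close>

definition top_coeff :: "nat \<Rightarrow> bipoly \<Rightarrow> nat \<Rightarrow> complex" where
  "top_coeff d p k = Poly_Mapping.lookup p (k, d - k)"

definition binary_form :: "nat \<Rightarrow> (nat \<Rightarrow> complex) \<Rightarrow> complex \<times> complex \<Rightarrow> complex" where
  "binary_form d a z = (\<Sum>k\<le>d. a k * fst z ^ k * snd z ^ (d - k))"

definition hat_map :: "nat \<Rightarrow> bipoly \<Rightarrow> bipoly \<Rightarrow> complex \<times> complex \<Rightarrow> complex \<times> complex" where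
  "hat_map d p q z = (binary_form d (top_coeff d p) z, binary_form d (top_coeff d q) z)"

definition regular_map :: "nat \<Rightarrow> bipoly \<Rightarrow> bipoly \<Rightarrow> bool" where
  "regular_map d p q \<longleftrightarrow>
     (\<forall>\<alpha>\<in>Poly_Mapping.keys p. total_deg \<alpha> \<le> d) \<and> (\<forall>\<alpha>\<in>Poly_Mapping.keys q. total_deg \<alpha> \<le> d) \<and>
     hat_map d p q -` {(0, 0)} = {(0, 0)}"


section \<open>The resultant of two binary forms of degree \<open>d\<close>\<close>

text \<open>
  Both forms have formal degree \<open>d\<close>: the coefficients \<open>a d\<close> and \<open>b d\<close> may vanish, so the
  matrix always has size \<open>2d \<times> 2d\<close> (unlike the Sylvester matrix of two univariate polynomials
  with their actual degrees). For \<open>s < d\<close>, the rows \<open>s\<close> and \<open>d + s\<close> are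
  \<open>(a d, a (d - 1), \<dots>, a 0, 0, \<dots>, 0)\<close> and \<open>(b d, b (d - 1), \<dots>, b 0, 0, \<dots>, 0)\<close>
  shifted to the right by \<open>s\<close> places.
\<close>

definition shifted_row :: "nat \<Rightarrow> (nat \<Rightarrow> complex) \<Rightarrow> nat \<Rightarrow> nat \<Rightarrow> complex" where
  "shifted_row d a s j = (if s \<le> j \<and> j \<le> s + d then a (d - (j - s)) else 0)"

definition form_resultant :: "nat \<Rightarrow> (nat \<Rightarrow> complex) \<Rightarrow> (nat \<Rightarrow> complex) \<Rightarrow> complex" where
  "form_resultant d a b = Determinant.det (Matrix.mat (2 * d) (2 * d)
     (\<lambda>(i, j). if i < d then shifted_row d a i j else shifted_row d b (i - d) j))"

definition hat_resultant :: "nat \<Rightarrow> bipoly \<Rightarrow> bipoly \<Rightarrow> complex" where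
  "hat_resultant d p q = form_resultant d (top_coeff d p) (top_coeff d q)"


section \<open>The Fekete--Leja transfinite diameter\<close>

text \<open>
  Enumerations of all monomials compatible with total degree; the list starts at index \<open>0\<close>.
\<close>

definition graded_enumeration :: "(nat \<Rightarrow> nat \<times> nat) \<Rightarrow> bool" where
  "graded_enumeration e \<longleftrightarrow> bij e \<and> (\<forall>i j. i \<le> j \<longrightarrow> total_deg (e i) \<le> total_deg (e j))"

definition monomial_count :: "nat \<Rightarrow> nat" where
  "monomial_count k = card {\<alpha>. total_deg \<alpha> \<le> k}"

definition degree_sum :: "nat \<Rightarrow> nat" where
  "degree_sum k = (\<Sum>\<nu>=1..k. \<nu> * (monomial_count \<nu> - monomial_count (\<nu> - 1)))"

text \<open>
  For nonempty compact \<open>E\<close> the supremum is a maximum of nonnegative numbers and the inserted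
  \<open>0\<close> has no effect; its only role is to make the value \<open>0\<close> when \<open>E\<close> is empty and \<open>n > 0\<close>.
\<close>

definition Van :: "(nat \<Rightarrow> nat \<times> nat) \<Rightarrow> nat \<Rightarrow> (complex \<times> complex) set \<Rightarrow> real" where
  "Van e n E = Sup (insert 0
     {cmod (Determinant.det (Matrix.mat n n (\<lambda>(j, k). monomial_at (e j) (\<zeta> k)))) | \<zeta>.
        \<forall>k<n. \<zeta> k \<in> E})"

text \<open>
  For compact \<open>E\<close> the sequence below is bounded, so the limit superior is a real number
  and \<^const>\<open>real_of_ereal\<close> loses nothing. The term for \<open>n = 0\<close>, where the exponent is
  \<open>1 / 0\<close>, does not affect the limit superior.
\<close>

definition transfinite_diameter ::
    "(nat \<Rightarrow> nat \<times> nat) \<Rightarrow> (complex \<times> complex) set \<Rightarrow> real" where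
  "transfinite_diameter e E = real_of_ereal
     (limsup (\<lambda>n. ereal (Van e (monomial_count n) E powr (1 / real (degree_sum n)))))"

lemma graded_enumeration_prod_decode: "graded_enumeration prod_decode"
  unfolding graded_enumeration_def
proof (intro conjI allI impI)
  show "bij prod_decode" by (rule bij_prod_decode)
  fix i j :: nat
  assume "i \<le> j"
  obtain a b where ab: "prod_decode i = (a, b)" by fastforce
  obtain c d where cd: "prod_decode j = (c, d)" by fastforce
  have i: "i = triangle (a + b) + a" and j: "j = triangle (c + d) + c"
    using prod_decode_inverse[of i] prod_decode_inverse[of j]
    by (auto simp: ab cd prod_encode_def)
  have "a + b \<le> c + d"
  proof (rule ccontr)
    assume "\<not> a + b \<le> c + d"
    then obtain t where "a + b = Suc (c + d) + t"
      by (metis less_iff_Suc_add not_le add_Suc)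
    moreover have "triangle x \<le> triangle (x + y)" for x y
      by (induction y) auto
    ultimately have "triangle (Suc (c + d)) \<le> triangle (a + b)" by metis
    then show False using i j \<open>i \<le> j\<close> by simp
  qed
  then show "total_deg (prod_decode i) \<le> total_deg (prod_decode j)"
    by (simp add: ab cd total_deg_def)
qed

end

theory Submission
  imports
    Defs
    "HOL-Real_Asymp.Real_Asymp"
    "Jordan_Normal_Form.Schur_Decomposition"
begin

text \<open>
  There are \<open>d\<^sup>2\<close> monomials \<open>g\<^sub>\<beta> = z\<^sup>\<beta>\<close> that form a basis of \<open>\<complex>[z]\<close> as a module over
  \<open>\<complex>[f\<^sub>1, f\<^sub>2]\<close>, and the products \<open>g\<^sub>\<beta> f\<^sup>\<alpha>\<close> form a graded basis of \<open>\<complex>[z]\<close>. In degree \<open>n = dq + r\<close>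
  the change of basis to monomials has determinant \<open>\<kappa>\<^sub>r^q Res^(q (q - 1) / 2)\<close> up to sign, by multiplicativity of
  the resultant; the product over all degrees up to \<open>n\<close> accounts for the factor
  \<open>|Res|^(- 1 / (2 d\<^sup>2))\<close>, since \<open>O(n\<^sup>2)\<close> is negligible against \<open>l\<^sub>n\<close>.

  In the new basis, Laplace expansion along the \<open>d\<^sup>2\<close> blocks \<open>g\<^sub>\<beta> \<cdot> (h \<circ> f)\<close> bounds the
  Vandermonde maxima of \<open>f\<^sup>-\<^sup>1(K)\<close> by \<open>d\<^sup>2\<close>-th powers of those of \<open>K\<close>. Conversely, at all preimages of points
  \<open>\<zeta>\<^sub>1, \<zeta>\<^sub>2, \<dots>\<close> of \<open>K\<close> the determinant is a Kronecker product: it is the \<open>d\<^sup>2\<close>-th power of the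
  Vandermonde determinant of the \<open>\<zeta>\<^sub>l\<close> times the product of the \<open>det [g\<^sub>\<beta>(w)]\<close>, with \<open>w\<close> running
  over the fibre of \<open>\<zeta>\<^sub>l\<close>. The latter are bounded below by the discriminant of the trace
  form of \<open>\<complex>[z]\<close> over \<open>\<complex>[f\<^sub>1, f\<^sub>2]\<close>, a nonzero polynomial in \<open>\<zeta>\<^sub>l\<close>, and multiplication by a fixed
  nonzero polynomial changes Vandermonde maxima only by a factor \<open>exp (O(n\<^sup>2))\<close>.
\<close>

section \<open>Generalised Vandermonde determinants\<close>

text \<open>Over a branch value the fibre has fewer than d^2 points, so the lower bound counts no
  preimages. It takes d^2 points of the fibre, possibly repeated, out of a Gram matrix of traces,
  using only that a trace is a sum of d^2 eigenvalues, each of them a value on the fibre. The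
  discriminant is the price of this choice. Exponents: in degree m the resultant enters with q (q -
  1) / 2 for q = m div d, about m^2 / (2 d^2). Summed up to n this is about n^3 / (6 d^2), against
  l_n of about n^3 / 3. The exponent 1/d of d(K) is the limit of d^2 l_k / l_n for k about n / d.
  The two estimates differ in reach. The upper one holds in every degree n from 2 d on, with degree
  n div d - 2 on the side of K, because the generators have degree up to 2 d. The lower one reaches
  only the degrees d k on the side of the preimage, but all large degrees on the side of K, and that
  is enough for a limit superior. Determinants are taken in modulus, so rows and columns may be
  reordered freely.\<close>

definition vdm :: "('x \<Rightarrow> complex) list \<Rightarrow> 'x list \<Rightarrow> real" where
  "vdm fs xs = cmod (det (mat (length fs) (length fs) (\<lambda>(i, j). (fs ! i) (xs ! j))))"

lemma vdm_nonneg [simp]: "0 \<le> vdm fs xs"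
  by (simp add: vdm_def)

lemma vdm_cong:
  assumes "length fs = length gs" "length xs = length fs" "length ys = length fs"
    and "\<And>i j. i < length fs \<Longrightarrow> j < length fs \<Longrightarrow> (fs ! i) (xs ! j) = (gs ! i) (ys ! j)"
  shows "vdm fs xs = vdm gs ys"
proof -
  have "mat (length fs) (length fs) (\<lambda>(i, j). (fs ! i) (xs ! j)) =
        mat (length gs) (length gs) (\<lambda>(i, j). (gs ! i) (ys ! j))"
    using assms by (intro eq_matI) auto
  then show ?thesis by (simp add: vdm_def)
qed

lemma vdm_perm_rows:
  assumes "mset fs = mset gs"
  shows "vdm fs xs = vdm gs xs"
proof -
  obtain p where p: "p permutes {..<length gs}" and fs: "permute_list p gs = fs"
    using mset_eq_permutation[OF assms] by metis
  define n where "n = length gs"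
  define A where "A = mat n n (\<lambda>(i, j). (gs ! i) (xs ! j))"
  have A: "A \<in> carrier_mat n n" by (simp add: A_def)
  have p': "p permutes {0..<n}" using p by (simp add: n_def lessThan_atLeast0)
  have len: "length fs = n" using fs by (auto simp: n_def)
  have "mat n n (\<lambda>(i, j). (fs ! i) (xs ! j)) = mat n n (\<lambda>(i, j). A $$ (p i, j))"
    using p' permutes_in_image[OF p'] fs[symmetric]
    by (intro eq_matI) (auto simp: A_def permute_list_nth[OF p] n_def)
  then show ?thesis
    using det_permute_rows[OF A p'] len
    by (simp add: vdm_def A_def n_def norm_mult sign_def)
qed

text \<open>Points become evaluation functionals, so each statement about rows yields one about
  columns.\<close>

lemma vdm_transpose:
  assumes "length xs = length fs"
  shows "vdm fs xs = vdm (map (\<lambda>x f. f x) xs) fs"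
proof -
  define n where "n = length fs"
  define A where "A = mat n n (\<lambda>(i, j). (fs ! i) (xs ! j))"
  have A: "A \<in> carrier_mat n n" by (simp add: A_def)
  have "transpose_mat A = mat n n (\<lambda>(i, j). (map (\<lambda>x f. f x) xs ! i) (fs ! j))"
    using assms by (intro eq_matI) (auto simp: A_def n_def)
  with det_transpose[OF A] assms show ?thesis
    by (simp add: vdm_def A_def n_def)
qed

lemma vdm_perm_cols:
  assumes "mset xs = mset ys" "length xs = length fs"
  shows "vdm fs xs = vdm fs ys"
proof -
  have "length ys = length fs" using assms mset_eq_length by metis
  moreover have "vdm (map (\<lambda>x f. f x) xs) fs = vdm (map (\<lambda>x f. f x) ys) fs"
    using assms by (intro vdm_perm_rows) simp
  ultimately show ?thesis using assms vdm_transpose by metis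
qed

lemma vdm_block:
  assumes "length xs = length fs" "length ys = length gs"
    and "\<And>f y. f \<in> set fs \<Longrightarrow> y \<in> set ys \<Longrightarrow> f y = 0"
  shows "vdm (fs @ gs) (xs @ ys) = vdm fs xs * vdm gs ys"
proof -
  define n m where "n = length fs" and "m = length gs"
  define A1 where "A1 = mat n n (\<lambda>(i, j). (fs ! i) (xs ! j))"
  define A3 where "A3 = mat m n (\<lambda>(i, j). (gs ! i) (xs ! j))"
  define A4 where "A4 = mat m m (\<lambda>(i, j). (gs ! i) (ys ! j))"
  have "mat (n + m) (n + m) (\<lambda>(i, j). ((fs @ gs) ! i) ((xs @ ys) ! j)) =
        four_block_mat A1 (0\<^sub>m n m) A3 A4"
    using assms by (intro eq_matI) (auto simp: A1_def A3_def A4_def n_def m_def nth_append)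
  moreover have "det (four_block_mat A1 (0\<^sub>m n m) A3 A4) = det A1 * det A4"
    by (rule det_four_block_mat_upper_right_zero) (auto simp: A1_def A3_def A4_def)
  ultimately show ?thesis
    by (simp add: vdm_def A1_def A4_def n_def m_def norm_mult)
qed

text \<open>The transition matrix from \<open>fs @ gs\<close> to \<open>fs @ hs\<close> is block
  lower triangular with diagonal blocks 1 and \<open>T\<close>, so the components \<open>Y\<close>
  along \<open>fs\<close> do not enter the factor. The factor is written as a \<open>vdm\<close>
  over index columns so that the lemmas on \<open>vdm\<close> apply to it again.\<close>

lemma vdm_transition:
  assumes "length hs = m" "length gs = m" "length xs = length fs + m"
    and "\<And>i x. i < m \<Longrightarrow> x \<in> set xs \<Longrightarrow>
      (hs ! i) x = (\<Sum>j<length fs. Y i j * (fs ! j) x) + (\<Sum>j<m. T i j * (gs ! j) x)"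
  shows "vdm (fs @ hs) xs = vdm (map T [0..<m]) [0..<m] * vdm (fs @ gs) xs"
proof -
  define n where "n = length fs"
  define A1 :: "complex mat" where "A1 = 1\<^sub>m n"
  define A3 where "A3 = mat m n (\<lambda>(i, j). Y i j)"
  define A4 where "A4 = mat m m (\<lambda>(i, j). T i j)"
  define X where "X = four_block_mat A1 (0\<^sub>m n m) A3 A4"
  define G where "G = mat (n + m) (n + m) (\<lambda>(i, j). ((fs @ gs) ! i) (xs ! j))"
  have car: "A1 \<in> carrier_mat n n" "A3 \<in> carrier_mat m n" "A4 \<in> carrier_mat m m"
    "X \<in> carrier_mat (n + m) (n + m)" "G \<in> carrier_mat (n + m) (n + m)"
    by (auto simp: A1_def A3_def A4_def X_def G_def)
  have "mat (n + m) (n + m) (\<lambda>(i, j). ((fs @ hs) ! i) (xs ! j)) = X * G"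
  proof (rule eq_matI)
    fix i j assume "i < dim_row (X * G)" "j < dim_col (X * G)"
    then have ij: "i < n + m" "j < n + m" using car by auto
    have XG: "(X * G) $$ (i, j) = (\<Sum>k<n + m. X $$ (i, k) * ((fs @ gs) ! k) (xs ! j))"
      using ij car by (simp add: scalar_prod_def G_def atLeast0LessThan)
    have split: "(\<Sum>k<n + m. h k) = (\<Sum>k<n. h k) + (\<Sum>k<m. h (n + k))" for h :: "nat \<Rightarrow> complex"
      by (induction m) (auto simp: add_ac)
    show "mat (n + m) (n + m) (\<lambda>(i, j). ((fs @ hs) ! i) (xs ! j)) $$ (i, j) = (X * G) $$ (i, j)"
    proof (cases "i < n")
      case True
      have "(\<Sum>k<n + m. X $$ (i, k) * ((fs @ gs) ! k) (xs ! j)) = (\<Sum>k<n. (if k = i then (fs ! k) (xs ! j) else 0))"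
        using True unfolding split
        by (auto simp: X_def A1_def A3_def A4_def nth_append n_def if_distrib[of "\<lambda>u. u * _"] eq_commute[of i] cong: if_cong)
      then show ?thesis using XG True ij by (simp add: nth_append n_def)
    next
      case False
      then have i: "i - n < m" using ij by auto
      have "(\<Sum>k<n + m. X $$ (i, k) * ((fs @ gs) ! k) (xs ! j)) =
         (\<Sum>k<n. Y (i - n) k * (fs ! k) (xs ! j)) + (\<Sum>k<m. T (i - n) k * (gs ! k) (xs ! j))"
        using False i unfolding split
        by (auto simp: X_def A1_def A3_def A4_def nth_append n_def)
      then show ?thesis using XG False ij assms i by (simp add: nth_append n_def)
    qed
  qed (use car in auto)
  moreover have "det X = det A4"
    using det_four_block_mat_upper_right_zero[of A1 n "0\<^sub>m n m" m A3 A4] car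
    by (simp add: X_def A1_def)
  moreover have "vdm (map T [0..<m]) [0..<m] = cmod (det A4)"
    unfolding vdm_def A4_def by (rule arg_cong[where f = "\<lambda>M. cmod (det M)"]) (auto intro!: eq_matI)
  ultimately show ?thesis
    using det_mult[OF car(4) car(5)] assms
    by (simp add: vdm_def n_def G_def norm_mult)
qed

lemma vdm_scale:
  assumes "length xs = length fs"
  shows "vdm (map (\<lambda>f x. g x * f x) fs) xs = (\<Prod>x\<leftarrow>xs. cmod (g x)) * vdm fs xs"
proof -
  define n where "n = length fs"
  define A where "A = mat n n (\<lambda>(i, j). (fs ! i) (xs ! j))"
  define B where "B = mat n n (\<lambda>(i, j). g (xs ! j) * (fs ! i) (xs ! j))"
  have car: "A \<in> carrier_mat n n" "B \<in> carrier_mat n n" by (auto simp: A_def B_def)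
  have "signof p * (\<Prod>i = 0..<n. B $$ (i, p i)) =
     (\<Prod>j = 0..<n. g (xs ! j)) * (signof p * (\<Prod>i = 0..<n. A $$ (i, p i)))"
    if p: "p permutes {0..<n}" for p
  proof -
    have "(\<Prod>i = 0..<n. B $$ (i, p i)) = (\<Prod>i = 0..<n. g (xs ! p i) * A $$ (i, p i))"
      using permutes_in_image[OF p] by (intro prod.cong) (auto simp: A_def B_def)
    also have "\<dots> = (\<Prod>j = 0..<n. g (xs ! j)) * (\<Prod>i = 0..<n. A $$ (i, p i))"
      using prod.permute[OF p, of "\<lambda>j. g (xs ! j)"] by (simp add: prod.distrib o_def)
    finally show ?thesis by simp
  qed
  then have "det B = (\<Prod>j = 0..<n. g (xs ! j)) * det A"
    unfolding det_def'[OF car(1)] det_def'[OF car(2)] sum_distrib_left by (intro sum.cong) auto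
  moreover have "cmod (\<Prod>j = 0..<n. g (xs ! j)) = (\<Prod>x\<leftarrow>xs. cmod (g x))"
    using assms by (simp add: prod_norm[symmetric] prod.list_conv_set_nth n_def)
  moreover have "vdm (map (\<lambda>f x. g x * f x) fs) xs = cmod (det B)"
    unfolding vdm_def B_def by (rule arg_cong[where f = "\<lambda>M. cmod (det M)"]) (auto intro!: eq_matI simp: n_def)
  ultimately show ?thesis by (simp add: vdm_def A_def norm_mult n_def)
qed

lemma vdm_le_fact:
  assumes "length xs = length fs" "0 \<le> C"
    and "\<And>f x. f \<in> set fs \<Longrightarrow> x \<in> set xs \<Longrightarrow> cmod (f x) \<le> C"
  shows "vdm fs xs \<le> fact (length fs) * C ^ length fs"
proof -
  define n where "n = length fs"
  define A where "A = mat n n (\<lambda>(i, j). (fs ! i) (xs ! j))"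
  have A: "A \<in> carrier_mat n n" by (simp add: A_def)
  have "cmod (det A) \<le> (\<Sum>p | p permutes {0..<n}. cmod (signof p * (\<Prod>i = 0..<n. A $$ (i, p i))))"
    unfolding det_def'[OF A] by (rule norm_sum)
  also have "\<dots> \<le> (\<Sum>p | p permutes {0..<n}. C ^ n)"
  proof (rule sum_mono)
    fix p assume "p \<in> {p. p permutes {0..<n}}"
    then have p: "p permutes {0..<n}" by simp
    have "cmod (signof p * (\<Prod>i = 0..<n. A $$ (i, p i))) = (\<Prod>i = 0..<n. cmod (A $$ (i, p i)))"
      by (simp add: norm_mult sign_def prod_norm)
    also have "\<dots> \<le> (\<Prod>i = 0..<n. C)"
      using permutes_in_image[OF p] assms by (intro prod_mono) (auto simp: A_def n_def)
    finally show "cmod (signof p * (\<Prod>i = 0..<n. A $$ (i, p i))) \<le> C ^ n" by simp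
  qed
  also have "\<dots> = fact n * C ^ n" by (simp add: card_permutations[of _ n])
  finally show ?thesis by (simp add: vdm_def A_def n_def)
qed

text \<open>Laplace expansion along the rows of \<open>fs\<close>, with signs discarded. Every
  permutation contributes to exactly one column set \<open>S\<close>, the image of the first rows.
  The factor 2^N counts all column sets, also those of the wrong size, since only the growth rate
  matters later.\<close>

lemma vdm_append_le:
  fixes fs gs :: "('x \<Rightarrow> complex) list"
  assumes len: "length xs = length fs + length gs"
    and B1: "\<And>ys. set ys \<subseteq> set xs \<Longrightarrow> length ys = length fs \<Longrightarrow> vdm fs ys \<le> B1"
    and B2: "\<And>ys. set ys \<subseteq> set xs \<Longrightarrow> length ys = length gs \<Longrightarrow> vdm gs ys \<le> B2"
    and nn: "0 \<le> B1" "0 \<le> B2"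
  shows "vdm (fs @ gs) xs \<le> 2 ^ length xs * (B1 * B2)"
proof -
  define a N where "a = length fs" and "N = length xs"
  define A where "A = mat N N (\<lambda>(i, j). ((fs @ gs) ! i) (xs ! j))"
  \<comment> \<open>\<open>M S\<close> keeps the entries whose row and column belong to the same
    side of the splitting. If \<open>S\<close> has \<open>a\<close> elements, its determinant is up
    to sign a product of two complementary minors; otherwise it is zero.\<close>
  define M where "M = (\<lambda>S. mat N N (\<lambda>(i, j). if (i < a) = (j \<in> S) then A $$ (i, j) else 0))"
  have car: "A \<in> carrier_mat N N" "\<And>S. M S \<in> carrier_mat N N" by (auto simp: A_def M_def)
  have aN: "a \<le> N" using len by (simp add: a_def N_def)
  have zero: "(\<Prod>i = 0..<N. M S $$ (i, p i)) = 0"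
    if p: "p permutes {0..<N}" and S: "S \<subseteq> {0..<N}" "S \<noteq> p ` {0..<a}" for p S
  proof -
    have "\<exists>i\<in>{0..<N}. (i < a) \<noteq> (p i \<in> S)"
    proof (rule ccontr)
      assume "\<not> ?thesis"
      then have eq: "\<And>i. i \<in> {0..<N} \<Longrightarrow> (i < a) = (p i \<in> S)" by auto
      have "S = p ` {0..<a}"
      proof (intro subset_antisym subsetI)
        fix s assume s: "s \<in> S"
        then have "s \<in> p ` {0..<N}" using S permutes_image[OF p] by auto
        then show "s \<in> p ` {0..<a}" using eq s by auto
      next
        fix s assume "s \<in> p ` {0..<a}"
        then obtain i where "i < a" "s = p i" by auto
        then show "s \<in> S" using eq[of i] aN by auto
      qed
      with S show False by simp
    qed
    then obtain i where i: "i \<in> {0..<N}" "(i < a) \<noteq> (p i \<in> S)" by blast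
    then have "M S $$ (i, p i) = 0" using permutes_in_image[OF p] by (auto simp: M_def)
    with i show ?thesis by (intro prod_zero) auto
  qed
  have split: "(\<Sum>S\<in>Pow {0..<N}. \<Prod>i = 0..<N. M S $$ (i, p i)) = (\<Prod>i = 0..<N. A $$ (i, p i))"
    if p: "p permutes {0..<N}" for p
  proof -
    have pa: "p ` {0..<a} \<subseteq> {0..<N}" using permutes_image[OF p] aN by fastforce
    have inj: "inj p" using permutes_inj[OF p] .
    have "(\<Sum>S\<in>Pow {0..<N}. \<Prod>i = 0..<N. M S $$ (i, p i)) =
          (\<Sum>S\<in>{p ` {0..<a}}. \<Prod>i = 0..<N. M S $$ (i, p i))"
      using pa zero[OF p] by (intro sum.mono_neutral_right) auto
    also have "\<dots> = (\<Prod>i = 0..<N. A $$ (i, p i))"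
      using permutes_in_image[OF p] aN inj
      by (auto simp: M_def inj_image_mem_iff intro!: prod.cong)
    finally show ?thesis .
  qed
  have "det A = (\<Sum>S\<in>Pow {0..<N}. det (M S))"
    unfolding det_def'[OF car(1)] det_def'[OF car(2)]
    by (subst sum.swap) (auto simp: sum_distrib_left[symmetric] split intro!: sum.cong)
  then have "cmod (det A) \<le> (\<Sum>S\<in>Pow {0..<N}. cmod (det (M S)))"
    by (simp add: norm_sum)
  also have "\<dots> \<le> (\<Sum>S\<in>Pow {0..<N}. B1 * B2)"
  proof (rule sum_mono)
    fix S assume "S \<in> Pow {0..<N}"
    then have S: "S \<subseteq> {0..<N}" by simp
    have fS: "finite S" using S finite_subset by blast
    show "cmod (det (M S)) \<le> B1 * B2"
    proof (cases "card S = a")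
      case False
      have "(\<Prod>i = 0..<N. M S $$ (i, p i)) = 0" if p: "p permutes {0..<N}" for p
      proof -
        have "S \<noteq> p ` {0..<a}"
          using False card_image[OF inj_on_subset[OF permutes_inj[OF p] subset_UNIV], of "{0..<a}"] by auto
        then show ?thesis using zero[OF p S] by blast
      qed
      then have "det (M S) = 0" unfolding det_def'[OF car(2)] by (intro sum.neutral) auto
      then show ?thesis using nn by simp
    next
      case True
      define us vs where "us = sorted_list_of_set S" and "vs = sorted_list_of_set ({0..<N} - S)"
      have lus: "length us = a" "set us = S" "set vs = {0..<N} - S"
        using fS True by (auto simp: us_def vs_def)
      have lvs: "length vs = N - a"
        using S True fS by (simp add: vs_def card_Diff_subset)
      have ms: "mset (us @ vs) = mset [0..<N]"
      proof -
        have "set (us @ vs) = set [0..<N]" "distinct (us @ vs)"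
          using lus S by (auto simp: us_def vs_def)
        then show ?thesis by (metis distinct_upt set_eq_iff_mset_eq_distinct)
      qed
      \<comment> \<open>Entries off the two diagonal blocks are set to zero as functions, which is
        the form that \<open>vdm_block\<close> expects.\<close>
      define F where "F = map (\<lambda>i j. if j \<in> S then (fs ! i) (xs ! j) else 0) [0..<a]"
      define G where "G = map (\<lambda>i j. if j \<in> S then 0 else (gs ! i) (xs ! j)) [0..<N - a]"
      have "mat (length (F @ G)) (length (F @ G)) (\<lambda>(i, j). ((F @ G) ! i) ([0..<N] ! j)) = M S"
        using aN by (intro eq_matI) (auto simp: F_def G_def M_def A_def nth_append a_def)
      then have "cmod (det (M S)) = vdm (F @ G) [0..<N]" by (simp add: vdm_def)
      also have "\<dots> = vdm (F @ G) (us @ vs)"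
        using ms aN by (intro vdm_perm_cols) (auto simp: F_def G_def)
      also have "\<dots> = vdm F us * vdm G vs"
        using lus lvs by (intro vdm_block) (auto simp: F_def G_def)
      also have "vdm F us = vdm fs (map ((!) xs) us)"
        using lus by (intro vdm_cong) (auto simp: F_def a_def intro: nth_mem)
      also have "vdm G vs = vdm gs (map ((!) xs) vs)"
      proof (intro vdm_cong)
        fix i j assume "i < length G" "j < length G"
        then have "vs ! j \<in> set vs" "i < N - a" using lvs by (auto simp: G_def)
        then show "(G ! i) (vs ! j) = (gs ! i) (map ((!) xs) vs ! j)"
          using lus lvs \<open>j < length G\<close> by (auto simp: G_def)
      qed (use lvs len in \<open>auto simp: G_def N_def a_def\<close>)
      also have "vdm fs (map ((!) xs) us) * vdm gs (map ((!) xs) vs) \<le> B1 * B2"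
        using lus lvs S len by (intro mult_mono B1 B2) (auto simp: a_def N_def nn)
      finally show ?thesis .
    qed
  qed
  also have "\<dots> = 2 ^ N * (B1 * B2)" by (simp add: card_Pow)
  finally show ?thesis using len by (simp add: vdm_def A_def N_def)
qed

lemma vdm_lower_triangular:
  assumes "length xs = length fs"
    and "\<And>i j. i < j \<Longrightarrow> j < length fs \<Longrightarrow> (fs ! i) (xs ! j) = 0"
  shows "vdm fs xs = (\<Prod>i<length fs. cmod ((fs ! i) (xs ! i)))"
proof -
  define n where "n = length fs"
  define A where "A = mat n n (\<lambda>(i, j). (fs ! i) (xs ! j))"
  have A: "A \<in> carrier_mat n n" by (simp add: A_def)
  have "det A = prod_list (diag_mat A)"
    by (rule det_lower_triangular[OF _ A]) (use assms in \<open>auto simp: A_def n_def\<close>)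
  also have "\<dots> = (\<Prod>i<n. (fs ! i) (xs ! i))"
    by (simp add: diag_mat_def A_def prod.list_conv_set_nth atLeast0LessThan)
  finally show ?thesis by (simp add: vdm_def A_def n_def prod_norm)
qed

lemma vdm_zero_iff_dependent_rows:
  assumes "length xs = length fs"
  shows "vdm fs xs = 0 \<longleftrightarrow> (\<exists>v. (\<exists>i<length fs. v i \<noteq> 0) \<and> (\<forall>x\<in>set xs. (\<Sum>i<length fs. v i * (fs ! i) x) = 0))"
    (is "?l \<longleftrightarrow> ?r")
proof -
  define n where "n = length fs"
  define A where "A = mat n n (\<lambda>(i, j). (fs ! i) (xs ! j))"
  have A: "A \<in> carrier_mat n n" by (simp add: A_def)
  have "?l \<longleftrightarrow> det (transpose_mat A) = 0"
    using det_transpose[OF A] by (simp add: vdm_def A_def n_def)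
  also have "\<dots> \<longleftrightarrow> (\<exists>v. v \<in> carrier_vec n \<and> v \<noteq> 0\<^sub>v n \<and> transpose_mat A *\<^sub>v v = 0\<^sub>v n)"
    using A by (intro det_0_iff_vec_prod_zero_field) simp
  also have "\<dots> \<longleftrightarrow> ?r"
  proof
    assume "\<exists>v. v \<in> carrier_vec n \<and> v \<noteq> 0\<^sub>v n \<and> transpose_mat A *\<^sub>v v = 0\<^sub>v n"
    then obtain v where v: "v \<in> carrier_vec n" "v \<noteq> 0\<^sub>v n" "transpose_mat A *\<^sub>v v = 0\<^sub>v n" by auto
    have "\<exists>i<n. v $ i \<noteq> 0"
    proof (rule ccontr)
      assume "\<not> ?thesis"
      then have "v = 0\<^sub>v n" using v(1) by (intro eq_vecI) auto
      with v show False by simp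
    qed
    moreover have "(\<Sum>i<n. v $ i * (fs ! i) x) = 0" if x: "x \<in> set xs" for x
    proof -
      obtain j where j: "j < n" "x = xs ! j" using x assms by (auto simp: in_set_conv_nth n_def)
      have "0 = (transpose_mat A *\<^sub>v v) $ j" using v j by simp
      also have "\<dots> = (\<Sum>i<n. v $ i * (fs ! i) x)"
        using j v(1) A by (auto simp: scalar_prod_def A_def atLeast0LessThan mult.commute intro!: sum.cong)
      finally show ?thesis by simp
    qed
    ultimately show ?r by (auto simp: n_def)
  next
    assume ?r
    then obtain v i where v: "i < n" "v i \<noteq> 0" "\<forall>x\<in>set xs. (\<Sum>i<n. v i * (fs ! i) x) = 0"
      by (auto simp: n_def)
    define w where "w = vec n v"
    have "transpose_mat A *\<^sub>v w = 0\<^sub>v n"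
    proof (rule eq_vecI)
      fix j assume "j < dim_vec (0\<^sub>v n :: complex vec)"
      then have j: "j < n" by simp
      have "(transpose_mat A *\<^sub>v w) $ j = (\<Sum>i<n. v i * (fs ! i) (xs ! j))"
        using j A by (auto simp: w_def scalar_prod_def A_def atLeast0LessThan mult.commute intro!: sum.cong)
      also have "\<dots> = 0" using v(3) j assms by (simp add: n_def)
      finally show "(transpose_mat A *\<^sub>v w) $ j = 0\<^sub>v n $ j" using j by simp
    qed (use A in auto)
    moreover have "w \<noteq> 0\<^sub>v n"
    proof
      assume "w = 0\<^sub>v n"
      then have "w $ i = 0" using v(1) by simp
      then show False using v by (simp add: w_def)
    qed
    ultimately show "\<exists>v. v \<in> carrier_vec n \<and> v \<noteq> 0\<^sub>v n \<and> transpose_mat A *\<^sub>v v = 0\<^sub>v n"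
      by (intro exI[of _ w]) (auto simp: w_def)
  qed
  finally show ?thesis .
qed

lemma vdm_pos_column_nonzero:
  assumes "vdm fs xs > 0" "length xs = length fs" "x \<in> set xs"
  shows "\<exists>f\<in>set fs. f x \<noteq> 0"
proof (rule ccontr)
  assume neg: "\<not> ?thesis"
  obtain j where j: "j < length fs" "xs ! j = x" using assms by (auto simp: in_set_conv_nth)
  have "vdm (map (\<lambda>x f. f x) xs) fs = 0"
    unfolding vdm_zero_iff_dependent_rows[of fs "map (\<lambda>x f. f x) xs", simplified, OF assms(2)[symmetric]]
    using neg j assms(2)
    by (intro exI[of _ "\<lambda>i. if i = j then 1 else 0"])
       (auto simp: if_distrib[of "\<lambda>u. u * _"] cong: if_cong intro!: sum.neutral)
  with assms vdm_transpose show False by (metis less_irrefl)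
qed

lemma vdm_pos_distinct_columns:
  assumes "vdm fs xs > 0" "length xs = length fs"
  shows "distinct xs"
proof (rule ccontr)
  assume "\<not> distinct xs"
  then obtain j k where jk: "j < length fs" "k < length fs" "j \<noteq> k" "xs ! j = xs ! k"
    using assms by (auto simp: distinct_conv_nth)
  have "vdm (map (\<lambda>x f. f x) xs) fs = 0"
  proof (rule vdm_zero_iff_dependent_rows[THEN iffD2], simp add: assms(2),
      intro exI[of _ "\<lambda>i. if i = j then 1 else if i = k then -1 else 0"] conjI ballI)
    fix f assume "f \<in> set fs"
    have "(\<Sum>i<length xs. (if i = j then 1 else if i = k then -1 else 0) * (map (\<lambda>x f. f x) xs ! i) f)
      = (\<Sum>i\<in>{j, k}. (if i = j then 1 else if i = k then -1 else 0) * (map (\<lambda>x f. f x) xs ! i) f)"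
      using jk assms(2) by (intro sum.mono_neutral_right) auto
    also have "\<dots> = 0" using jk assms(2) by auto
    finally show "(\<Sum>i<length (map (\<lambda>x f. f x) xs).
        (if i = j then 1 else if i = k then -1 else 0) * (map (\<lambda>x f. f x) xs ! i) f) = 0" by simp
  qed (use jk assms(2) in auto)
  with assms vdm_transpose show False by (metis less_irrefl)
qed

section \<open>Coefficient determinants of univariate polynomials\<close>

text \<open>A coefficient matrix is an instance of \<open>vdm\<close>: a polynomial is the function
  \<open>coeff p\<close> of the exponent, and exponents are the points. The value is meaningful when
  all degrees lie below the number of polynomials.\<close>

definition cvd :: "complex poly list \<Rightarrow> real" where
  "cvd ps = vdm (map coeff ps) [0..<length ps]"

text \<open>Degree below \<open>k\<close>, in a form that holds for the zero polynomial also when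
  \<open>k\<close> is 0, where \<open>degree p < k\<close> fails.\<close>

abbreviation deg_below :: "nat \<Rightarrow> complex poly \<Rightarrow> bool" where
  "deg_below k p \<equiv> (\<forall>j\<ge>k. coeff p j = 0)"

lemma deg_below_expand:
  assumes "deg_below k q"
  shows "q = (\<Sum>j<k. smult (coeff q j) (monom 1 j))"
proof (rule poly_eqI)
  fix n
  show "coeff q n = coeff (\<Sum>j<k. smult (coeff q j) (monom 1 j)) n"
    using assms by (simp add: coeff_sum if_distrib[of "\<lambda>u. _ * u"] cong: if_cong)
qed

lemma deg_below_mult:
  assumes "deg_below (Suc k) p" "deg_below l q"
  shows "deg_below (k + l) (p * q)"
proof (intro allI impI)
  fix j assume j: "k + l \<le> j"
  have "coeff p i * coeff q (j - i) = 0" for i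
    using assms j by (cases "i \<le> k") (auto intro: Suc_leI)
  then show "coeff (p * q) j = 0"
    unfolding coeff_mult by (intro sum.neutral) blast
qed

lemma deg_below_degree: "deg_below (Suc d) p \<longleftrightarrow> degree p \<le> d"
  by (meson Suc_le_eq coeff_eq_0 degree_le le_degree not_less_eq_eq order_less_le_trans)

lemma cvd_perm: "mset ps = mset qs \<Longrightarrow> cvd ps = cvd qs"
  unfolding cvd_def by (metis vdm_perm_rows mset_map mset_eq_length)

lemma cvd_transition:
  assumes "length hs = m" "length gs = m"
    and "\<And>i. i < m \<Longrightarrow>
      hs ! i = (\<Sum>j<length fs. smult (Y i j) (fs ! j)) + (\<Sum>j<m. smult (T i j) (gs ! j))"
  shows "cvd (fs @ hs) = vdm (map T [0..<m]) [0..<m] * cvd (fs @ gs)"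
proof -
  have "vdm (map coeff fs @ map coeff hs) [0..<length fs + m] =
     vdm (map T [0..<m]) [0..<m] * vdm (map coeff fs @ map coeff gs) [0..<length fs + m]"
    using assms by (intro vdm_transition[where Y = Y]) (auto simp: coeff_sum)
  then show ?thesis using assms by (simp add: cvd_def)
qed

text \<open>One block of rows of a Sylvester matrix. Two blocks of length d, for \<open>A\<close>
  and \<open>B\<close>, give the modulus of the resultant.\<close>

definition shifts :: "complex poly \<Rightarrow> nat \<Rightarrow> complex poly list" where
  "shifts A k = map (\<lambda>i. A * monom 1 i) [0..<k]"

lemma length_shifts [simp]: "length (shifts A k) = k"
  by (simp add: shifts_def)

lemma shifts_expand:
  assumes "deg_below k q"
  shows "A * q = (\<Sum>j<k. smult (coeff q j) (shifts A k ! j))"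
  by (subst deg_below_expand[OF assms]) (simp add: sum_distrib_left shifts_def)

lemma poly_mod_sum: "(\<Sum>j\<in>S. f j) mod (A :: complex poly) = (\<Sum>j\<in>S. f j mod A)"
  by (induction S rule: infinite_finite_induct) (auto simp: poly_mod_add_left)

lemma deg_below_div_mod:
  assumes "degree A = d" "1 \<le> d" "deg_below (k + d) c"
  shows "deg_below k (c div A)" "deg_below d (c mod A)"
proof -
  have A0: "A \<noteq> 0" using assms by auto
  show "deg_below d (c mod A)"
    using degree_mod_less[OF A0, of c] assms(1) by (auto intro: coeff_eq_0)
  show "deg_below k (c div A)"
  proof (cases "c div A = 0")
    case False
    have "c \<noteq> 0" using False by auto
    have "degree (A * (c div A)) = d + degree (c div A)"
      using False A0 assms by (simp add: degree_mult_eq)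
    moreover have "degree c = degree (A * (c div A))"
    proof (cases "c mod A = 0")
      case True
      then show ?thesis by (metis add.right_neutral mult_div_mod_eq)
    next
      case False
      then have "degree (c mod A) < degree (A * (c div A))"
        using degree_mod_less[OF A0, of c] assms calculation by auto
      then show ?thesis by (metis degree_add_eq_left mult_div_mod_eq)
    qed
    ultimately have "degree c = d + degree (c div A)" by simp
    moreover have "degree c < k + d"
      using assms(3) \<open>c \<noteq> 0\<close> leading_coeff_neq_0 not_le by blast
    ultimately show ?thesis by (auto intro: coeff_eq_0)
  qed auto
qed

text \<open>Multiples of \<open>A\<close> may be subtracted from the polynomials in
  \<open>cs\<close>, so only their remainders, elements of the d-dimensional space C[x]/(A), enter
  the determinant.\<close>

lemma cvd_shifts_append:
  assumes d: "degree A = d" "1 \<le> d" and cs: "length cs = d" "\<And>c. c \<in> set cs \<Longrightarrow> deg_below (k + d) c"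
  shows "cvd (shifts A k @ cs) =
    cmod (lead_coeff A) ^ k * vdm (map (\<lambda>c. coeff (c mod A)) cs) [0..<d]"
proof -
  define ms :: "complex poly list" where "ms = map (monom 1) [0..<d]"
  have "cvd (shifts A k @ cs) = vdm (map (\<lambda>i. coeff (cs ! i mod A)) [0..<d]) [0..<d] * cvd (shifts A k @ ms)"
  proof (rule cvd_transition[where Y = "\<lambda>i. coeff (cs ! i div A)"])
    fix i assume i: "i < d"
    have db: "deg_below (k + d) (cs ! i)" using cs i by simp
    note dm = deg_below_div_mod[OF d db]
    have "cs ! i = A * (cs ! i div A) + cs ! i mod A" by simp
    also have "A * (cs ! i div A) = (\<Sum>j<k. smult (coeff (cs ! i div A) j) (shifts A k ! j))"
      by (rule shifts_expand[OF dm(1)])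
    also have "cs ! i mod A = (\<Sum>j<d. smult (coeff (cs ! i mod A) j) (ms ! j))"
      by (subst deg_below_expand[OF dm(2)]) (simp add: ms_def)
    finally show "cs ! i = (\<Sum>j<length (shifts A k). smult (coeff (cs ! i div A) j) (shifts A k ! j)) +
        (\<Sum>j<d. smult (coeff (cs ! i mod A) j) (ms ! j))" by simp
  qed (use cs in \<open>auto simp: ms_def\<close>)
  also have "map (\<lambda>i. coeff (cs ! i mod A)) [0..<d] = map (\<lambda>c. coeff (c mod A)) cs"
    using cs by (auto intro: nth_equalityI)
  \<comment> \<open>With the low monomials in front the matrix is block triangular, and on the
    exponents from d to d + k - 1 the multiples of \<open>A\<close> are triangular with the leading
    coefficient on the diagonal.\<close>
  also have "cvd (shifts A k @ ms) = cvd (ms @ shifts A k)"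
    by (rule cvd_perm) simp
  also have "\<dots> = vdm (map coeff ms @ map coeff (shifts A k)) ([0..<d] @ [d..<d + k])"
    by (simp add: cvd_def ms_def upt_add_eq_append[symmetric])
  also have "\<dots> = vdm (map coeff ms) [0..<d] * vdm (map coeff (shifts A k)) [d..<d + k]"
    by (rule vdm_block) (auto simp: ms_def)
  also have "vdm (map coeff ms) [0..<d] = 1"
    by (subst vdm_lower_triangular) (auto simp: ms_def)
  also have "vdm (map coeff (shifts A k)) [d..<d + k] = cmod (lead_coeff A) ^ k"
    using d by (subst vdm_lower_triangular) (auto simp: shifts_def coeff_eq_0 coeff_monom_mult mult.commute[of A])
  finally show ?thesis by simp
qed

text \<open>Multiplicativity of the resultant. By \<open>cvd_shifts_append\<close> both sides are
  determinants on C[x]/(A), where multiplication by \<open>B\<close> has the remainders of the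
  \<open>B\<close> x^i as its matrix. The powers of the leading coefficient match because k + d
  shifts on the left face k and d on the right.\<close>

lemma cvd_shifts_mult:
  assumes d: "degree A = d" "1 \<le> d" and B: "deg_below (Suc d) B"
    and cs: "length cs = d" "\<And>c. c \<in> set cs \<Longrightarrow> deg_below (k + d) c"
  shows "cvd (shifts A (k + d) @ map ((*) B) cs) =
    cvd (shifts A d @ shifts B d) * cvd (shifts A k @ cs)"
proof -
  define b where "b = vdm (map (\<lambda>c. coeff (c mod A)) (shifts B d)) [0..<d]"
  define l where "l = cmod (lead_coeff A)"
  have "cvd (shifts A (k + d) @ map ((*) B) cs) =
      l ^ (k + d) * vdm (map (\<lambda>c. coeff (c mod A)) (map ((*) B) cs)) [0..<d]"
    unfolding l_def
  proof (rule cvd_shifts_append[OF d])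
    fix c assume "c \<in> set (map ((*) B) cs)"
    then obtain c' where c': "c' \<in> set cs" "c = B * c'" by auto
    show "deg_below (k + d + d) c"
      using deg_below_mult[OF B cs(2)[OF c'(1)]] c' by (simp add: add_ac)
  qed (use cs in auto)
  also have "vdm (map (\<lambda>c. coeff (c mod A)) (map ((*) B) cs)) [0..<d] =
      vdm ([] @ map (\<lambda>c. coeff ((B * c) mod A)) cs) [0..<d]" by (simp add: o_def)
  \<comment> \<open>Modulo \<open>A\<close>, the product of \<open>B\<close> and c is the
    combination of the \<open>B\<close> x^j with the coefficients of \<open>c mod A\<close>. No
    unchanged rows are involved, hence the empty list.\<close>
  also have "\<dots> = vdm (map (\<lambda>i. coeff (cs ! i mod A)) [0..<d]) [0..<d] *
      vdm ([] @ map (\<lambda>c. coeff (c mod A)) (shifts B d)) [0..<d]"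
  proof (rule vdm_transition[where Y = "\<lambda>_ _. 0"])
    fix i x assume i: "i < d"
    have db: "deg_below (k + d) (cs ! i)" using cs i by simp
    have "B * (cs ! i) mod A = B * (cs ! i mod A) mod A" by (simp add: mod_mult_right_eq)
    also have "\<dots> = (\<Sum>j<d. smult (coeff (cs ! i mod A) j) (shifts B d ! j)) mod A"
      by (subst shifts_expand[OF deg_below_div_mod(2)[OF d db]]) simp
    also have "\<dots> = (\<Sum>j<d. smult (coeff (cs ! i mod A) j) (shifts B d ! j mod A))"
      by (simp add: poly_mod_sum mod_smult_left)
    finally show "(map (\<lambda>c. coeff ((B * c) mod A)) cs ! i) x =
      (\<Sum>j<length []. 0 * ([] ! j) x) + (\<Sum>j<d. coeff (cs ! i mod A) j * (map (\<lambda>c. coeff (c mod A)) (shifts B d) ! j) x)"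
      using i cs by (simp add: coeff_sum)
  qed (use cs in auto)
  also have "map (\<lambda>i. coeff (cs ! i mod A)) [0..<d] = map (\<lambda>c. coeff (c mod A)) cs"
    using cs by (auto intro: nth_equalityI)
  finally have 1: "cvd (shifts A (k + d) @ map ((*) B) cs) =
      l ^ (k + d) * (vdm (map (\<lambda>c. coeff (c mod A)) cs) [0..<d] * b)" by (simp add: b_def)
  have 2: "cvd (shifts A k @ cs) = l ^ k * vdm (map (\<lambda>c. coeff (c mod A)) cs) [0..<d]"
    unfolding l_def by (rule cvd_shifts_append[OF d cs])
  have 3: "cvd (shifts A d @ shifts B d) = l ^ d * b"
    unfolding l_def b_def
  proof (rule cvd_shifts_append[OF d])
    fix c assume "c \<in> set (shifts B d)"
    then obtain i where i: "i < d" "c = B * monom 1 i" by (auto simp: shifts_def)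
    have "deg_below d (monom 1 i :: complex poly)" using i by auto
    from deg_below_mult[OF B this] show "deg_below (d + d) c" using i by simp
  qed auto
  show ?thesis by (simp add: 1 2 3 power_add)
qed

section \<open>Sylvester matrices and graded bases\<close>

lemma cvd_zero_imp_dependent:
  assumes "cvd ps = 0" "\<And>p. p \<in> set ps \<Longrightarrow> deg_below (length ps) p"
  shows "\<exists>v. (\<exists>i<length ps. v i \<noteq> 0) \<and> (\<Sum>i<length ps. smult (v i) (ps ! i)) = 0"
proof -
  define n where "n = length ps"
  have "\<exists>v. (\<exists>i<length (map coeff ps). v i \<noteq> 0) \<and>
      (\<forall>x\<in>set [0..<n]. (\<Sum>i<length (map coeff ps). v i * (map coeff ps ! i) x) = 0)"
    using assms(1) by (subst vdm_zero_iff_dependent_rows[symmetric]) (auto simp: cvd_def n_def)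
  then obtain v where v: "\<exists>i<n. v i \<noteq> 0" "\<forall>x<n. (\<Sum>i<n. v i * (map coeff ps ! i) x) = 0"
    unfolding n_def length_map set_upt atLeast0LessThan by blast
  have "(\<Sum>i<n. smult (v i) (ps ! i)) = 0"
  proof (rule poly_eqI)
    fix x
    show "coeff (\<Sum>i<n. smult (v i) (ps ! i)) x = coeff 0 x"
      using v(2)[rule_format, of x] assms(2) nth_mem[of _ ps]
      by (cases "x < n") (auto simp: coeff_sum n_def not_less intro!: sum.neutral)
  qed
  with v show ?thesis by (auto simp: n_def)
qed

lemma sum_lessThan_add: "(\<Sum>i<m + n. f i) = (\<Sum>i<m. f i) + (\<Sum>i<n. f (m + i))"
  for f :: "nat \<Rightarrow> 'a::comm_monoid_add"
  by (induction n) (auto simp: add_ac)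

lemma deg_below_shifts:
  assumes "deg_below (Suc d) A" "p \<in> set (shifts A k)"
  shows "deg_below (d + k) p"
proof -
  obtain i where i: "i < k" "p = A * monom 1 i" using assms(2) by (auto simp: shifts_def)
  have "deg_below k (monom 1 i :: complex poly)" using i by auto
  from deg_below_mult[OF assms(1) this] show ?thesis using i by simp
qed

text \<open>Over the complex numbers a nonconstant \<open>A\<close> has a root, which must be a root
  of \<open>w\<close>; cancelling the linear factor lowers the degree of \<open>A\<close>.\<close>

lemma dvd_mult_no_common_root:
  fixes A B w :: "complex poly"
  assumes "A \<noteq> 0" "A dvd w * B" "\<And>t. poly A t = 0 \<Longrightarrow> poly B t \<noteq> 0"
  shows "A dvd w"
  using assms
proof (induction "degree A" arbitrary: A w rule: less_induct)
  case less
  show ?case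
  proof (cases "degree A = 0")
    case True
    then show ?thesis using less.prems(1) is_unit_iff_degree unit_imp_dvd by blast
  next
    case False
    then obtain t where t: "poly A t = 0"
      using fundamental_theorem_of_algebra[of A] by (auto simp: constant_degree)
    then obtain A' where A': "A = [:-t, 1:] * A'" by (metis poly_eq_0_iff_dvd dvd_def)
    have "poly (w * B) t = 0" using less.prems(2) t by (metis dvd_trans poly_eq_0_iff_dvd)
    then have "poly w t = 0" using less.prems(3)[OF t] by simp
    then obtain w' where w': "w = [:-t, 1:] * w'" by (metis poly_eq_0_iff_dvd dvd_def)
    have nz: "[:-t, 1:] \<noteq> 0" "A' \<noteq> 0" using A' less.prems(1) by auto
    have "[:-t, 1:] * A' dvd [:-t, 1:] * (w' * B)"
      using less.prems(2) unfolding A' w' by (simp only: mult.assoc)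
    then have "A' dvd w' * B" using nz by (simp only: dvd_mult_cancel_left) simp
    moreover have "degree A' < degree A" using nz unfolding A' by (subst degree_mult_eq) auto
    moreover have "poly B s \<noteq> 0" if "poly A' s = 0" for s
      using less.prems(3)[of s] that by (simp add: A')
    ultimately have "A' dvd w'" using less.hyps nz by blast
    then show ?thesis unfolding A' w' by (rule mult_dvd_mono[OF dvd_refl])
  qed
qed

text \<open>A vanishing determinant gives u and w of degree below d, not both zero, with A u + B w =
  0. Without common roots \<open>A\<close> divides w, and since \<open>A\<close> has degree exactly
  d this forces w = 0 and then u = 0. The degree of \<open>B\<close> may drop, which means that its
  form vanishes at infinity.\<close>

lemma cvd_sylvester_pos:
  assumes A: "degree A = d" "1 \<le> d" and B: "deg_below (Suc d) B"
    and cop: "\<And>t. poly A t = 0 \<Longrightarrow> poly B t \<noteq> 0"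
  shows "cvd (shifts A d @ shifts B d) > 0"
proof (rule ccontr)
  assume "\<not> ?thesis"
  then have "cvd (shifts A d @ shifts B d) = 0"
    by (auto simp: cvd_def not_less intro: antisym)
  moreover have A': "deg_below (Suc d) A" using A by (simp add: deg_below_degree)
  ultimately obtain v where v: "\<exists>i<d + d. v i \<noteq> 0"
    "(\<Sum>i<d + d. smult (v i) ((shifts A d @ shifts B d) ! i)) = 0"
    using cvd_zero_imp_dependent[of "shifts A d @ shifts B d"] deg_below_shifts[OF A'] deg_below_shifts[OF B]
    by auto blast
  define u w where "u = (\<Sum>i<d. smult (v i) (monom 1 i))" and "w = (\<Sum>i<d. smult (v (d + i)) (monom 1 i))"
  have cu: "coeff u j = (if j < d then v j else 0)" and cw: "coeff w j = (if j < d then v (d + j) else 0)" for j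
    by (simp_all add: u_def w_def coeff_sum if_distrib[of "\<lambda>u. _ * u"] cong: if_cong)
  have eq: "A * u + B * w = 0"
    using v(2) unfolding sum_lessThan_add
    by (simp add: u_def w_def sum_distrib_left nth_append shifts_def)
  then have "A dvd w * B"
    by (metis add.commute add_eq_0_iff dvd_minus_iff dvd_triv_left mult.commute)
  moreover have "A \<noteq> 0" using A by auto
  ultimately have "A dvd w" using cop dvd_mult_no_common_root by blast
  have w0: "w = 0"
  proof (rule ccontr)
    assume "w \<noteq> 0"
    then have "degree A \<le> degree w" using \<open>A dvd w\<close> by (simp add: dvd_imp_degree_le)
    moreover have "coeff w (degree w) \<noteq> 0" using \<open>w \<noteq> 0\<close> by simp
    ultimately show False using cw[of "degree w"] A by simp
  qed
  moreover have "A \<noteq> 0" using A by auto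
  ultimately have "u = 0" using eq by simp
  have "v i = 0" if "i < d + d" for i
  proof (cases "i < d")
    case True
    then show ?thesis using cu[of i] \<open>u = 0\<close> by simp
  next
    case False
    then have "i - d < d" "d + (i - d) = i" using that by auto
    then show ?thesis using cw[of "i - d"] w0 by simp
  qed
  with v(1) show False by blast
qed

text \<open>Origin of the generators of degree d + r. The first r + 1 shifts of \<open>A\<close> and
  of \<open>B\<close> are rows of a nonsingular matrix, so some minor of full size 2 (r + 1) is
  nonzero. Its columns are exponents at most d + r, and the d - 1 - r complementary exponents
  \<open>js\<close> give monomials that complete these shifts to a basis of the polynomials of
  degree at most d + r.\<close>

lemma cvd_sylvester_extend:
  assumes pos: "cvd (shifts A d @ shifts B d) > 0" and r: "r < d"
    and AB: "deg_below (Suc d) A" "deg_below (Suc d) B"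
  shows "\<exists>js. distinct js \<and> length js = d - 1 - r \<and> (\<forall>j\<in>set js. j \<le> d + r) \<and>
    cvd (shifts A (Suc r) @ shifts B (Suc r) @ map (monom 1) js) > 0"
proof -
  define fs where "fs = map coeff (shifts A (Suc r) @ shifts B (Suc r))"
  define rest where "rest C = map (\<lambda>i. coeff (C * monom 1 i)) [Suc r..<d]" for C :: "complex poly"
  define gs where "gs = rest A @ rest B"
  have upt: "[0..<d] = [0..<Suc r] @ [Suc r..<d]"
    using r upt_add_eq_append[of 0 "Suc r" "d - Suc r"] by simp
  have sp: "map coeff (shifts C d) = map coeff (shifts C (Suc r)) @ rest C" for C
    by (simp add: shifts_def upt rest_def del: upt_Suc)
  have lfs: "length fs = 2 * Suc r" "length gs = 2 * (d - Suc r)"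
    by (auto simp: fs_def gs_def rest_def)
  have "mset (map coeff (shifts A d @ shifts B d)) = mset (fs @ gs)"
    by (simp add: sp fs_def gs_def add_ac)
  then have *: "cvd (shifts A d @ shifts B d) = vdm (fs @ gs) [0..<d + d]"
    unfolding cvd_def by (metis vdm_perm_rows length_append length_shifts)
  define C where "C = Max (insert 0 {cmod (g y) | g y. g \<in> set gs \<and> y \<in> set [0..<d + d]})"
  have "finite {cmod (g y) | g y. g \<in> set gs \<and> y \<in> set [0..<d + d]}"
    by (rule finite_subset[of _ "(\<lambda>(g, y). cmod (g y)) ` (set gs \<times> set [0..<d + d])"]) auto
  then have C: "0 \<le> C" "\<And>g y. g \<in> set gs \<Longrightarrow> y \<in> set [0..<d + d] \<Longrightarrow> cmod (g y) \<le> C"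
    unfolding C_def by (auto intro!: Max_ge simp del: Max_insert)
  \<comment> \<open>If all maximal minors of \<open>fs\<close> vanished, the Laplace estimate with
    bound 0 for \<open>fs\<close> would make the resultant 0. The constant \<open>C\<close> only
    supplies some bound for the remaining rows.\<close>
  have "\<exists>ys. set ys \<subseteq> set [0..<d + d] \<and> length ys = length fs \<and> vdm fs ys > 0"
  proof (rule ccontr)
    assume neg: "\<not> ?thesis"
    have "vdm (fs @ gs) [0..<d + d] \<le> 2 ^ length [0..<d + d] * (0 * (fact (length gs) * C ^ length gs))"
    proof (rule vdm_append_le)
      show "0 \<le> fact (length gs) * C ^ length gs" using C(1) by simp
      fix ys assume ys: "set ys \<subseteq> set [0..<d + d]"
      show "vdm fs ys \<le> 0" if "length ys = length fs" using neg ys that by (meson not_less)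
      show "vdm gs ys \<le> fact (length gs) * C ^ length gs" if "length ys = length gs"
        using that C ys by (intro vdm_le_fact) blast+
    qed (use lfs r in simp_all)
    with pos * show False by simp
  qed
  then obtain ys where ys: "length ys = length fs" "vdm fs ys > 0" by blast
  have dys: "distinct ys" using vdm_pos_distinct_columns[OF ys(2) ys(1)] .
  \<comment> \<open>A column beyond d + r is zero on all of \<open>fs\<close>, so it cannot occur in
    a nonzero minor.\<close>
  have ysle: "y \<le> d + r" if "y \<in> set ys" for y
  proof (rule ccontr)
    assume "\<not> y \<le> d + r"
    moreover obtain f where f: "f \<in> set fs" "f y \<noteq> 0"
      using vdm_pos_column_nonzero[OF ys(2) ys(1)] \<open>y \<in> set ys\<close> by blast
    ultimately show False
      using deg_below_shifts[OF AB(1), of _ "Suc r"] deg_below_shifts[OF AB(2), of _ "Suc r"]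
      by (auto simp: fs_def)
  qed
  define js where "js = sorted_list_of_set ({0..d + r} - set ys)"
  have "card ({0..d + r} - set ys) = d + r + 1 - 2 * Suc r"
    using ysle dys ys(1) lfs by (subst card_Diff_subset) (auto simp: distinct_card)
  then have js: "distinct js" "set js = {0..d + r} - set ys" "length js = d - 1 - r"
    by (auto simp: js_def)
  have ms: "mset (js @ ys) = mset [0..<d + Suc r]"
  proof -
    have "set (js @ ys) = set [0..<d + Suc r]" by (auto simp: js(2) less_Suc_eq_le simp del: upt_Suc dest: ysle)
    moreover have "distinct (js @ ys)" using js dys by auto
    ultimately show ?thesis by (metis distinct_upt set_eq_iff_mset_eq_distinct)
  qed
  have "cvd (shifts A (Suc r) @ shifts B (Suc r) @ map (monom 1) js) =
      cvd (map (monom 1) js @ shifts A (Suc r) @ shifts B (Suc r))"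
    by (rule cvd_perm) (simp add: add_ac)
  also have "\<dots> = vdm (map coeff (map (monom 1) js) @ fs) [0..<d + Suc r]"
    using js r by (simp add: cvd_def fs_def del: upt_Suc)
  also have "\<dots> = vdm (map coeff (map (monom 1) js) @ fs) (js @ ys)"
    using js(3) r lfs by (intro vdm_perm_cols ms[symmetric]) simp
  also have "\<dots> = vdm (map coeff (map (monom 1) js)) js * vdm fs ys"
  proof (rule vdm_block)
    fix f y assume "f \<in> set (map coeff (map (monom 1) js))" "y \<in> set ys"
    then obtain j where "j \<in> set js" "f = coeff (monom 1 j)" by auto
    moreover have "j \<noteq> y" using js(2) \<open>y \<in> set ys\<close> calculation(1) by blast
    ultimately show "f y = 0" by simp
  qed (simp_all add: ys(1))
  also have "vdm (map coeff (map (monom 1) js)) js = 1"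
    using js(1) by (subst vdm_lower_triangular) (auto simp: nth_eq_iff_index_eq)
  finally have "cvd (shifts A (Suc r) @ shifts B (Suc r) @ map (monom 1) js) > 0" using ys(2) by simp
  moreover have "\<forall>j\<in>set js. j \<le> d + r" by (simp add: js(2))
  ultimately show ?thesis using js(1,3) by blast
qed

text \<open>\<open>z\<^sup>\<beta> f\<^sup>\<alpha>\<close>, with the leading part dehomogenised at \<open>z\<^sub>2 = 1\<close>.\<close>

definition up :: "complex poly \<Rightarrow> complex poly \<Rightarrow> (nat \<times> nat) \<times> (nat \<times> nat) \<Rightarrow> complex poly" where
  "up A B = (\<lambda>(\<beta>, \<alpha>). monom 1 (fst \<beta>) * A ^ fst \<alpha> * B ^ snd \<alpha>)"

text \<open>Indices of the products in degree d q + r. From one level to the next, those with a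
  positive power of the first component arise from the previous level by a factor \<open>A\<close>.
  The others are \<open>B ^ Suc q\<close> times the monomials of degree r, and \<open>B ^ q\<close>
  times the extra generators of degree d + r with first exponents in \<open>G r\<close>.\<close>

fun items :: "nat \<Rightarrow> (nat \<Rightarrow> nat list) \<Rightarrow> nat \<Rightarrow> nat \<Rightarrow> ((nat \<times> nat) \<times> (nat \<times> nat)) list" where
  "items d G 0 r = map (\<lambda>a. ((a, r - a), (0, 0))) [0..<Suc r]"
| "items d G (Suc q) r = map (\<lambda>(\<beta>, \<alpha>). (\<beta>, (Suc (fst \<alpha>), snd \<alpha>))) (items d G q r) @
     map (\<lambda>a. ((a, r - a), (0, Suc q))) [0..<Suc r] @ map (\<lambda>a. ((a, d + r - a), (0, q))) (G r)"

lemma set_items: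
  "(\<beta>, (i, j)) \<in> set (items d G q r) \<longleftrightarrow>
     (\<exists>a\<le>r. \<beta> = (a, r - a) \<and> i + j = q) \<or> (\<exists>a\<in>set (G r). \<beta> = (a, d + r - a) \<and> Suc (i + j) = q)"
proof (induction q arbitrary: i j)
  case 0
  show ?case by (auto simp: less_Suc_eq_le simp del: upt_Suc)
next
  case (Suc q)
  have "(\<beta>, (i, j)) \<in> set (items d G (Suc q) r) \<longleftrightarrow>
      (\<exists>i'. i = Suc i' \<and> (\<beta>, (i', j)) \<in> set (items d G q r)) \<or>
      (\<exists>a\<le>r. \<beta> = (a, r - a) \<and> i = 0 \<and> j = Suc q) \<or> (\<exists>a\<in>set (G r). \<beta> = (a, d + r - a) \<and> i = 0 \<and> j = q)"
    by (auto simp del: upt_Suc simp: image_iff less_Suc_eq_le) (force+)?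
  then show ?case unfolding Suc.IH by (cases i) auto
qed

lemma distinct_items:
  assumes "distinct (G r)"  "1 \<le> d"
  shows "distinct (items d G q r)"
proof (induction q)
  case 0
  show ?case by (auto simp: distinct_map inj_on_def simp del: upt_Suc)
next
  case (Suc q)
  have "inj (\<lambda>(\<beta> :: nat \<times> nat, \<alpha> :: nat \<times> nat). (\<beta>, (Suc (fst \<alpha>), snd \<alpha>)))"
    by (auto simp: inj_on_def prod_eq_iff)
  then have "distinct (map (\<lambda>(\<beta>, \<alpha>). (\<beta>, (Suc (fst \<alpha>), snd \<alpha>))) (items d G q r))"
    using Suc.IH by (simp add: distinct_map inj_on_subset[OF _ subset_UNIV])
  moreover have "distinct (map (\<lambda>a. ((a, r - a), (0::nat, Suc q))) [0..<Suc r])"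
    by (auto simp: distinct_map inj_on_def simp del: upt_Suc)
  moreover have "distinct (map (\<lambda>a. ((a, d + r - a), (0::nat, q))) (G r))"
    using assms by (auto simp: distinct_map inj_on_def)
  ultimately show ?case unfolding items.simps(2) distinct_append
    by (auto simp del: upt_Suc)
qed

lemma length_items:
  assumes "length (G r) = d - 1 - r" "r < d"
  shows "length (items d G q r) = d * q + r + 1"
  using assms by (induction q) (auto simp del: upt_Suc)

text \<open>Let U consist of the r + 1 shifts of \<open>B\<close> and the d - 1 - r extra monomials.
  The rows of level q + 1 are \<open>A\<close> times the rows of level q, together with
  \<open>B ^ q\<close> times U. The first group contributes the determinant of level q; the second
  contributes \<kappa> times R^q, one factor R for each multiplication by \<open>B\<close>. The
  exponents 0 + ... + (q - 1) add up to q (q - 1) / 2.\<close>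

lemma cvd_items:
  assumes A: "degree A = d" "1 \<le> d" and B: "deg_below (Suc d) B" and r: "r < d"
    and G: "length (G r) = d - 1 - r" "\<And>j. j \<in> set (G r) \<Longrightarrow> j \<le> d + r"
  shows "cvd (map (up A B) (items d G q r)) =
    cvd (shifts A (Suc r) @ shifts B (Suc r) @ map (monom 1) (G r)) ^ q *
    cvd (shifts A d @ shifts B d) ^ (q * (q - 1) div 2)"
proof -
  define \<kappa> R where "\<kappa> = cvd (shifts A (Suc r) @ shifts B (Suc r) @ map (monom 1) (G r))"
    and "R = cvd (shifts A d @ shifts B d)"
  define U where "U = shifts B (Suc r) @ map (monom 1) (G r)"
  define rows where "rows q = map (up A B) (items d G q r)" for q
  have A': "deg_below (Suc d) A" using A by (simp add: deg_below_degree)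
  have lr: "length (rows q) = d * q + r + 1" for q
    using length_items[of G r d q] G r by (simp add: rows_def)
  have lU: "length U = d" using G r by (simp add: U_def)
  have rec: "rows (Suc q) = map ((*) A) (rows q) @ map ((*) (B ^ q)) U" for q
    by (simp add: rows_def up_def U_def shifts_def o_def case_prod_unfold mult_ac del: upt_Suc)
  have dB: "deg_below (d * q + l) (B ^ q * p)" if "deg_below l p" for q l p
    using that
  proof (induction q)
    case (Suc q)
    then show ?case using deg_below_mult[OF B, of "d * q + l" "B ^ q * p"] by (simp add: mult_ac add_ac)
  qed simp
  have degU: "deg_below (Suc r + d) u" if "u \<in> set U" for u
    using that deg_below_shifts[OF B, of u "Suc r"] G by (fastforce simp: U_def add_ac)
  have deg: "deg_below (d * q + r + 1) p" if "p \<in> set (rows q)" for p q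
    using that
  proof (induction q arbitrary: p)
    case 0
    then show ?case by (auto simp: rows_def up_def simp del: upt_Suc)
  next
    case (Suc q)
    then consider p' where "p' \<in> set (rows q)" "p = A * p'" | u where "u \<in> set U" "p = B ^ q * u"
      unfolding rec by auto
    then show ?case
    proof cases
      case 1
      show ?thesis using deg_below_mult[OF A' Suc.IH[OF 1(1)]] 1 by (simp add: add_ac)
    next
      case 2
      show ?thesis using dB[OF degU[OF 2(1)]] 2 by (simp add: add_ac)
    qed
  qed
  \<comment> \<open>Each factor \<open>B\<close> is removed by \<open>cvd_shifts_mult\<close>, which
    also lowers the number of shifts of \<open>A\<close> by d.\<close>
  have step: "cvd (shifts A (d * q + Suc r) @ map ((*) (B ^ q)) U) = R ^ q * \<kappa>" for q
  proof (induction q)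
    case 0
    then show ?case by (simp add: \<kappa>_def U_def)
  next
    case (Suc q)
    have "cvd (shifts A (d * Suc q + Suc r) @ map ((*) (B ^ Suc q)) U) =
       cvd (shifts A ((d * q + Suc r) + d) @ map ((*) B) (map ((*) (B ^ q)) U))"
    proof -
      have "map ((*) (B ^ Suc q)) U = map ((*) B) (map ((*) (B ^ q)) U)" by (auto simp: mult.assoc)
      then show ?thesis by (simp only: mult_Suc_right add_ac)
    qed
    also have "\<dots> = R * cvd (shifts A (d * q + Suc r) @ map ((*) (B ^ q)) U)"
      unfolding R_def
    proof (rule cvd_shifts_mult[OF A B])
      fix c assume "c \<in> set (map ((*) (B ^ q)) U)"
      then obtain u where "u \<in> set U" "c = B ^ q * u" by auto
      then show "deg_below (d * q + Suc r + d) c" using dB[OF degU, of u q] by (simp only: add.assoc) blast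
    qed (use lU in auto)
    finally show ?case using Suc.IH by simp
  qed
  have "cvd (rows q) = \<kappa> ^ q * R ^ (q * (q - 1) div 2)"
  proof (induction q)
    case 0
    have "rows 0 = map (monom 1) [0..<Suc r]" by (simp add: rows_def up_def del: upt_Suc)
    moreover have "vdm (map coeff (map (monom 1) [0..<Suc r])) [0..<Suc r] = 1"
      by (subst vdm_lower_triangular) (auto simp del: upt_Suc)
    ultimately show ?case by (simp add: cvd_def del: upt_Suc)
  next
    case (Suc q)
    define n where "n = d * q + r + 1"
    have "cvd (rows (Suc q)) = cvd (map ((*) (B ^ q)) U @ map ((*) A) (rows q))"
      unfolding rec by (rule cvd_perm) simp
    \<comment> \<open>Level q consists of n polynomials of degree below n, so its multiples by
      \<open>A\<close> are combinations of the n shifts of \<open>A\<close>, and the transition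
      matrix is the coefficient matrix of level q.\<close>
    also have "\<dots> = vdm (map (\<lambda>i. coeff (rows q ! i)) [0..<n]) [0..<n] * cvd (map ((*) (B ^ q)) U @ shifts A n)"
    proof (rule cvd_transition[where Y = "\<lambda>_ _. 0"])
      fix i assume i: "i < n"
      then have "deg_below n (rows q ! i)" using deg[OF nth_mem, of i q] unfolding lr n_def by blast
      from shifts_expand[OF this, of A]
      show "map ((*) A) (rows q) ! i = (\<Sum>j<length (map ((*) (B ^ q)) U). smult 0 (map ((*) (B ^ q)) U ! j)) +
          (\<Sum>j<n. smult (coeff (rows q ! i) j) (shifts A n ! j))"
        using i lr by (simp add: n_def)
    qed (use lr in \<open>auto simp: n_def\<close>)
    also have "map (\<lambda>i. coeff (rows q ! i)) [0..<n] = map coeff (rows q)"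
      by (intro nth_equalityI) (simp_all add: lr n_def del: upt_Suc)
    also have "cvd (map ((*) (B ^ q)) U @ shifts A n) = cvd (shifts A (d * q + Suc r) @ map ((*) (B ^ q)) U)"
      by (rule cvd_perm) (simp add: n_def)
    also have "\<dots> = R ^ q * \<kappa>" by (rule step)
    also have "vdm (map coeff (rows q)) [0..<n] = cvd (rows q)"
      by (simp add: cvd_def lr n_def)
    finally have "cvd (rows (Suc q)) = \<kappa> ^ Suc q * R ^ (q * (q - 1) div 2 + q)"
      using Suc.IH by (simp add: power_add mult_ac)
    also have "q * (q - 1) div 2 + q = Suc q * (Suc q - 1) div 2"
      by (cases q) (auto simp: algebra_simps)
    finally show ?case .
  qed
  then show ?thesis by (simp add: rows_def \<kappa>_def R_def)
qed


text \<open>Bundles the properties of the basis so that they can be transferred when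
  \<open>A\<close> and \<open>B\<close> are exchanged. The bound 2 d holds because generators have
  degree r or d + r with r < d. The n + 1 indices of degree n match the n + 1 monomials of that
  degree.\<close>

definition graded_basis_for ::
    "nat \<Rightarrow> complex poly \<Rightarrow> complex poly \<Rightarrow> (nat \<times> nat) set \<Rightarrow> (nat \<Rightarrow> real) \<Rightarrow> bool" where
  "graded_basis_for d A B \<Gamma> \<kappa> \<longleftrightarrow> finite \<Gamma> \<and> card \<Gamma> = d\<^sup>2 \<and> (0, 0) \<in> \<Gamma> \<and>
    (\<forall>\<beta>\<in>\<Gamma>. total_deg \<beta> \<le> 2 * d) \<and> (\<forall>r. \<kappa> r > 0) \<and>
    (\<forall>n. \<exists>is. distinct is \<and> set is = {(\<beta>, \<alpha>). \<beta> \<in> \<Gamma> \<and> total_deg \<beta> + d * total_deg \<alpha> = n} \<and>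
      length is = Suc n \<and> cvd (map (up A B) is) = \<kappa> (n mod d) ^ (n div d) *
        cvd (shifts A d @ shifts B d) ^ (n div d * (n div d - 1) div 2))"

text \<open>Each residue r modulo d contributes r + 1 generators of degree r and d - 1 - r of degree
  d + r, hence d of them, and d^2 in all.\<close>

lemma graded_basis_aux:
  assumes A: "degree A = d" "1 \<le> d" and B: "deg_below (Suc d) B"
    and cop: "\<And>t. poly A t = 0 \<Longrightarrow> poly B t \<noteq> 0"
  shows "\<exists>\<Gamma> \<kappa>. graded_basis_for d A B \<Gamma> \<kappa>"
proof -
  have A': "deg_below (Suc d) A" using A by (simp add: deg_below_degree)
  have "\<forall>r. \<exists>js. r < d \<longrightarrow> distinct js \<and> length js = d - 1 - r \<and> (\<forall>j\<in>set js. j \<le> d + r) \<and>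
    cvd (shifts A (Suc r) @ shifts B (Suc r) @ map (monom 1) js) > 0"
    using cvd_sylvester_extend[OF cvd_sylvester_pos[OF A B cop] _ A' B] by blast
  then obtain G where G: "\<And>r. r < d \<Longrightarrow> distinct (G r)" "\<And>r. r < d \<Longrightarrow> length (G r) = d - 1 - r"
    "\<And>r j. r < d \<Longrightarrow> j \<in> set (G r) \<Longrightarrow> j \<le> d + r"
    "\<And>r. r < d \<Longrightarrow> cvd (shifts A (Suc r) @ shifts B (Suc r) @ map (monom 1) (G r)) > 0"
    by metis
  define S where "S r = (\<lambda>a. (a, r - a)) ` {..r} \<union> (\<lambda>a. (a, d + r - a)) ` set (G r)" for r
  define \<Gamma> where "\<Gamma> = (\<Union>r<d. S r)"
  \<comment> \<open>The value 1 from d on is a default that keeps \<kappa> positive everywhere; only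
    residues below d occur in the determinants.\<close>
  define \<kappa> where "\<kappa> r = (if r < d then cvd (shifts A (Suc r) @ shifts B (Suc r) @ map (monom 1) (G r)) else 1)" for r
  have deg: "total_deg \<beta> = r \<or> total_deg \<beta> = d + r" if "\<beta> \<in> S r" "r < d" for \<beta> r
    using that G(3) by (auto simp: S_def total_deg_def)
  have cS: "card (S r) = d" if r: "r < d" for r
  proof -
    have "card (S r) = card ((\<lambda>a. (a, r - a)) ` {..r}) + card ((\<lambda>a. (a, d + r - a)) ` set (G r))"
      unfolding S_def using r by (intro card_Un_disjoint) auto
    also have "card ((\<lambda>a. (a, r - a)) ` {..r}) = Suc r"
      by (subst card_image) (auto simp: inj_on_def)
    also have "card ((\<lambda>a. (a, d + r - a)) ` set (G r)) = d - 1 - r"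
      using G(1,2)[OF r] by (subst card_image) (auto simp: inj_on_def distinct_card)
    finally show ?thesis using r by simp
  qed
  have "card \<Gamma> = (\<Sum>r<d. card (S r))"
    unfolding \<Gamma>_def
  proof (rule card_UN_disjoint)
    show "\<forall>i\<in>{..<d}. \<forall>j\<in>{..<d}. i \<noteq> j \<longrightarrow> S i \<inter> S j = {}"
    proof (intro ballI impI equals0I)
      fix i j \<beta> assume "i \<in> {..<d}" "j \<in> {..<d}" "i \<noteq> j" "\<beta> \<in> S i \<inter> S j"
      then show False using deg[of \<beta> i] deg[of \<beta> j] by auto
    qed
  qed (auto simp: S_def)
  then have card: "card \<Gamma> = d\<^sup>2" by (simp add: cS power2_eq_square)
  have "(0, 0) \<in> S 0" by (simp add: S_def)
  then have zero: "(0, 0) \<in> \<Gamma>" using A(2) by (auto simp: \<Gamma>_def)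
  have "\<exists>is. distinct is \<and> set is = {(\<beta>, \<alpha>). \<beta> \<in> \<Gamma> \<and> total_deg \<beta> + d * total_deg \<alpha> = n} \<and>
      length is = Suc n \<and> cvd (map (up A B) is) = \<kappa> (n mod d) ^ (n div d) *
        cvd (shifts A d @ shifts B d) ^ (n div d * (n div d - 1) div 2)" for n
  proof (intro exI[of _ "items d G (n div d) (n mod d)"] conjI)
    define q r where "q = n div d" and "r = n mod d"
    have r: "r < d" and n: "n = d * q + r" using A(2) by (auto simp: q_def r_def)
    show "distinct (items d G (n div d) (n mod d))"
      using distinct_items[of G r d q] G(1) r A(2) by (simp add: q_def r_def)
    show "length (items d G (n div d) (n mod d)) = Suc n"
      unfolding q_def[symmetric] r_def[symmetric] using length_items[where G = G, OF G(2)[OF r] r, of q] n by simp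
    show "cvd (map (up A B) (items d G (n div d) (n mod d))) = \<kappa> (n mod d) ^ (n div d) *
        cvd (shifts A d @ shifts B d) ^ (n div d * (n div d - 1) div 2)"
    proof -
      have "\<kappa> r = cvd (shifts A (Suc r) @ shifts B (Suc r) @ map (monom 1) (G r))"
        using r by (simp add: \<kappa>_def)
      then show ?thesis unfolding q_def[symmetric] r_def[symmetric]
        by (simp only:) (rule cvd_items[where G = G, OF A B r G(2)[OF r] G(3)[OF r]])
    qed
    show "set (items d G (n div d) (n mod d)) = {(\<beta>, \<alpha>). \<beta> \<in> \<Gamma> \<and> total_deg \<beta> + d * total_deg \<alpha> = n}"
    proof (rule Set.set_eqI)
      fix x :: "(nat \<times> nat) \<times> (nat \<times> nat)"
      obtain \<beta> i j where x: "x = (\<beta>, (i, j))" by (metis surj_pair)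
      have "x \<in> set (items d G q r) \<longleftrightarrow> \<beta> \<in> \<Gamma> \<and> total_deg \<beta> + d * (i + j) = n"
      proof
        assume "x \<in> set (items d G q r)"
        then consider a where "a \<le> r" "\<beta> = (a, r - a)" "i + j = q"
          | a where "a \<in> set (G r)" "\<beta> = (a, d + r - a)" "Suc (i + j) = q"
          unfolding x set_items by blast
        then show "\<beta> \<in> \<Gamma> \<and> total_deg \<beta> + d * (i + j) = n"
        proof cases
          case 1
          then have "\<beta> \<in> S r" by (auto simp: S_def)
          then show ?thesis using 1 r n by (auto simp: \<Gamma>_def total_deg_def)
        next
          case 2
          then have "\<beta> \<in> S r" by (auto simp: S_def)
          moreover have "total_deg \<beta> = d + r" using 2 G(3)[OF r] by (simp add: total_deg_def)
          ultimately show ?thesis using 2(3) r n by (auto simp: \<Gamma>_def algebra_simps)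
        qed
      next
        assume *: "\<beta> \<in> \<Gamma> \<and> total_deg \<beta> + d * (i + j) = n"
        then obtain r' where r': "r' < d" "\<beta> \<in> S r'" by (auto simp: \<Gamma>_def)
        from r'(2) consider a where "a \<le> r'" "\<beta> = (a, r' - a)"
          | a where "a \<in> set (G r')" "\<beta> = (a, d + r' - a)" unfolding S_def by auto
        then show "x \<in> set (items d G q r)"
        proof cases
          case 1
          then have "r' + d * (i + j) = d * q + r" using * n by (simp add: total_deg_def)
          then have "r' = r" "i + j = q" using r r'(1)
            by (metis mod_less mod_mult_self2 add.commute, metis add.commute div_mult_self2 div_less add_0 not_less_zero)
          then show ?thesis unfolding x set_items using 1 by auto
        next
          case 2
          then have "total_deg \<beta> = d + r'" using G(3)[OF r'(1)] by (simp add: total_deg_def)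
          then have "r' + d * (Suc (i + j)) = d * q + r" using * n by (simp add: algebra_simps)
          then have "r' = r" "Suc (i + j) = q" using r r'(1)
            by (metis mod_less mod_mult_self2 add.commute, metis add.commute div_mult_self2 div_less add_0 not_less_zero)
          then show ?thesis unfolding x set_items using 2 by auto
        qed
      qed
      then show "x \<in> set (items d G (n div d) (n mod d)) \<longleftrightarrow>
          x \<in> {(\<beta>, \<alpha>). \<beta> \<in> \<Gamma> \<and> total_deg \<beta> + d * total_deg \<alpha> = n}"
        unfolding x q_def r_def by (simp add: total_deg_def)
    qed
  qed
  moreover have "finite \<Gamma>" by (auto simp: \<Gamma>_def S_def)
  moreover have "\<forall>\<beta>\<in>\<Gamma>. total_deg \<beta> \<le> 2 * d" using deg by (fastforce simp: \<Gamma>_def)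
  moreover have "\<forall>r. \<kappa> r > 0" using G(4) by (simp add: \<kappa>_def)
  ultimately show ?thesis using card zero unfolding graded_basis_for_def by blast
qed

text \<open>The construction divides by a polynomial of exact degree d. The absence of a common zero
  at infinity provides one, \<open>A\<close> or \<open>B\<close>, and in the second case the roles
  are exchanged.\<close>

lemma graded_basis:
  assumes d: "1 \<le> d" and AB: "deg_below (Suc d) A" "deg_below (Suc d) B"
    and lead: "coeff A d \<noteq> 0 \<or> coeff B d \<noteq> 0"
    and cop: "\<And>t. poly A t = 0 \<Longrightarrow> poly B t \<noteq> 0"
  obtains \<Gamma> :: "(nat \<times> nat) set" and \<kappa> :: "nat \<Rightarrow> real" and "is" :: "nat \<Rightarrow> ((nat \<times> nat) \<times> (nat \<times> nat)) list"
  where "cvd (shifts A d @ shifts B d) > 0" "finite \<Gamma>" "card \<Gamma> = d\<^sup>2" "(0, 0) \<in> \<Gamma>"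
    "\<And>\<beta>. \<beta> \<in> \<Gamma> \<Longrightarrow> total_deg \<beta> \<le> 2 * d" "\<And>r. \<kappa> r > 0"
    "\<And>n. distinct (is n)"
    "\<And>n. set (is n) = {(\<beta>, \<alpha>). \<beta> \<in> \<Gamma> \<and> total_deg \<beta> + d * total_deg \<alpha> = n}"
    "\<And>n. length (is n) = Suc n"
    "\<And>n. cvd (map (up A B) (is n)) = \<kappa> (n mod d) ^ (n div d) *
        cvd (shifts A d @ shifts B d) ^ (n div d * (n div d - 1) div 2)"
proof (cases "coeff A d = 0")
  case False
  have A: "degree A = d" using AB(1) False by (simp add: deg_below_degree le_antisym le_degree)
  obtain \<Gamma> \<kappa> where g: "graded_basis_for d A B \<Gamma> \<kappa>"
    using graded_basis_aux[OF A d AB(2)] cop by blast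
  note * = g[unfolded graded_basis_for_def]
  from choice[OF *[THEN conjunct2, THEN conjunct2, THEN conjunct2, THEN conjunct2, THEN conjunct2]] obtain "is" where "\<forall>n. distinct (is n) \<and> set (is n) = {(\<beta>, \<alpha>). \<beta> \<in> \<Gamma> \<and> total_deg \<beta> + d * total_deg \<alpha> = n} \<and>
      length (is n) = Suc n \<and> cvd (map (up A B) (is n)) = \<kappa> (n mod d) ^ (n div d) *
        cvd (shifts A d @ shifts B d) ^ (n div d * (n div d - 1) div 2)" ..
  then show thesis using * cvd_sylvester_pos[OF A d AB(2) cop] by (intro that[of \<Gamma> \<kappa> "is"]) blast+
next
  case True
  then have B: "degree B = d" using AB(2) lead by (simp add: deg_below_degree le_antisym le_degree)
  have cop': "\<And>t. poly B t = 0 \<Longrightarrow> poly A t \<noteq> 0" using cop by blast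
  have R: "cvd (shifts B d @ shifts A d) = cvd (shifts A d @ shifts B d)"
    by (rule cvd_perm) simp
  obtain \<Gamma> \<kappa> where g: "graded_basis_for d B A \<Gamma> \<kappa>"
    using graded_basis_aux[OF B d AB(1)] cop by blast
  note * = g[unfolded graded_basis_for_def R]
  from choice[OF *[THEN conjunct2, THEN conjunct2, THEN conjunct2, THEN conjunct2, THEN conjunct2]] obtain is0 where is0: "\<forall>n. distinct (is0 n) \<and> set (is0 n) = {(\<beta>, \<alpha>). \<beta> \<in> \<Gamma> \<and> total_deg \<beta> + d * total_deg \<alpha> = n} \<and>
      length (is0 n) = Suc n \<and> cvd (map (up B A) (is0 n)) = \<kappa> (n mod d) ^ (n div d) *
        cvd (shifts A d @ shifts B d) ^ (n div d * (n div d - 1) div 2)" ..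
  \<comment> \<open>Exchanging the two exponents in \<alpha> compensates for the exchange of
    \<open>A\<close> and \<open>B\<close> in \<open>up\<close>.\<close>
  define sw :: "(nat \<times> nat) \<times> (nat \<times> nat) \<Rightarrow> (nat \<times> nat) \<times> (nat \<times> nat)" where "sw = (\<lambda>(\<beta>, \<alpha>). (\<beta>, prod.swap \<alpha>))"
  have inj: "inj sw" by (auto simp: sw_def inj_on_def prod_eq_iff)
  have sw: "sw (sw x) = x" for x by (simp add: sw_def case_prod_unfold)
  define "is" where "is n = map sw (is0 n)" for n
  have "set (is n) = {(\<beta>, \<alpha>). \<beta> \<in> \<Gamma> \<and> total_deg \<beta> + d * total_deg \<alpha> = n}" for n
  proof -
    have "x \<in> sw ` set (is0 n) \<longleftrightarrow> sw x \<in> set (is0 n)" for x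
      using sw by (metis image_iff)
    then show ?thesis
      using is0 by (auto simp: is_def sw_def total_deg_def add.commute)
  qed
  moreover have "map (up A B) (is n) = map (up B A) (is0 n)" for n
    by (auto simp: is_def sw_def up_def case_prod_unfold mult_ac)
  moreover have "distinct (is n)" "length (is n) = Suc n" for n
    using is0 by (auto simp: is_def distinct_map inj_on_subset[OF inj subset_UNIV])
  ultimately show thesis using is0 * cvd_sylvester_pos[OF B d AB(1) cop']
    by (intro that[of \<Gamma> \<kappa> "is"]) (auto simp: R)
qed

section \<open>Polynomial functions in two variables\<close>

type_synonym fun2 = "complex \<times> complex \<Rightarrow> complex"

lemma finite_total_deg: "finite {\<gamma>. total_deg \<gamma> < n}" "finite {\<gamma>. total_deg \<gamma> \<le> n}"
  by (rule finite_subset[of _ "{..n} \<times> {..n}"]; auto simp: total_deg_def)+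

text \<open>Polynomials enter as functions because the rows of \<open>vdm\<close> are functions. The
  strict bound makes \<open>polys_below n\<close> the space of terms negligible against a form of
  degree n.\<close>

definition polys_below :: "nat \<Rightarrow> fun2 set" where
  "polys_below n = {F. \<exists>c. \<forall>z. F z = (\<Sum>\<gamma> | total_deg \<gamma> < n. c \<gamma> * monomial_at \<gamma> z)}"

lemma polys_below_monomial: "total_deg \<gamma> < n \<Longrightarrow> (\<lambda>z. a * monomial_at \<gamma> z) \<in> polys_below n"
  unfolding polys_below_def mem_Collect_eq
  by (rule exI[of _ "\<lambda>\<gamma>'. if \<gamma>' = \<gamma> then a else 0"])
     (auto simp: if_distrib[of "\<lambda>u. u * _"] sum.delta[OF finite_total_deg(1)] cong: if_cong)

lemma polys_below_zero: "(\<lambda>z. 0) \<in> polys_below n"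
  unfolding polys_below_def by (auto intro!: exI[of _ "\<lambda>_. 0"])

lemma polys_below_add: "F \<in> polys_below n \<Longrightarrow> G \<in> polys_below n \<Longrightarrow> (\<lambda>z. F z + G z) \<in> polys_below n"
proof -
  assume "F \<in> polys_below n" "G \<in> polys_below n"
  then obtain c c' where "\<forall>z. F z = (\<Sum>\<gamma> | total_deg \<gamma> < n. c \<gamma> * monomial_at \<gamma> z)"
    "\<forall>z. G z = (\<Sum>\<gamma> | total_deg \<gamma> < n. c' \<gamma> * monomial_at \<gamma> z)" by (auto simp: polys_below_def)
  then show ?thesis unfolding polys_below_def
    by (auto intro!: exI[of _ "\<lambda>\<gamma>. c \<gamma> + c' \<gamma>"] simp: ring_distribs sum.distrib)
qed

lemma polys_below_sum: "(\<And>i. i \<in> I \<Longrightarrow> F i \<in> polys_below n) \<Longrightarrow> (\<lambda>z. \<Sum>i\<in>I. F i z) \<in> polys_below n"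
  by (induction I rule: infinite_finite_induct) (auto intro: polys_below_zero polys_below_add)

lemma polys_belowE:
  assumes "F \<in> polys_below n"
  obtains c where "F = (\<lambda>z. \<Sum>\<gamma> | total_deg \<gamma> < n. c \<gamma> * monomial_at \<gamma> z)"
  using assms unfolding polys_below_def mem_Collect_eq by (auto simp: fun_eq_iff simp del: split_paired_All)

lemma monomial_at_mult:
  "monomial_at \<gamma> z * monomial_at \<delta> z = monomial_at (fst \<gamma> + fst \<delta>, snd \<gamma> + snd \<delta>) z"
  by (simp add: monomial_at_def power_add)

lemma polys_below_mult:
  assumes "F \<in> polys_below (Suc a)" "G \<in> polys_below b"
  shows "(\<lambda>z. F z * G z) \<in> polys_below (a + b)"
proof -
  obtain c c' where F: "F = (\<lambda>z. \<Sum>\<gamma> | total_deg \<gamma> < Suc a. c \<gamma> * monomial_at \<gamma> z)"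
    and G: "G = (\<lambda>z. \<Sum>\<gamma> | total_deg \<gamma> < b. c' \<gamma> * monomial_at \<gamma> z)"
    using assms by (auto elim!: polys_belowE)
  have "(\<lambda>z. \<Sum>\<gamma> | total_deg \<gamma> < Suc a. \<Sum>\<delta> | total_deg \<delta> < b.
      (c \<gamma> * c' \<delta>) * monomial_at (fst \<gamma> + fst \<delta>, snd \<gamma> + snd \<delta>) z) \<in> polys_below (a + b)"
    by (intro polys_below_sum polys_below_monomial) (auto simp: total_deg_def)
  moreover have "(\<lambda>z. F z * G z) = (\<lambda>z. \<Sum>\<gamma> | total_deg \<gamma> < Suc a. \<Sum>\<delta> | total_deg \<delta> < b.
      (c \<gamma> * c' \<delta>) * monomial_at (fst \<gamma> + fst \<delta>, snd \<gamma> + snd \<delta>) z)"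
    unfolding F G sum_product monomial_at_mult[symmetric] by (simp add: mult_ac)
  ultimately show ?thesis by simp
qed

lemma polys_below_mono:
  assumes "F \<in> polys_below m" "m \<le> n"
  shows "F \<in> polys_below n"
proof -
  obtain c where F: "F = (\<lambda>z. \<Sum>\<gamma> | total_deg \<gamma> < m. c \<gamma> * monomial_at \<gamma> z)"
    using assms by (auto elim!: polys_belowE)
  show ?thesis unfolding F
    using assms(2) by (intro polys_below_sum polys_below_monomial) auto
qed

text \<open>Homogenisation of \<open>p\<close> to degree n; setting the second variable to 1 gives
  back \<open>p\<close> if its degree is at most n.\<close>

definition hform :: "nat \<Rightarrow> complex poly \<Rightarrow> fun2" where
  "hform n p z = (\<Sum>b\<le>n. coeff p b * monomial_at (b, n - b) z)"

lemma hform_eq_poly: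
  assumes "degree p \<le> n" "snd z \<noteq> 0"
  shows "hform n p z = snd z ^ n * poly p (fst z / snd z)"
proof -
  have "poly p (fst z / snd z) = (\<Sum>b\<le>n. coeff p b * (fst z / snd z) ^ b)"
    using assms(1) unfolding poly_altdef
    by (intro sum.mono_neutral_left) (auto intro: coeff_eq_0)
  then show ?thesis using assms(2)
    by (auto simp: hform_def monomial_at_def sum_distrib_left power_divide power_diff mult_ac intro!: sum.cong)
qed

lemma hform_infinity:
  assumes "snd z = 0"
  shows "hform n p z = coeff p n * fst z ^ n"
proof -
  have "hform n p z = (\<Sum>b\<in>{n}. coeff p b * monomial_at (b, n - b) z)"
    unfolding hform_def using assms by (intro sum.mono_neutral_right) (auto simp: monomial_at_def)
  then show ?thesis by (simp add: monomial_at_def)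
qed

lemma coeff_mult_top:
  assumes "degree p \<le> a" "degree q \<le> b"
  shows "coeff (p * q) (a + b) = coeff p a * (coeff q b :: complex)"
proof -
  have "coeff (p * q) (a + b) = (\<Sum>i\<in>{a}. coeff p i * coeff q (a + b - i))"
    unfolding coeff_mult
  proof (intro sum.mono_neutral_right ballI)
    fix i assume i: "i \<in> {..a + b} - {a}"
    show "coeff p i * coeff q (a + b - i) = 0"
    proof (cases "i < a")
      case True
      then show ?thesis using assms by (simp add: coeff_eq_0)
    next
      case False
      then show ?thesis using assms i by (simp add: coeff_eq_0)
    qed
  qed auto
  then show ?thesis by simp
qed

text \<open>Off the line z2 = 0 homogenisation is evaluation at z1 / z2 rescaled by a power of z2;
  on that line only top coefficients survive, and these multiply.\<close>

lemma hform_mult: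
  assumes "degree p \<le> a" "degree q \<le> b"
  shows "hform (a + b) (p * q) z = hform a p z * hform b q z"
proof (cases "snd z = 0")
  case True
  then show ?thesis using coeff_mult_top[OF assms] by (simp add: hform_infinity power_add)
next
  case False
  moreover have "degree (p * q) \<le> a + b" using assms degree_mult_le[of p q] by linarith
  ultimately show ?thesis using assms by (simp add: hform_eq_poly power_add)
qed

lemma hform_in_polys_below: "hform n p \<in> polys_below (Suc n)"
  unfolding hform_def[abs_def]
  by (intro polys_below_sum polys_below_monomial) (auto simp: total_deg_def)

text \<open>\<open>F\<close> is a polynomial of degree at most n whose part of degree n is the
  homogenisation of \<open>p\<close>. The polynomial \<open>p\<close> may be zero, so products and
  powers need no case distinction.\<close>

definition leads :: "nat \<Rightarrow> complex poly \<Rightarrow> fun2 \<Rightarrow> bool" where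
  "leads n p F \<longleftrightarrow> degree p \<le> n \<and> (\<exists>H\<in>polys_below n. F = (\<lambda>z. hform n p z + H z))"

lemma leads_mult:
  assumes "leads a p F" "leads b q G"
  shows "leads (a + b) (p * q) (\<lambda>z. F z * G z)"
proof -
  obtain H K where H: "H \<in> polys_below a" "F = (\<lambda>z. hform a p z + H z)"
    and K: "K \<in> polys_below b" "G = (\<lambda>z. hform b q z + K z)"
    and deg: "degree p \<le> a" "degree q \<le> b" using assms by (auto simp: leads_def)
  have G: "G \<in> polys_below (Suc b)"
    unfolding K(2) by (intro polys_below_add hform_in_polys_below polys_below_mono[OF K(1)]) simp
  have "(\<lambda>z. hform a p z * K z + G z * H z) \<in> polys_below (a + b)"
    using polys_below_mult[OF hform_in_polys_below K(1)] polys_below_mult[OF G H(1)]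
    by (intro polys_below_add) (auto simp: add.commute)
  moreover have "(\<lambda>z. F z * G z) = (\<lambda>z. hform (a + b) (p * q) z + (hform a p z * K z + G z * H z))"
    by (auto simp: hform_mult[OF deg] H(2) K(2) algebra_simps)
  moreover have "degree (p * q) \<le> a + b" using deg degree_mult_le[of p q] by linarith
  ultimately show ?thesis unfolding leads_def by (intro conjI bexI)
qed

lemma leads_monomial: "leads (total_deg \<beta>) (monom 1 (fst \<beta>)) (monomial_at \<beta>)"
proof -
  have "hform (total_deg \<beta>) (monom 1 (fst \<beta>)) z = monomial_at \<beta> z" for z
    by (simp add: hform_def total_deg_def if_distrib[of "\<lambda>u. u * _"] cong: if_cong)
  moreover have "degree (monom (1::complex) (fst \<beta>)) \<le> total_deg \<beta>"
    by (simp add: total_deg_def degree_monom_eq)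
  ultimately show ?thesis unfolding leads_def by (auto intro!: bexI[OF _ polys_below_zero])
qed

lemma leads_power:
  assumes "leads d p F"
  shows "leads (d * i) (p ^ i) (\<lambda>z. F z ^ i)"
proof (induction i)
  case 0
  show ?case using leads_monomial[of "(0, 0)"] by (simp add: total_deg_def monomial_at_def[abs_def] monom_0 one_pCons)
next
  case (Suc i)
  then show ?case using leads_mult[OF assms Suc.IH] by simp
qed

definition top_poly :: "nat \<Rightarrow> bipoly \<Rightarrow> complex poly" where
  "top_poly d p = (\<Sum>k\<le>d. monom (top_coeff d p k) k)"

lemma coeff_top_poly: "coeff (top_poly d p) k = (if k \<le> d then top_coeff d p k else 0)"
  by (simp add: top_poly_def coeff_sum)

lemma hform_top_poly: "hform d (top_poly d p) z = binary_form d (top_coeff d p) z"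
  by (simp add: hform_def binary_form_def coeff_top_poly monomial_at_def mult.assoc)

lemma leads_bipoly_eval:
  assumes "\<forall>\<alpha>\<in>Poly_Mapping.keys p. total_deg \<alpha> \<le> d"
  shows "leads d (top_poly d p) (bipoly_eval p)"
proof -
  let ?t = "\<lambda>z \<alpha>. Poly_Mapping.lookup p \<alpha> * monomial_at \<alpha> z"
  let ?H = "\<lambda>z. \<Sum>\<alpha>\<in>{\<alpha>\<in>Poly_Mapping.keys p. total_deg \<alpha> < d}. ?t z \<alpha>"
  have "bipoly_eval p z = hform d (top_poly d p) z + ?H z" for z
  proof -
    have "bipoly_eval p z = (\<Sum>\<alpha>\<in>{\<alpha>\<in>Poly_Mapping.keys p. total_deg \<alpha> = d}. ?t z \<alpha>) + ?H z"
      unfolding bipoly_eval_def using assms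
      by (subst sum.union_disjoint[symmetric]) (auto intro!: sum.cong)
    also have "(\<Sum>\<alpha>\<in>{\<alpha>\<in>Poly_Mapping.keys p. total_deg \<alpha> = d}. ?t z \<alpha>) = (\<Sum>\<alpha>\<in>(\<lambda>b. (b, d - b)) ` {..d}. ?t z \<alpha>)"
    proof (rule sum.mono_neutral_left)
      show "{\<alpha> \<in> Poly_Mapping.keys p. total_deg \<alpha> = d} \<subseteq> (\<lambda>b. (b, d - b)) ` {..d}"
        by (auto simp: total_deg_def)
      show "\<forall>i\<in>(\<lambda>b. (b, d - b)) ` {..d} - {\<alpha> \<in> Poly_Mapping.keys p. total_deg \<alpha> = d}. ?t z i = 0"
        by (auto simp: total_deg_def in_keys_iff)
    qed auto
    also have "\<dots> = hform d (top_poly d p) z"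
      by (subst sum.reindex) (auto simp: inj_on_def hform_def coeff_top_poly top_coeff_def)
    finally show ?thesis .
  qed
  moreover have "?H \<in> polys_below d"
    by (intro polys_below_sum polys_below_monomial) auto
  moreover have "degree (top_poly d p) \<le> d"
    by (rule degree_le) (simp add: coeff_top_poly)
  ultimately show ?thesis unfolding leads_def by (auto simp: fun_eq_iff)
qed

section \<open>Monomial lists by degree, triangular change of basis and Vandermonde maxima\<close>

definition exps :: "nat \<Rightarrow> (nat \<times> nat) list" where
  "exps n = map (\<lambda>b. (b, n - b)) [0..<Suc n]"

definition all_exps :: "nat \<Rightarrow> (nat \<times> nat) list" where
  "all_exps n = concat (map exps [0..<n])"

lemma set_exps: "set (exps n) = {\<gamma>. total_deg \<gamma> = n}"
  by (auto simp: exps_def total_deg_def image_iff less_Suc_eq_le simp del: upt_Suc)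

lemma set_all_exps: "set (all_exps n) = {\<gamma>. total_deg \<gamma> < n}"
  by (auto simp: all_exps_def set_exps)

lemma distinct_exps: "distinct (exps n)"
  by (auto simp: exps_def distinct_map inj_on_def simp del: upt_Suc)

lemma distinct_all_exps: "distinct (all_exps n)"
  unfolding all_exps_def
proof (induction n)
  case (Suc n)
  then show ?case using distinct_exps[of n] set_all_exps[of n]
    by (auto simp: set_exps all_exps_def)
qed simp

lemma length_all_exps: "2 * length (all_exps n) = n * Suc n"
  by (induction n) (simp_all add: all_exps_def exps_def)

lemma in_span_of_list:
  fixes F :: fun2
  assumes "F \<in> polys_below n" "\<And>\<gamma>. total_deg \<gamma> < n \<Longrightarrow> monomial_at \<gamma> \<in> set fs"
  shows "\<exists>c. \<forall>z. F z = (\<Sum>j<length fs. c j * (fs ! j) z)"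
proof -
  obtain a where a: "F = (\<lambda>z. \<Sum>\<gamma> | total_deg \<gamma> < n. a \<gamma> * monomial_at \<gamma> z)"
    using assms by (auto elim!: polys_belowE)
  have "\<forall>\<gamma>\<in>{\<gamma>. total_deg \<gamma> < n}. \<exists>j<length fs. fs ! j = monomial_at \<gamma>"
    using assms(2) by (simp add: in_set_conv_nth)
  then obtain h where h: "\<And>\<gamma>. total_deg \<gamma> < n \<Longrightarrow> h \<gamma> < length fs \<and> fs ! h \<gamma> = monomial_at \<gamma>"
    by (metis mem_Collect_eq)
  have "F z = (\<Sum>j<length fs. (\<Sum>\<gamma> | total_deg \<gamma> < n. if h \<gamma> = j then a \<gamma> else 0) * (fs ! j) z)" for z
  proof -
    have "(\<Sum>j<length fs. (\<Sum>\<gamma> | total_deg \<gamma> < n. if h \<gamma> = j then a \<gamma> else 0) * (fs ! j) z) =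
        (\<Sum>\<gamma> | total_deg \<gamma> < n. \<Sum>j<length fs. (if h \<gamma> = j then a \<gamma> else 0) * (fs ! j) z)"
      unfolding sum_distrib_right by (rule sum.swap)
    also have "\<dots> = (\<Sum>\<gamma> | total_deg \<gamma> < n. a \<gamma> * monomial_at \<gamma> z)"
      using h by (intro sum.cong) (auto simp: if_distrib[of "\<lambda>u. u * _"] cong: if_cong)
    finally show ?thesis by (simp add: a)
  qed
  then show ?thesis by (intro exI[of _ "\<lambda>j. \<Sum>\<gamma> | total_deg \<gamma> < n. if h \<gamma> = j then a \<gamma> else 0"]) auto
qed

text \<open>The change of basis is block triangular by degree, and the block of degree m is the
  coefficient matrix of the leading parts. In the induction the rows of degree n first move into
  \<open>Y\<close>, so that the lower degrees are already monomials and can absorb the lower-order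
  terms of degree n. This is why \<open>Y\<close> is arbitrary.\<close>

lemma vdm_graded:
  assumes "\<And>m. length (rw m) = Suc m" "\<And>m. length (ps m) = Suc m"
    and "\<And>m i. i \<le> m \<Longrightarrow> leads m (ps m ! i) (rw m ! i)"
    and "length xs = length (all_exps n) + length Y"
  shows "vdm (concat (map rw [0..<n]) @ Y) xs =
     (\<Prod>m<n. cvd (ps m)) * vdm (map monomial_at (all_exps n) @ Y) xs"
  using assms(4)
proof (induction n arbitrary: Y)
  case 0
  then show ?case by (simp add: all_exps_def)
next
  case (Suc n)
  define M where "M = map monomial_at (all_exps n)"
  have ae: "all_exps (Suc n) = all_exps n @ exps n" by (simp add: all_exps_def)
  have le: "length (exps n) = Suc n" by (simp add: exps_def)
  have lM: "length xs = length (M @ Y) + Suc n" using Suc.prems le by (simp add: ae M_def)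
  have "\<forall>i<Suc n. \<exists>c. \<forall>z. (rw n ! i) z = hform n (ps n ! i) z + (\<Sum>j<length (M @ Y). c j * ((M @ Y) ! j) z)"
  proof (intro allI impI)
    fix i assume i: "i < Suc n"
    then obtain H where H: "H \<in> polys_below n" "rw n ! i = (\<lambda>z. hform n (ps n ! i) z + H z)"
      using assms(3)[of i n] by (auto simp: leads_def)
    have "\<exists>c. \<forall>z. H z = (\<Sum>j<length (M @ Y). c j * ((M @ Y) ! j) z)"
      by (rule in_span_of_list[OF H(1)]) (simp add: M_def set_all_exps)
    then show "\<exists>c. \<forall>z. (rw n ! i) z = hform n (ps n ! i) z + (\<Sum>j<length (M @ Y). c j * ((M @ Y) ! j) z)"
      unfolding H(2) by (elim exE, rule_tac exI) auto
  qed
  then obtain c where c: "\<And>i z. i < Suc n \<Longrightarrow>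
      (rw n ! i) z = hform n (ps n ! i) z + (\<Sum>j<length (M @ Y). c i j * ((M @ Y) ! j) z)" by metis
  have "vdm (concat (map rw [0..<Suc n]) @ Y) xs = vdm (concat (map rw [0..<n]) @ (rw n @ Y)) xs"
    by simp
  also have "\<dots> = (\<Prod>m<n. cvd (ps m)) * vdm (M @ (rw n @ Y)) xs"
    unfolding M_def using Suc.prems assms(1) le by (intro Suc.IH) (simp add: ae)
  also have "vdm (M @ (rw n @ Y)) xs = vdm ((M @ Y) @ rw n) xs"
    by (rule vdm_perm_rows) simp
  also have "\<dots> = vdm (map (\<lambda>i. coeff (ps n ! i)) [0..<Suc n]) [0..<Suc n] *
      vdm ((M @ Y) @ map monomial_at (exps n)) xs"
  proof (rule vdm_transition[where Y = c])
    fix i x assume i: "i < Suc n"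
    have "hform n (ps n ! i) x = (\<Sum>j<Suc n. coeff (ps n ! i) j * (map monomial_at (exps n) ! j) x)"
      unfolding hform_def by (intro sum.cong) (auto simp: exps_def simp del: upt_Suc)
    then show "(rw n ! i) x = (\<Sum>j<length (M @ Y). c i j * ((M @ Y) ! j) x) +
        (\<Sum>j<Suc n. coeff (ps n ! i) j * (map monomial_at (exps n) ! j) x)"
      using c[OF i, of x] by simp
  qed (use assms(1) le lM in auto)
  also have "map (\<lambda>i. coeff (ps n ! i)) [0..<Suc n] = map coeff (ps n)"
    by (intro nth_equalityI) (simp_all add: assms(2) del: upt_Suc)
  also have "vdm (map coeff (ps n)) [0..<Suc n] = cvd (ps n)"
    by (simp add: cvd_def assms(2))
  also have "vdm ((M @ Y) @ map monomial_at (exps n)) xs = vdm (map monomial_at (all_exps (Suc n)) @ Y) xs"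
    by (rule vdm_perm_rows) (simp add: ae M_def)
  finally show ?case by (simp add: mult_ac)
qed

lemma monomial_count_eq: "monomial_count n = length (all_exps (Suc n))"
  using distinct_card[OF distinct_all_exps[of "Suc n"]]
  by (simp add: monomial_count_def set_all_exps less_Suc_eq_le)

text \<open>The indices of monomials of degree at most n are closed downwards, hence an initial
  segment. So the first \<open>monomial_count n\<close> monomials are the same for every admissible
  order, and so is \<open>Van\<close> at these sizes.\<close>

lemma graded_enumeration_initial:
  assumes "graded_enumeration e"
  shows "mset (map e [0..<monomial_count n]) = mset (all_exps (Suc n))"
proof -
  define S where "S = {i. total_deg (e i) \<le> n}"
  have inj: "inj e" and surj: "surj e" using assms by (auto simp: graded_enumeration_def bij_def)
  have eS: "e ` S = {\<gamma>. total_deg \<gamma> \<le> n}"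
    using surj by (auto simp: S_def) (metis imageI mem_Collect_eq surjD)
  have fS: "finite S" using eS finite_total_deg(2)[of n] inj finite_imageD inj_on_subset by (metis subset_UNIV)
  have cS: "card S = monomial_count n"
    using card_image[OF inj_on_subset[OF inj subset_UNIV], of S] by (simp add: eS monomial_count_def)
  have down: "j \<in> S" if "i \<in> S" "j \<le> i" for i j
    using that assms unfolding S_def graded_enumeration_def mem_Collect_eq by (meson le_trans)
  have "S = {0..<monomial_count n}"
  proof -
    have "S \<subseteq> {0..<card S}"
    proof
      fix i assume i: "i \<in> S"
      then have "{..i} \<subseteq> S" using down by auto
      then have "card {..i} \<le> card S" using fS card_mono by blast
      then show "i \<in> {0..<card S}" by simp
    qed
    then show ?thesis using cS fS by (simp add: card_subset_eq)
  qed
  then have "set (map e [0..<monomial_count n]) = set (all_exps (Suc n))"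
    using eS by (simp add: set_all_exps less_Suc_eq_le)
  moreover have "distinct (map e [0..<monomial_count n])"
    using inj_on_subset[OF inj subset_UNIV] by (simp add: distinct_map)
  ultimately show ?thesis using distinct_all_exps set_eq_iff_mset_eq_distinct by blast
qed

lemma cmod_monomial_at_le:
  assumes "cmod (fst z) \<le> C" "cmod (snd z) \<le> C" "1 \<le> C" "total_deg \<gamma> \<le> n"
  shows "cmod (monomial_at \<gamma> z) \<le> C ^ n"
proof -
  have "cmod (monomial_at \<gamma> z) \<le> C ^ fst \<gamma> * C ^ snd \<gamma>"
    using assms unfolding monomial_at_def norm_mult norm_power
    by (intro mult_mono power_mono) auto
  also have "\<dots> \<le> C ^ n"
    using assms unfolding power_add[symmetric] by (intro power_increasing) (auto simp: total_deg_def)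
  finally show ?thesis .
qed

definition mons :: "nat \<Rightarrow> fun2 list" where
  "mons n = map monomial_at (all_exps (Suc n))"

lemma length_mons: "length (mons n) = monomial_count n"
  by (simp add: mons_def monomial_count_eq)

lemma det_eq_vdm_mons:
  assumes "graded_enumeration e"
  shows "cmod (det (mat (monomial_count n) (monomial_count n) (\<lambda>(j, k). monomial_at (e j) (\<zeta> k)))) =
    vdm (mons n) (map \<zeta> [0..<monomial_count n])"
proof -
  let ?m = "monomial_count n"
  have "cmod (det (mat ?m ?m (\<lambda>(j, k). monomial_at (e j) (\<zeta> k)))) =
      vdm (map monomial_at (map e [0..<?m])) (map \<zeta> [0..<?m])"
    unfolding vdm_def by (rule arg_cong[where f = "\<lambda>M. cmod (det M)"]) (auto intro!: eq_matI)
  also have "\<dots> = vdm (mons n) (map \<zeta> [0..<?m])"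
    unfolding mons_def using graded_enumeration_initial[OF assms, of n]
    by (intro vdm_perm_rows) (simp only: mset_map)
  finally show ?thesis .
qed

text \<open>On a bounded set the determinants of fixed size are bounded, so the \<open>Sup\<close>
  in \<open>Van\<close> is an actual upper bound for them.\<close>

lemma Van_nonneg: 
  assumes e: "graded_enumeration e" and b: "\<And>z. z \<in> E \<Longrightarrow> cmod (fst z) \<le> C \<and> cmod (snd z) \<le> C"
  shows "0 \<le> Van e (monomial_count n) E"
    and "\<And>xs. set xs \<subseteq> E \<Longrightarrow> length xs = monomial_count n \<Longrightarrow> vdm (mons n) xs \<le> Van e (monomial_count n) E"
proof -
  let ?m = "monomial_count n"
  let ?S = "insert 0 {cmod (det (mat ?m ?m (\<lambda>(j, k). monomial_at (e j) (\<zeta> k)))) | \<zeta>. \<forall>k<?m. \<zeta> k \<in> E}"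
  have "s \<le> fact ?m * (max 1 C ^ n) ^ ?m" if "s \<in> ?S" for s
  proof -
    consider "s = 0" | \<zeta> where "s = vdm (mons n) (map \<zeta> [0..<?m])" "\<forall>k<?m. \<zeta> k \<in> E"
      using \<open>s \<in> ?S\<close> unfolding det_eq_vdm_mons[OF e] by blast
    then show ?thesis
    proof cases
      case 2
      have "vdm (mons n) (map \<zeta> [0..<?m]) \<le> fact (length (mons n)) * (max 1 C ^ n) ^ length (mons n)"
      proof (rule vdm_le_fact)
        fix f x assume "f \<in> set (mons n)" "x \<in> set (map \<zeta> [0..<?m])"
        then obtain \<gamma> where "f = monomial_at \<gamma>" "total_deg \<gamma> \<le> n" "x \<in> E"
          using 2(2) by (auto simp: mons_def set_all_exps)
        then show "cmod (f x) \<le> max 1 C ^ n"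
          using b[of x] by (auto intro!: cmod_monomial_at_le)
      qed (simp_all add: length_mons)
      then show ?thesis using 2 by (simp add: length_mons)
    qed simp
  qed
  then have bdd: "bdd_above ?S" by (rule bdd_aboveI)
  show "0 \<le> Van e ?m E" unfolding Van_def by (rule cSup_upper[OF _ bdd]) simp
  fix xs assume xs: "set xs \<subseteq> E" "length xs = ?m"
  have "vdm (mons n) xs = vdm (mons n) (map ((!) xs) [0..<?m])"
    using xs(2) by (metis map_nth)
  also have "\<dots> = cmod (det (mat ?m ?m (\<lambda>(j, k). monomial_at (e j) (xs ! k))))"
    by (rule det_eq_vdm_mons[OF e, symmetric])
  also have "\<dots> \<in> ?S" using xs nth_mem by (intro insertI2 CollectI exI[of _ "(!) xs"]) auto
  finally show "vdm (mons n) xs \<le> Van e ?m E" unfolding Van_def by (rule cSup_upper[OF _ bdd])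
qed

lemma Van_least:
  assumes e: "graded_enumeration e" and "0 \<le> B"
    and "\<And>xs. set xs \<subseteq> E \<Longrightarrow> length xs = monomial_count n \<Longrightarrow> vdm (mons n) xs \<le> B"
  shows "Van e (monomial_count n) E \<le> B"
  unfolding Van_def det_eq_vdm_mons[OF e]
  by (rule cSup_least) (use assms in \<open>auto intro!: assms(3)\<close>)

section \<open>Traces and eigenvalues\<close>

definition mtrace :: "'a::comm_ring_1 mat \<Rightarrow> 'a" where
  "mtrace M = (\<Sum>i<dim_row M. M $$ (i, i))"

lemma mtrace_mult_commute:
  assumes "A \<in> carrier_mat n n" "B \<in> carrier_mat n n"
  shows "mtrace (A * B) = mtrace (B * A)"
proof -
  have "mtrace (A * B) = (\<Sum>i<n. \<Sum>k<n. A $$ (i, k) * B $$ (k, i))"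
    using assms by (simp add: mtrace_def scalar_prod_def atLeast0LessThan)
  also have "\<dots> = (\<Sum>k<n. \<Sum>i<n. B $$ (k, i) * A $$ (i, k))"
    by (subst sum.swap) (simp add: mult.commute)
  also have "\<dots> = mtrace (B * A)"
    using assms by (simp add: mtrace_def scalar_prod_def atLeast0LessThan)
  finally show ?thesis .
qed

lemma triangularize:
  assumes A: "(A :: complex mat) \<in> carrier_mat n n"
  obtains U P Q where "U \<in> carrier_mat n n" "P \<in> carrier_mat n n" "Q \<in> carrier_mat n n"
    "P * Q = 1\<^sub>m n" "Q * P = 1\<^sub>m n" "A = P * U * Q" "upper_triangular U" "similar_mat_wit A U P Q"
proof -
  obtain es where es: "char_poly A = (\<Prod>a\<leftarrow>es. [:- a, 1:])" using char_poly_factorized[OF A] by blast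
  obtain U P Q where s: "schur_decomposition A es = (U, P, Q)" by (metis surj_pair)
  from schur_decomposition[OF A es s] have w: "similar_mat_wit A U P Q" and u: "upper_triangular U" by auto
  from similar_mat_witD2[OF A w] u w show thesis by (intro that[of U P Q]) auto
qed

lemma upper_triangular_pow:
  fixes U :: "'a::comm_ring_1 mat"
  assumes U: "U \<in> carrier_mat n n" "upper_triangular U"
  shows "upper_triangular (U ^\<^sub>m k) \<and> (\<forall>i<n. (U ^\<^sub>m k) $$ (i, i) = (U $$ (i, i)) ^ k)"
proof (induction k)
  case 0
  then show ?case using U by (auto simp: upper_triangular_def)
next
  case (Suc k)
  have c: "U ^\<^sub>m k \<in> carrier_mat n n" using U by auto
  have z: "(U ^\<^sub>m k) $$ (i, l) = 0" if "l < i" "i < n" for i l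
    using Suc.IH c that by (auto simp: upper_triangular_def)
  have zU: "U $$ (i, l) = 0" if "l < i" "i < n" for i l
    using U that by (auto simp: upper_triangular_def)
  have entry: "(U ^\<^sub>m Suc k) $$ (i, j) = (\<Sum>l<n. (U ^\<^sub>m k) $$ (i, l) * U $$ (l, j))" if "i < n" "j < n" for i j
    using that U c by (simp add: scalar_prod_def atLeast0LessThan)
  have "(U ^\<^sub>m Suc k) $$ (i, j) = 0" if "j < i" "i < n" for i j
  proof -
    have "(U ^\<^sub>m k) $$ (i, l) * U $$ (l, j) = 0" if "l < n" for l
      using z[of l i] zU[of j l] that \<open>j < i\<close> \<open>i < n\<close> by (cases "l < i") auto
    then show ?thesis using entry that by simp
  qed
  moreover have "(U ^\<^sub>m Suc k) $$ (i, i) = U $$ (i, i) ^ Suc k" if i: "i < n" for i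
  proof -
    have "(U ^\<^sub>m Suc k) $$ (i, i) = (\<Sum>l\<in>{i}. (U ^\<^sub>m k) $$ (i, l) * U $$ (l, i))"
      unfolding entry[OF i i]
    proof (intro sum.mono_neutral_right ballI)
      fix l assume "l \<in> {..<n} - {i}"
      then show "(U ^\<^sub>m k) $$ (i, l) * U $$ (l, i) = 0"
        using z[of l i] zU[of i l] i by (cases "l < i") auto
    qed (use i in auto)
    then show ?thesis using Suc.IH i by simp
  qed
  ultimately show ?case using U by (auto simp: upper_triangular_def simp del: pow_mat.simps)
qed

lemma mtrace_similar_pow:
  fixes A :: "complex mat"
  assumes A: "A \<in> carrier_mat n n" and U: "U \<in> carrier_mat n n" "upper_triangular U"
    and w: "similar_mat_wit A U P Q"
  shows "mtrace (A ^\<^sub>m k) = (\<Sum>i<n. U $$ (i, i) ^ k)"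
proof -
  from similar_mat_witD2[OF A w] have PQ: "P \<in> carrier_mat n n" "Q \<in> carrier_mat n n" "Q * P = 1\<^sub>m n"
    by auto
  have Uk: "U ^\<^sub>m k \<in> carrier_mat n n" using U by auto
  have "A ^\<^sub>m k = P * (U ^\<^sub>m k) * Q" using similar_mat_wit_pow_id[OF w] .
  then have "mtrace (A ^\<^sub>m k) = mtrace (P * (U ^\<^sub>m k * Q))"
    using PQ Uk by (simp add: assoc_mult_mat[OF PQ(1) Uk PQ(2)])
  also have "\<dots> = mtrace ((U ^\<^sub>m k * Q) * P)"
    using PQ Uk by (intro mtrace_mult_commute) auto
  also have "\<dots> = mtrace (U ^\<^sub>m k)"
    using PQ Uk by (simp add: assoc_mult_mat[OF Uk PQ(2) PQ(1)] right_mult_one_mat[OF Uk])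
  also have "\<dots> = (\<Sum>i<n. U $$ (i, i) ^ k)"
    using U(1) upper_triangular_pow[OF U] by (simp add: mtrace_def)
  finally show ?thesis .
qed

lemma eigenvalue_iff_diag:
  fixes A :: "complex mat"
  assumes A: "A \<in> carrier_mat n n" and U: "U \<in> carrier_mat n n" "upper_triangular U"
    and w: "similar_mat_wit A U P Q"
  shows "eigenvalue A k \<longleftrightarrow> (\<exists>i<n. k = U $$ (i, i))"
proof -
  have "char_poly A = char_poly U"
    using w by (intro char_poly_similar) (auto simp: similar_mat_def)
  also have "\<dots> = (\<Prod>a\<leftarrow>diag_mat U. [:- a, 1:])"
    by (rule char_poly_upper_triangular[OF U])
  finally have "poly (char_poly A) k = (\<Prod>a\<leftarrow>diag_mat U. k - a)"
    by (simp add: poly_prod_list o_def)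
  then show ?thesis using U(1)
    unfolding eigenvalue_root_char_poly[OF A]
    by (auto simp: prod_list_zero_iff diag_mat_def image_iff)
qed

text \<open>The trace is a sum of n eigenvalues, so the largest of them serves. A sum over a fibre
  with multiplicities is thus replaced by the value at one point.\<close>

lemma mtrace_le_eigenvalue:
  fixes A :: "complex mat"
  assumes A: "A \<in> carrier_mat n n" and n: "0 < n"
  obtains k where "eigenvalue A k" "cmod (mtrace A) \<le> real n * cmod k"
proof -
  obtain U P Q where U: "U \<in> carrier_mat n n" "upper_triangular U" "similar_mat_wit A U P Q"
    using triangularize[OF A] by metis
  obtain i where i: "i < n" "\<And>j. j < n \<Longrightarrow> cmod (U $$ (j, j)) \<le> cmod (U $$ (i, i))"
  proof -
    have "finite ((\<lambda>j. cmod (U $$ (j, j))) ` {..<n})" "(\<lambda>j. cmod (U $$ (j, j))) ` {..<n} \<noteq> {}" using n by auto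
    from Max_in[OF this] obtain i where "i < n" "Max ((\<lambda>j. cmod (U $$ (j, j))) ` {..<n}) = cmod (U $$ (i, i))" by auto
    moreover have "cmod (U $$ (j, j)) \<le> Max ((\<lambda>j. cmod (U $$ (j, j))) ` {..<n})" if "j < n" for j
      using that by (intro Max_ge) auto
    ultimately show thesis by (intro that[of i]) auto
  qed
  have "mtrace A = (\<Sum>j<n. U $$ (j, j))"
    using mtrace_similar_pow[OF A U, of 1] A by simp
  also have "cmod \<dots> \<le> (\<Sum>j<n. cmod (U $$ (j, j)))" by (rule norm_sum)
  also have "\<dots> \<le> (\<Sum>j<n. cmod (U $$ (i, i)))" using i by (intro sum_mono) auto
  finally show thesis using i(1) eigenvalue_iff_diag[OF A U] by (intro that[of "U $$ (i, i)"]) auto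
qed

text \<open>Applies the traces of powers to a polynomial h that vanishes at 0 and at all eigenvalues
  except k. As h has no constant term, the sum of its values at the eigenvalues is zero; but this
  sum is the multiplicity of k times h(k), which is nonzero if k is.\<close>

lemma eigenvalue_zero_if_traces_vanish:
  fixes A :: "complex mat"
  assumes A: "A \<in> carrier_mat n n" and tr: "\<And>m. 0 < m \<Longrightarrow> mtrace (A ^\<^sub>m m) = 0"
    and k: "eigenvalue A k"
  shows "k = 0"
proof (rule ccontr)
  assume k0: "k \<noteq> 0"
  obtain U P Q where U: "U \<in> carrier_mat n n" "upper_triangular U" "similar_mat_wit A U P Q"
    using triangularize[OF A] by metis
  define u where "u i = U $$ (i, i)" for i
  define h where "h = [:0, 1:] * (\<Prod>e\<in>u ` {..<n} - {k}. [:-e, 1:])"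
  have "coeff h 0 = 0" by (simp add: h_def)
  have "(\<Sum>i<n. poly h (u i)) = (\<Sum>m\<le>degree h. coeff h m * (\<Sum>i<n. u i ^ m))"
    unfolding poly_altdef sum_distrib_left by (rule sum.swap)
  also have "\<dots> = 0"
  proof (rule sum.neutral, rule ballI)
    fix m
    show "coeff h m * (\<Sum>i<n. u i ^ m) = 0"
      using tr[of m] mtrace_similar_pow[OF A U, of m] \<open>coeff h 0 = 0\<close> by (cases "m = 0") (auto simp: u_def)
  qed
  finally have 1: "(\<Sum>i<n. poly h (u i)) = 0" .
  have "poly h (u i) = (if u i = k then poly h k else 0)" if "i < n" for i
  proof (cases "u i = k")
    case False
    then have "\<exists>e\<in>u ` {..<n} - {k}. poly [:-e, 1:] (u i) = 0" using that by auto
    then show ?thesis using False by (simp add: h_def poly_prod)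
  qed simp
  then have "(\<Sum>i<n. poly h (u i)) = (\<Sum>i | i < n \<and> u i = k. poly h k)"
    by (simp add: sum.If_cases Int_def lessThan_def)
  then have "of_nat (card {i. i < n \<and> u i = k}) * poly h k = 0" using 1 by simp
  moreover have "poly h k \<noteq> 0" using k0 by (auto simp: h_def poly_prod)
  moreover have "card {i. i < n \<and> u i = k} \<noteq> 0"
    using k eigenvalue_iff_diag[OF A U] by (auto simp: u_def)
  ultimately show False by simp
qed

text \<open>A nonzero subspace invariant under \<open>N\<close> contains an eigenvector of \<open>N\<close>: with respect to a
  triangularising basis, \<open>N - U\<^bsub>kk\<^esub>\<close> shortens the flag in which a given vector lies.\<close>

lemma invariant_subspace_eigenvector:
  fixes N :: "complex mat"
  assumes N: "N \<in> carrier_mat n n" and W: "W \<subseteq> carrier_vec n" and v: "v \<in> W" "v \<noteq> 0\<^sub>v n"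
    and add: "\<And>u w. u \<in> W \<Longrightarrow> w \<in> W \<Longrightarrow> u + w \<in> W"
    and smult: "\<And>c w. w \<in> W \<Longrightarrow> c \<cdot>\<^sub>v w \<in> W"
    and inv: "\<And>w. w \<in> W \<Longrightarrow> N *\<^sub>v w \<in> W"
  shows "\<exists>w x. w \<in> W \<and> w \<noteq> 0\<^sub>v n \<and> N *\<^sub>v w = x \<cdot>\<^sub>v w"
proof -
  obtain U P Q where U: "U \<in> carrier_mat n n" "P \<in> carrier_mat n n" "Q \<in> carrier_mat n n"
    "P * Q = 1\<^sub>m n" "Q * P = 1\<^sub>m n" "N = P * U * Q" "upper_triangular U"
    using triangularize[OF N] by metis
  have QN: "Q *\<^sub>v (N *\<^sub>v w) = U *\<^sub>v (Q *\<^sub>v w)" if w: "w \<in> carrier_vec n" for w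
  proof -
    have "Q * N = (Q * P) * (U * Q)" unfolding U(6)
      using U(1-3) by (simp add: assoc_mult_mat[of _ n n _ n _ n])
    also have "\<dots> = U * Q" using U by simp
    finally have "Q * N = U * Q" .
    then show ?thesis using U N w by (metis assoc_mult_mat_vec)
  qed
  have "\<exists>w x. w \<in> W \<and> w \<noteq> 0\<^sub>v n \<and> N *\<^sub>v w = x \<cdot>\<^sub>v w"
    if "v \<in> W" "v \<noteq> 0\<^sub>v n" "k \<le> n" "\<And>j. k \<le> j \<Longrightarrow> j < n \<Longrightarrow> (Q *\<^sub>v v) $ j = 0" for v k
    using that
  proof (induction k arbitrary: v)
    case 0
    have vc: "v \<in> carrier_vec n" using 0 W by auto
    have "Q *\<^sub>v v = 0\<^sub>v n" using 0 U by (intro eq_vecI) auto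
    then have "P *\<^sub>v (Q *\<^sub>v v) = 0\<^sub>v n" using U by auto
    moreover have "P *\<^sub>v (Q *\<^sub>v v) = v"
      using U vc by (metis assoc_mult_mat_vec one_mult_mat_vec)
    ultimately show ?case using 0 by simp
  next
    case (Suc k)
    have vc: "v \<in> carrier_vec n" using Suc.prems W by auto
    define c where "c = U $$ (k, k)"
    define u where "u = N *\<^sub>v v + (- c) \<cdot>\<^sub>v v"
    have u: "u \<in> W" unfolding u_def using Suc.prems by (intro add smult inv) auto
    show ?case
    proof (cases "u = 0\<^sub>v n")
      case True
      have "N *\<^sub>v v = c \<cdot>\<^sub>v v"
      proof (rule eq_vecI)
        fix i assume "i < dim_vec (c \<cdot>\<^sub>v v)"
        then have i: "i < n" using vc by simp
        have "u $ i = 0" using True i by simp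
        then show "(N *\<^sub>v v) $ i = (c \<cdot>\<^sub>v v) $ i" using i vc N by (simp add: u_def)
      qed (use N vc in auto)
      then show ?thesis using Suc.prems by blast
    next
      case False
      have "Q *\<^sub>v u = U *\<^sub>v (Q *\<^sub>v v) + (- c) \<cdot>\<^sub>v (Q *\<^sub>v v)"
      proof -
        have "Q *\<^sub>v u = Q *\<^sub>v (N *\<^sub>v v) + Q *\<^sub>v ((- c) \<cdot>\<^sub>v v)"
          unfolding u_def using N vc by (intro mult_add_distrib_mat_vec[OF U(3)]) auto
        then show ?thesis using mult_mat_vec[OF U(3) vc, of "- c"] QN[OF vc] by simp
      qed
      moreover have "(U *\<^sub>v (Q *\<^sub>v v)) $ j = c * (Q *\<^sub>v v) $ j" if j: "k \<le> j" "j < n" for j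
      proof -
        have "(U *\<^sub>v (Q *\<^sub>v v)) $ j = (\<Sum>l<n. U $$ (j, l) * (Q *\<^sub>v v) $ l)"
          using U j vc by (simp add: scalar_prod_def atLeast0LessThan)
        also have "\<dots> = (\<Sum>l\<in>{k}. U $$ (j, l) * (Q *\<^sub>v v) $ l)"
        proof (intro sum.mono_neutral_right ballI)
          fix l assume "l \<in> {..<n} - {k}"
          then show "U $$ (j, l) * (Q *\<^sub>v v) $ l = 0"
            using Suc.prems(4)[of l] U(1,7) j by (cases "l < k") (auto simp: upper_triangular_def)
        qed (use Suc.prems in auto)
        also have "\<dots> = c * (Q *\<^sub>v v) $ j"
          using Suc.prems(4)[of j] U(1,7) j by (cases "j = k") (auto simp: c_def upper_triangular_def)
        finally show ?thesis .
      qed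
      ultimately have "(Q *\<^sub>v u) $ j = 0" if "k \<le> j" "j < n" for j
        using that U vc by simp
      then show ?thesis using Suc.IH[OF u False] Suc.prems(3) by simp
    qed
  qed
  from this[OF v, of n] show ?thesis by simp
qed

section \<open>The free module over the subring generated by a regular map\<close>

lemma vdm_left_inverse:
  assumes "vdm (map T [0..<m]) [0..<m] \<noteq> 0"
  obtains W where "\<And>b j. b < m \<Longrightarrow> j < m \<Longrightarrow> (\<Sum>i<m. W b i * T i j) = (if b = j then 1 else 0)"
proof -
  define A where "A = mat m m (\<lambda>(i, j). T i j)"
  have A: "A \<in> carrier_mat m m" by (simp add: A_def)
  have "mat m m (\<lambda>(i, j). (map T [0..<m] ! i) ([0..<m] ! j)) = A"
    unfolding A_def by (intro eq_matI) auto
  then have "det A \<noteq> 0" using assms by (auto simp: vdm_def)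
  from det_non_zero_imp_unit[OF A this, of "()"] obtain B where B: "B \<in> carrier_mat m m" "B * A = 1\<^sub>m m"
    by (auto simp: Units_def ring_mat_def)
  show thesis
  proof (rule that[of "\<lambda>b i. B $$ (b, i)"])
    fix b j assume bj: "b < m" "j < m"
    have "(B * A) $$ (b, j) = (\<Sum>i<m. B $$ (b, i) * T i j)"
      using bj A B(1) by (simp add: scalar_prod_def atLeast0LessThan A_def)
    then show "(\<Sum>i<m. B $$ (b, i) * T i j) = (if b = j then 1 else 0)" using B(2) bj by simp
  qed
qed

text \<open>Suppose good points \<open>xs\<close> for \<open>fs\<close> exist, but adding any x
  makes the determinant with the new function g vanish. Then g is a combination of \<open>fs\<close>
  on \<open>xs\<close> and x. The coefficients are determined by \<open>xs\<close> alone, hence do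
  not depend on x, and g is this combination everywhere, against independence.\<close>

lemma exists_unisolvent_points:
  fixes fs :: "('x \<Rightarrow> complex) list"
  assumes "\<And>v. (\<forall>x. (\<Sum>i<length fs. v i * (fs ! i) x) = 0) \<Longrightarrow> \<forall>i<length fs. v i = 0"
  shows "\<exists>xs. length xs = length fs \<and> vdm fs xs \<noteq> 0"
  using assms
proof (induction fs rule: rev_induct)
  case Nil
  show ?case by (simp add: vdm_def)
next
  case (snoc g fs)
  let ?n = "length fs"
  have sum_snoc: "(\<Sum>i<length (fs @ [g]). v i * ((fs @ [g]) ! i) x) = (\<Sum>i<?n. v i * (fs ! i) x) + v ?n * g x" for v x
    by (simp add: nth_append)
  have "\<exists>xs. length xs = length fs \<and> vdm fs xs \<noteq> 0"
  proof (rule snoc.IH)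
    fix v assume v: "\<forall>x. (\<Sum>i<?n. v i * (fs ! i) x) = 0"
    have "\<forall>i<length (fs @ [g]). (v(?n := 0)) i = 0"
    proof (rule snoc.prems, rule allI)
      fix x
      show "(\<Sum>i<length (fs @ [g]). (v(?n := 0)) i * ((fs @ [g]) ! i) x) = 0"
        using v unfolding sum_snoc by simp
    qed
    then have "(v(?n := 0)) i = 0" if "i < ?n" for i using that by (metis length_append_singleton less_SucI)
    then show "\<forall>i<?n. v i = 0" by (metis fun_upd_other less_irrefl)
  qed
  then obtain xs where xs: "length xs = ?n" "vdm fs xs \<noteq> 0" by blast
  show ?case
  proof (rule ccontr)
    assume "\<not> ?thesis"
    then have zero: "vdm (fs @ [g]) (xs @ [x]) = 0" for x using xs(1) by (metis length_append length_Cons list.size(3))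
    have indep: "\<forall>i<?n. v i = 0" if "\<forall>x\<in>set xs. (\<Sum>i<?n. v i * (fs ! i) x) = 0" for v
      using xs that vdm_zero_iff_dependent_rows[OF xs(1)] by blast
    have "\<exists>u. (\<forall>y\<in>set (xs @ [x]). (\<Sum>i<?n. u i * (fs ! i) y) + g y = 0)" for x
    proof -
      have "\<exists>v. (\<exists>i<length (fs @ [g]). v i \<noteq> 0) \<and> (\<forall>y\<in>set (xs @ [x]). (\<Sum>i<length (fs @ [g]). v i * ((fs @ [g]) ! i) y) = 0)"
        using zero[of x] xs(1) by (subst vdm_zero_iff_dependent_rows[symmetric]) auto
      then obtain v j where v: "j < Suc ?n" "v j \<noteq> 0"
        "\<And>y. y \<in> set (xs @ [x]) \<Longrightarrow> (\<Sum>i<?n. v i * (fs ! i) y) + v ?n * g y = 0"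
        unfolding sum_snoc by auto
      have vn: "v ?n \<noteq> 0"
      proof
        assume "v ?n = 0"
        then have "\<forall>i<?n. v i = 0" using v(3) by (intro indep) auto
        with v(1,2) \<open>v ?n = 0\<close> show False by (metis less_SucE)
      qed
      have "(\<Sum>i<?n. (v i / v ?n) * (fs ! i) y) + g y = 0" if "y \<in> set (xs @ [x])" for y
      proof -
        have "(\<Sum>i<?n. (v i / v ?n) * (fs ! i) y) + g y = ((\<Sum>i<?n. v i * (fs ! i) y) + v ?n * g y) / v ?n"
          using vn by (simp add: add_divide_distrib sum_divide_distrib)
        then show ?thesis using v(3)[OF that] by simp
      qed
      then show ?thesis by (intro exI[of _ "\<lambda>i. v i / v ?n"] ballI)
    qed
    then obtain u where u: "\<And>x y. y \<in> set (xs @ [x]) \<Longrightarrow> (\<Sum>i<?n. u x i * (fs ! i) y) + g y = 0" by metis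
    \<comment> \<open>Any choice of x gives the same coefficients, so an arbitrary one is
      fixed.\<close>
    define w where "w = u undefined"
    have "u x i = w i" if "i < ?n" for x i
    proof -
      have "\<forall>i<?n. u x i - w i = 0"
      proof (rule indep, rule ballI)
        fix y assume y: "y \<in> set xs"
        have "(\<Sum>i<?n. (u x i - w i) * (fs ! i) y) = (\<Sum>i<?n. u x i * (fs ! i) y) - (\<Sum>i<?n. w i * (fs ! i) y)"
          by (simp add: left_diff_distrib sum_subtractf)
        also have "\<dots> = ((\<Sum>i<?n. u x i * (fs ! i) y) + g y) - ((\<Sum>i<?n. w i * (fs ! i) y) + g y)" by simp
        also have "(\<Sum>i<?n. u x i * (fs ! i) y) + g y = 0" by (rule u) (use y in simp)
        also have "(\<Sum>i<?n. w i * (fs ! i) y) + g y = 0" unfolding w_def by (rule u) (use y in simp)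
        finally show "(\<Sum>i<?n. (u x i - w i) * (fs ! i) y) = 0" by simp
      qed
      then show ?thesis using that by auto
    qed
    then have "(\<Sum>i<?n. w i * (fs ! i) x) + g x = 0" for x using u[of x x] by simp
    then have "\<forall>i<length (fs @ [g]). (w(?n := 1)) i = 0"
      by (intro snoc.prems allI, unfold sum_snoc) simp
    then have "(w(?n := 1)) ?n = 0" by (metis length_append_singleton lessI)
    then show False by simp
  qed
qed

section \<open>Bivariate polynomials as iterated polynomials\<close>

type_synonym qpoly = "complex poly poly"

text \<open>The outer variable is z2 and the coefficients are polynomials in z1. The type
  \<open>qpoly\<close> is an integral domain, so a singular matrix over it has a nonzero kernel
  vector with entries in it.\<close>

definition ev :: "qpoly \<Rightarrow> fun2" where
  "ev P z = poly (poly P [:snd z:]) (fst z)"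

lemma ev_simps [simp]:
  "ev (P + Q) z = ev P z + ev Q z" "ev (P - Q) z = ev P z - ev Q z" "ev (P * Q) z = ev P z * ev Q z"
 "ev (smult c P) z = poly c (fst z) * ev P z" "ev 0 z = 0" "ev 1 z = 1" "ev (P ^ k) z = ev P z ^ k" "ev [:[:a:]:] z = a"
  by (simp_all add: ev_def)

lemma ev_sum [simp]: "ev (\<Sum>i\<in>I. F i) z = (\<Sum>i\<in>I. ev (F i) z)"
  by (induction I rule: infinite_finite_induct) auto

text \<open>If \<open>P\<close> vanishes as a function, every constant polynomial is a root of
  \<open>P\<close> in the ring of polynomials in z1, which is too many roots for a nonzero
  \<open>P\<close>.\<close>

lemma ev_eq_0_imp:
  assumes "\<And>z. ev P z = 0"
  shows "P = 0"
proof (rule ccontr)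
  assume "P \<noteq> 0"
  have "poly P [:y:] = 0" for y
  proof (rule ccontr)
    assume "poly P [:y:] \<noteq> 0"
    then have "finite {x. poly (poly P [:y:]) x = 0}" by (rule poly_roots_finite)
    moreover have "{x. poly (poly P [:y:]) x = 0} = UNIV" using assms[of "(_, y)"] by (auto simp: ev_def)
    ultimately show False using infinite_UNIV_char_0 by metis
  qed
  then have "range (\<lambda>y::complex. [:y:]) \<subseteq> {p. poly P p = 0}" by auto
  moreover have "finite {p. poly P p = 0}" using \<open>P \<noteq> 0\<close> by (rule poly_roots_finite)
  ultimately have "finite (range (\<lambda>y::complex. [:y:]))" by (rule finite_subset)
  then have "finite (UNIV :: complex set)" by (rule finite_imageD) (auto simp: inj_on_def)
  then show False using infinite_UNIV_char_0 by metis
qed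

definition qmono :: "nat \<times> nat \<Rightarrow> qpoly" where
  "qmono \<gamma> = [:[:0, 1:]:] ^ fst \<gamma> * [:0, 1:] ^ snd \<gamma>"

lemma ev_qmono [simp]: "ev (qmono \<gamma>) z = monomial_at \<gamma> z"
  by (simp add: qmono_def ev_def monomial_at_def)

definition qcoeff :: "qpoly \<Rightarrow> nat \<times> nat \<Rightarrow> complex" where
  "qcoeff P \<alpha> = coeff (coeff P (snd \<alpha>)) (fst \<alpha>)"

lemma qcoeff_qmono: "qcoeff (qmono \<gamma>) \<alpha> = (if \<alpha> = \<gamma> then 1 else 0)"
proof -
  have "qmono \<gamma> = monom (monom 1 (fst \<gamma>)) (snd \<gamma>)"
    by (simp add: qmono_def monom_altdef pCons_one[symmetric] poly_const_pow)
  then show ?thesis by (auto simp: qcoeff_def prod_eq_iff)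
qed

text \<open>The range of exponents may be enlarged at will, so that several polynomials can be
  expanded over a common one.\<close>

lemma ev_expand: "\<exists>N. \<forall>n\<ge>N. \<forall>z. ev P z = (\<Sum>\<alpha> | total_deg \<alpha> < n. qcoeff P \<alpha> * monomial_at \<alpha> z)"
proof -
  \<comment> \<open>A total degree of at least N makes either the exponent of z2 exceed the degree
    of \<open>P\<close> or the exponent of z1 exceed the degree of the coefficient
    concerned.\<close>
  define N where "N = Suc (degree P + (\<Sum>j\<le>degree P. degree (coeff P j)))"
  have zero: "qcoeff P \<alpha> = 0" if "N \<le> total_deg \<alpha>" for \<alpha>
  proof (cases "snd \<alpha> \<le> degree P")
    case True
    then have "degree (coeff P (snd \<alpha>)) \<le> (\<Sum>j\<le>degree P. degree (coeff P j))"
      by (intro member_le_sum) auto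
    then have "degree (coeff P (snd \<alpha>)) < fst \<alpha>" using that True by (simp add: N_def total_deg_def)
    then show ?thesis by (simp add: qcoeff_def coeff_eq_0)
  qed (simp add: qcoeff_def coeff_eq_0)
  have "ev P z = (\<Sum>\<alpha> | total_deg \<alpha> < n. qcoeff P \<alpha> * monomial_at \<alpha> z)" if n: "N \<le> n" for n z
  proof -
    have "P = (\<Sum>\<alpha> | total_deg \<alpha> < n. [:[:qcoeff P \<alpha>:]:] * qmono \<alpha>)"
    proof (intro poly_eqI)
      fix j i
      have "qcoeff (\<Sum>\<alpha> | total_deg \<alpha> < n. [:[:qcoeff P \<alpha>:]:] * qmono \<alpha>) (i, j) =
          (\<Sum>\<alpha> | total_deg \<alpha> < n. qcoeff P \<alpha> * qcoeff (qmono \<alpha>) (i, j))"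
        by (simp add: qcoeff_def coeff_sum)
      also have "\<dots> = (if total_deg (i, j) < n then qcoeff P (i, j) else 0)"
        unfolding qcoeff_qmono by (simp add: if_distrib[of "\<lambda>u. _ * u"] sum.delta[OF finite_total_deg(1)] eq_commute[of "(i, j)"] cong: if_cong)
      also have "\<dots> = qcoeff P (i, j)" using zero[of "(i, j)"] n by auto
      finally show "coeff (coeff P j) i = coeff (coeff (\<Sum>\<alpha> | total_deg \<alpha> < n. [:[:qcoeff P \<alpha>:]:] * qmono \<alpha>) j) i"
        by (simp add: qcoeff_def)
    qed
    then have "ev P z = ev (\<Sum>\<alpha> | total_deg \<alpha> < n. [:[:qcoeff P \<alpha>:]:] * qmono \<alpha>) z" by simp
    then show ?thesis by simp
  qed
  then show ?thesis by blast
qed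

lemma qcoeff_eq_0_imp:
  assumes "\<And>\<alpha>. qcoeff P \<alpha> = 0"
  shows "P = 0"
  using assms ev_expand[of P] by (intro ev_eq_0_imp) auto

lemma polys_below_imp_ev:
  assumes "F \<in> polys_below n"
  obtains P where "ev P = F"
proof -
  obtain c where F: "F = (\<lambda>z. \<Sum>\<gamma> | total_deg \<gamma> < n. c \<gamma> * monomial_at \<gamma> z)" by (rule polys_belowE[OF assms])
  show thesis by (rule that[of "\<Sum>\<gamma> | total_deg \<gamma> < n. [:[:c \<gamma>:]:] * qmono \<gamma>"]) (simp add: F fun_eq_iff)
qed

lemma monomials_independent:
  assumes "\<And>z. (\<Sum>\<gamma> | total_deg \<gamma> < n. c \<gamma> * monomial_at \<gamma> z) = 0" "total_deg \<delta> < n"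
  shows "c \<delta> = 0"
proof -
  define P where "P = (\<Sum>\<gamma> | total_deg \<gamma> < n. [:[:c \<gamma>:]:] * qmono \<gamma>)"
  have "P = 0" using assms(1) by (intro ev_eq_0_imp) (simp add: P_def)
  have "qcoeff P \<delta> = (\<Sum>\<gamma> | total_deg \<gamma> < n. c \<gamma> * qcoeff (qmono \<gamma>) \<delta>)"
    by (simp add: P_def qcoeff_def coeff_sum)
  also have "\<dots> = c \<delta>"
    unfolding qcoeff_qmono using assms(2)
    by (simp add: if_distrib[of "\<lambda>u. _ * u"] sum.delta[OF finite_total_deg(1)] eq_commute[of \<delta>] cong: if_cong)
  finally show ?thesis using \<open>P = 0\<close> by (simp add: qcoeff_def)
qed

lemma mons_unisolvent: "\<exists>xs. length xs = monomial_count n \<and> vdm (mons n) xs \<noteq> 0"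
proof -
  let ?L = "all_exps (Suc n)"
  have bij: "bij_betw (\<lambda>i. ?L ! i) {..<length ?L} {\<gamma>. total_deg \<gamma> < Suc n}"
    using bij_betw_nth[OF distinct_all_exps refl refl, of "Suc n"] by (simp add: set_all_exps)
  have "\<exists>xs. length xs = length (mons n) \<and> vdm (mons n) xs \<noteq> 0"
  proof (rule exists_unisolvent_points)
    fix v :: "nat \<Rightarrow> complex" assume v: "\<forall>z. (\<Sum>i<length (mons n). v i * (mons n ! i) z) = 0"
    define c where "c \<gamma> = v (inv_into {..<length ?L} ((!) ?L) \<gamma>)" for \<gamma>
    have ci: "c (?L ! i) = v i" if "i < length ?L" for i
      using bij_betw_inv_into_left[OF bij, of i] that by (simp add: c_def)
    have "(\<Sum>\<gamma> | total_deg \<gamma> < Suc n. c \<gamma> * monomial_at \<gamma> z) = 0" for z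
    proof -
      have "(\<Sum>\<gamma> | total_deg \<gamma> < Suc n. c \<gamma> * monomial_at \<gamma> z) = (\<Sum>i<length ?L. c (?L ! i) * monomial_at (?L ! i) z)"
        by (rule sum.reindex_bij_betw[OF bij, symmetric])
      also have "\<dots> = (\<Sum>i<length (mons n). v i * (mons n ! i) z)"
        by (rule sum.cong) (auto simp: mons_def ci)
      finally show ?thesis using v by simp
    qed
    from monomials_independent[OF this] have "c \<delta> = 0" if "total_deg \<delta> < Suc n" for \<delta> using that by blast
    moreover have "total_deg (?L ! i) < Suc n" if "i < length ?L" for i
      using nth_mem[OF that] by (simp add: set_all_exps)
    ultimately show "\<forall>i<length (mons n). v i = 0"
      using ci by (metis length_map mons_def)
  qed
  then show ?thesis by (simp add: length_mons)
qed

section \<open>Freeness of C[z] over C[f1, f2] and multiplication matrices\<close>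

text \<open>Of the degreewise determinants only positivity is kept here, which makes the products
  z^\<beta> f^\<alpha> a graded basis; their values come back in \<open>Delta_bounds\<close>. That
  (0, 0) lies in \<Gamma> says that 1 is a generator.\<close>

locale graded_pair =
  fixes d :: nat and A B :: "complex poly" and f1 f2 :: fun2
    and \<Gamma> :: "(nat \<times> nat) set" and "is" :: "nat \<Rightarrow> ((nat \<times> nat) \<times> (nat \<times> nat)) list"
  assumes d: "1 \<le> d" and lead1: "leads d A f1" and lead2: "leads d B f2"
    and fin: "finite \<Gamma>" and cardG: "card \<Gamma> = d\<^sup>2" and zeroG: "(0, 0) \<in> \<Gamma>"
    and degG: "\<And>\<beta>. \<beta> \<in> \<Gamma> \<Longrightarrow> total_deg \<beta> \<le> 2 * d"
    and distinct_is: "\<And>n. distinct (is n)"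
    and set_is: "\<And>n. set (is n) = {(\<beta>, \<alpha>). \<beta> \<in> \<Gamma> \<and> total_deg \<beta> + d * total_deg \<alpha> = n}"
    and length_is: "\<And>n. length (is n) = Suc n"
    and cvd_is: "\<And>n. cvd (map (up A B) (is n)) > 0"
begin

definition f :: "complex \<times> complex \<Rightarrow> complex \<times> complex" where
  "f z = (f1 z, f2 z)"

definition nw :: "(nat \<times> nat) \<times> (nat \<times> nat) \<Rightarrow> fun2" where
  "nw x z = monomial_at (fst x) z * monomial_at (snd x) (f z)"

lemma leads_nw:
  assumes "x \<in> set (is n)"
  shows "leads n (up A B x) (nw x)"
proof -
  obtain \<beta> i j where x: "x = (\<beta>, (i, j))" by (metis surj_pair)
  have n: "total_deg \<beta> + d * i + d * j = n"
    using assms by (simp add: x set_is total_deg_def algebra_simps)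
  have "leads (total_deg \<beta> + d * i + d * j) (monom 1 (fst \<beta>) * A ^ i * B ^ j)
      (\<lambda>z. monomial_at \<beta> z * f1 z ^ i * f2 z ^ j)"
    by (intro leads_mult leads_monomial leads_power lead1 lead2)
  moreover have "nw x = (\<lambda>z. monomial_at \<beta> z * f1 z ^ i * f2 z ^ j)"
    by (simp add: nw_def x f_def monomial_at_def[of "(i, j)"] fun_eq_iff mult.assoc)
  ultimately show ?thesis by (simp add: n up_def x)
qed

definition all_is :: "nat \<Rightarrow> ((nat \<times> nat) \<times> (nat \<times> nat)) list" where
  "all_is n = concat (map is [0..<Suc n])"

text \<open>Modulus of the determinant of the change of basis between the functions
  \<open>nw\<close> and the monomials in degrees up to n, as \<open>vdm_all_is\<close>
  shows.\<close>

definition Delta :: "nat \<Rightarrow> real" where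
  "Delta n = (\<Prod>m<Suc n. cvd (map (up A B) (is m)))"

lemma Delta_pos: "Delta n > 0"
  unfolding Delta_def by (intro prod_pos cvd_is ballI)

lemma vdm_all_is:
  assumes "length xs = monomial_count n + length Y"
  shows "vdm (map nw (all_is n) @ Y) xs = Delta n * vdm (mons n @ Y) xs"
proof -
  have "vdm (concat (map (\<lambda>m. map nw (is m)) [0..<Suc n]) @ Y) xs =
     (\<Prod>m<Suc n. cvd (map (up A B) (is m))) * vdm (map monomial_at (all_exps (Suc n)) @ Y) xs"
    using assms length_is leads_nw
    by (intro vdm_graded) (auto simp: monomial_count_eq less_Suc_eq_le)
  moreover have "map nw (all_is n) = concat (map (\<lambda>m. map nw (is m)) [0..<Suc n])"
    by (simp add: all_is_def map_concat o_def)
  ultimately show ?thesis by (simp add: Delta_def mons_def)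
qed

lemma set_all_is: "set (all_is n) = {(\<beta>, \<alpha>). \<beta> \<in> \<Gamma> \<and> total_deg \<beta> + d * total_deg \<alpha> \<le> n}"
  by (auto simp: all_is_def set_is less_Suc_eq_le simp del: upt_Suc)

lemma distinct_all_is: "distinct (all_is n)"
proof -
  have "distinct (concat (map is [0..<k]))" for k
    by (induction k) (auto simp: distinct_is set_is)
  then show ?thesis unfolding all_is_def .
qed

lemma length_all_is: "length (all_is n) = monomial_count n"
proof -
  have "length (concat (map is [0..<k])) = length (all_exps k)" for k
    by (induction k) (auto simp: length_is all_exps_def exps_def)
  then show ?thesis by (simp only: all_is_def monomial_count_eq)
qed

definition gs :: "(nat \<times> nat) list" where
  "gs = (SOME l. distinct l \<and> set l = \<Gamma>)"

lemma gs: "distinct gs" "set gs = \<Gamma>"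
  using someI_ex[OF finite_distinct_list[OF fin, unfolded conj_commute[of _ "distinct _"]]]
  by (auto simp: gs_def)

definition D :: nat where "D = d\<^sup>2"

lemma length_gs: "length gs = D"
  using gs cardG distinct_card[of gs] by (simp add: D_def)

lemma D_pos: "0 < D" using d by (simp add: D_def)

lemma bij_gs: "bij_betw (\<lambda>i. gs ! i) {..<D} \<Gamma>"
  using bij_betw_nth[OF gs(1) refl refl] by (simp add: length_gs gs(2))

definition g :: "nat \<Rightarrow> fun2" where "g i = monomial_at (gs ! i)"

text \<open>Coordinates of \<open>F\<close> with respect to the generators: each coefficient is a
  polynomial in two variables composed with f.\<close>

definition rep :: "fun2 \<Rightarrow> (nat \<Rightarrow> qpoly) \<Rightarrow> bool" where
  "rep F c \<longleftrightarrow> (\<forall>z. F z = (\<Sum>j<D. ev (c j) (f z) * g j z))"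

lemma rep_sum:
  assumes "\<And>i. i \<in> I \<Longrightarrow> \<exists>c. rep (F i) c"
  shows "\<exists>c. rep (\<lambda>z. \<Sum>i\<in>I. a i * F i z) c"
proof -
  obtain c where c: "\<And>i. i \<in> I \<Longrightarrow> rep (F i) (c i)" using assms by metis
  have "rep (\<lambda>z. \<Sum>i\<in>I. a i * F i z) (\<lambda>j. \<Sum>i\<in>I. [:[:a i:]:] * c i j)"
    unfolding rep_def
  proof
    fix z
    have "(\<Sum>i\<in>I. a i * F i z) = (\<Sum>i\<in>I. \<Sum>j<D. a i * (ev (c i j) (f z) * g j z))"
      by (intro sum.cong refl) (simp only: c[unfolded rep_def, rule_format] sum_distrib_left)
    also have "\<dots> = (\<Sum>j<D. \<Sum>i\<in>I. a i * (ev (c i j) (f z) * g j z))" by (rule sum.swap)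
    also have "\<dots> = (\<Sum>j<D. ev (\<Sum>i\<in>I. [:[:a i:]:] * c i j) (f z) * g j z)"
      by (simp add: sum_distrib_right mult.assoc)
    finally show "(\<Sum>i\<in>I. a i * F i z) = (\<Sum>j<D. ev (\<Sum>i\<in>I. [:[:a i:]:] * c i j) (f z) * g j z)" .
  qed
  then show ?thesis by blast
qed

lemma rep_nw:
  assumes "fst x \<in> \<Gamma>"
  shows "\<exists>c. rep (nw x) c"
proof -
  obtain k where k: "k < D" "gs ! k = fst x" using assms gs(2) length_gs by (metis in_set_conv_nth)
  have "rep (nw x) (\<lambda>j. if j = k then qmono (snd x) else 0)"
    unfolding rep_def nw_def g_def using k
    by (auto simp: if_distrib[of "\<lambda>u. ev u _"] if_distrib[of "\<lambda>u. u * _"] cong: if_cong)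
  then show ?thesis by blast
qed

text \<open>The generators span. In degree n the leading forms of the \<open>nw\<close> have an
  invertible coefficient matrix, so a monomial of degree n is a combination of them up to lower
  degree, where induction applies.\<close>

lemma rep_monomial: "\<exists>c. rep (monomial_at \<gamma>) c"
proof (induction "total_deg \<gamma>" arbitrary: \<gamma> rule: less_induct)
  case less
  define n where "n = total_deg \<gamma>"
  have low: "\<exists>c. rep H c" if "H \<in> polys_below n" for H
  proof -
    obtain c where H: "H = (\<lambda>z. \<Sum>\<gamma> | total_deg \<gamma> < n. c \<gamma> * monomial_at \<gamma> z)" by (rule polys_belowE[OF \<open>H \<in> polys_below n\<close>])
    show ?thesis unfolding H using less by (intro rep_sum) (auto simp: n_def)
  qed
  define p where "p i = up A B (is n ! i)" for i
  have "vdm (map (\<lambda>i. coeff (p i)) [0..<Suc n]) [0..<Suc n] = cvd (map (up A B) (is n))"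
  proof -
    have "map (\<lambda>i. coeff (p i)) [0..<Suc n] = map coeff (map (up A B) (is n))"
      by (intro nth_equalityI) (simp_all add: p_def length_is del: upt_Suc)
    then show ?thesis by (simp only: cvd_def length_map length_is)
  qed
  then have "vdm (map (\<lambda>i. coeff (p i)) [0..<Suc n]) [0..<Suc n] \<noteq> 0" using cvd_is[of n] by simp
  then obtain W where W: "\<And>b j. b < Suc n \<Longrightarrow> j < Suc n \<Longrightarrow> (\<Sum>i<Suc n. W b i * coeff (p i) j) = (if b = j then 1 else 0)"
    by (rule vdm_left_inverse) blast
  have "\<forall>i<Suc n. \<exists>H\<in>polys_below n. nw (is n ! i) = (\<lambda>z. hform n (p i) z + H z)"
    using leads_nw[of _ n] length_is[of n] nth_mem[of _ "is n"] unfolding leads_def p_def by auto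
  then obtain H where H: "\<And>i. i < Suc n \<Longrightarrow> H i \<in> polys_below n"
    "\<And>i. i < Suc n \<Longrightarrow> nw (is n ! i) = (\<lambda>z. hform n (p i) z + H i z)" by metis
  define b where "b = fst \<gamma>"
  have b: "b < Suc n" "\<gamma> = (b, n - b)" by (simp_all add: b_def n_def total_deg_def)
  have "monomial_at \<gamma> z = (\<Sum>i<Suc n. W b i * nw (is n ! i) z) + (\<Sum>i<Suc n. - W b i * H i z)" for z
  proof -
    have "(\<Sum>i<Suc n. W b i * hform n (p i) z) = (\<Sum>j<Suc n. (\<Sum>i<Suc n. W b i * coeff (p i) j) * monomial_at (j, n - j) z)"
      unfolding hform_def sum_distrib_left sum_distrib_right lessThan_Suc_atMost
      by (subst sum.swap) (simp add: mult.assoc)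
    also have "\<dots> = (\<Sum>j<Suc n. (if b = j then 1 else 0) * monomial_at (j, n - j) z)"
      using W[OF b(1)] by (intro sum.cong) auto
    also have "\<dots> = monomial_at \<gamma> z"
      using b by (simp add: if_distrib[of "\<lambda>u. u * _"] del: sum.lessThan_Suc cong: if_cong)
    finally have "monomial_at \<gamma> z = (\<Sum>i<Suc n. W b i * hform n (p i) z)" by simp
    also have "\<dots> = (\<Sum>i<Suc n. W b i * (nw (is n ! i) z - H i z))"
      using H(2) by (intro sum.cong) auto
    finally show ?thesis by (simp add: right_diff_distrib sum_subtractf sum_negf del: sum.lessThan_Suc)
  qed
  \<comment> \<open>The two-term sum is written as a sum over {0, 1} so that \<open>rep_sum\<close>
    covers it.\<close>
  then have eq: "monomial_at \<gamma> = (\<lambda>z. \<Sum>k\<in>{0, 1::nat}. 1 * (if k = 0 then \<Sum>i<Suc n. W b i * nw (is n ! i) z else \<Sum>i<Suc n. - W b i * H i z))"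
    by (simp add: fun_eq_iff del: sum.lessThan_Suc)
  have "\<exists>c. rep (\<lambda>z. \<Sum>i<Suc n. W b i * nw (is n ! i) z) c"
  proof (intro rep_sum rep_nw)
    fix i assume "i \<in> {..<Suc n}"
    then have "is n ! i \<in> set (is n)" by (simp add: length_is)
    then show "fst (is n ! i) \<in> \<Gamma>" by (auto simp: set_is)
  qed
  moreover have "\<exists>c. rep (\<lambda>z. \<Sum>i<Suc n. - W b i * H i z) c"
    using H(1) low by (intro rep_sum) auto
  ultimately show ?case unfolding eq by (intro rep_sum) auto
qed

lemma rep_ev: "\<exists>c. rep (ev P) c"
proof -
  obtain N where "\<forall>z. ev P z = (\<Sum>\<alpha> | total_deg \<alpha> < N. qcoeff P \<alpha> * monomial_at \<alpha> z)"
    using ev_expand by blast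
  then have "ev P = (\<lambda>z. \<Sum>\<alpha> | total_deg \<alpha> < N. qcoeff P \<alpha> * monomial_at \<alpha> z)" by auto
  then show ?thesis by (simp only:) (rule rep_sum[OF rep_monomial])
qed

text \<open>A relation over C[f1, f2] expands into a linear relation between finitely many
  \<open>nw\<close>. At points where the monomials have a nonzero determinant the \<open>nw\<close>
  have one too, since \<open>Delta\<close> is positive, so all coefficients vanish.\<close>

lemma rep_independent:
  assumes "\<And>z. (\<Sum>j<D. ev (c j) (f z) * g j z) = 0" "j < D"
  shows "c j = 0"
proof -
  have "\<forall>i. \<exists>N. \<forall>n\<ge>N. \<forall>z. ev (c i) z = (\<Sum>\<alpha> | total_deg \<alpha> < n. qcoeff (c i) \<alpha> * monomial_at \<alpha> z)"
    using ev_expand by blast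
  then obtain N where N: "\<And>i n z. N i \<le> n \<Longrightarrow> ev (c i) z = (\<Sum>\<alpha> | total_deg \<alpha> < n. qcoeff (c i) \<alpha> * monomial_at \<alpha> z)"
    by metis
  have "qcoeff (c j) \<alpha>\<^sub>0 = 0" for \<alpha>\<^sub>0
  proof -
    define n where "n = (\<Sum>i<D. N i) + Suc (total_deg \<alpha>\<^sub>0)"
    have Nn: "N i \<le> n" if "i < D" for i
      using member_le_sum[of i "{..<D}" N] that by (simp add: n_def)
    \<comment> \<open>Bounds the degree of all products that occur: generators have degree at most 2
      d, and each power of f adds d.\<close>
    define n' where "n' = 2 * d + d * n"
    define a where "a x = (if total_deg (snd x) < n then qcoeff (c (inv_into {..<D} ((!) gs) (fst x))) (snd x) else 0)" for x
    have ai: "a (gs ! i, \<alpha>) = (if total_deg \<alpha> < n then qcoeff (c i) \<alpha> else 0)" if "i < D" for i \<alpha>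
      using bij_betw_inv_into_left[OF bij_gs, of i] that by (simp add: a_def)
    have "(\<Sum>x\<in>set (all_is n'). a x * nw x z) = 0" for z
    proof -
      have "(\<Sum>x\<in>set (all_is n'). a x * nw x z) = (\<Sum>x\<in>\<Gamma> \<times> {\<alpha>. total_deg \<alpha> < n}. a x * nw x z)"
      proof (rule sum.mono_neutral_right)
        have "total_deg \<beta> + d * total_deg \<alpha> \<le> n'" if "\<beta> \<in> \<Gamma>" "total_deg \<alpha> < n" for \<beta> \<alpha>
          using degG[OF that(1)] that(2) by (simp add: n'_def add_mono)
        then show "\<Gamma> \<times> {\<alpha>. total_deg \<alpha> < n} \<subseteq> set (all_is n')" by (auto simp: set_all_is)
        show "\<forall>x\<in>set (all_is n') - \<Gamma> \<times> {\<alpha>. total_deg \<alpha> < n}. a x * nw x z = 0"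
          by (auto simp: set_all_is a_def)
      qed simp
      also have "\<dots> = (\<Sum>\<beta>\<in>\<Gamma>. \<Sum>\<alpha> | total_deg \<alpha> < n. a (\<beta>, \<alpha>) * nw (\<beta>, \<alpha>) z)"
        by (simp add: sum.cartesian_product)
      also have "\<dots> = (\<Sum>i<D. \<Sum>\<alpha> | total_deg \<alpha> < n. a (gs ! i, \<alpha>) * nw (gs ! i, \<alpha>) z)"
        by (rule sum.reindex_bij_betw[OF bij_gs, symmetric])
      also have "\<dots> = (\<Sum>i<D. ev (c i) (f z) * g i z)"
      proof (rule sum.cong[OF refl])
        fix i assume "i \<in> {..<D}"
        then have i: "i < D" by simp
        show "(\<Sum>\<alpha> | total_deg \<alpha> < n. a (gs ! i, \<alpha>) * nw (gs ! i, \<alpha>) z) = ev (c i) (f z) * g i z"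
          unfolding N[OF Nn[OF i]] sum_distrib_right
          by (rule sum.cong) (auto simp: ai[OF i] nw_def g_def)
      qed
      finally show ?thesis using assms(1) by simp
    qed
    then have rel: "(\<Sum>i<length (all_is n'). a (all_is n' ! i) * (map nw (all_is n') ! i) z) = 0" for z
      using sum.reindex_bij_betw[OF bij_betw_nth[OF distinct_all_is refl refl], of "\<lambda>x. a x * nw x z" n'] by simp
    obtain xs where xs: "length xs = monomial_count n'" "vdm (mons n') xs \<noteq> 0" using mons_unisolvent by blast
    have nz: "vdm (map nw (all_is n')) xs \<noteq> 0"
      using vdm_all_is[of xs n' "[]"] xs Delta_pos[of n'] by simp
    have all0: "\<forall>i<length (map nw (all_is n')). a (all_is n' ! i) = 0"
    proof (rule ccontr)
      assume "\<not> ?thesis"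
      then have "vdm (map nw (all_is n')) xs = 0"
        using rel xs(1) length_all_is by (subst vdm_zero_iff_dependent_rows) (auto intro!: exI[of _ "\<lambda>i. a (all_is n' ! i)"])
      with nz show False by simp
    qed
    have "gs ! j \<in> \<Gamma>" using assms(2) gs(2) length_gs nth_mem by metis
    then have "(gs ! j, \<alpha>\<^sub>0) \<in> set (all_is n')"
      using degG[of "gs ! j"] by (simp add: set_all_is n'_def n_def add_mono)
    then have "a (gs ! j, \<alpha>\<^sub>0) = 0" using all0 by (metis in_set_conv_nth length_map)
    then show ?thesis using ai[OF assms(2)] by (simp add: n_def split: if_splits)
  qed
  then show ?thesis by (rule qcoeff_eq_0_imp)
qed


text \<open>The matrix of multiplication by \<open>P\<close> on \<open>\<complex>[z]\<close>, which is free over \<open>\<complex>[f\<^sub>1, f\<^sub>2]\<close> with basis \<open>g\<close>.\<close>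

definition is_mult_matrix :: "qpoly \<Rightarrow> qpoly mat \<Rightarrow> bool" where
  "is_mult_matrix P M \<longleftrightarrow> M \<in> carrier_mat D D \<and>
     (\<forall>i<D. \<forall>z. ev P z * g i z = (\<Sum>j<D. ev (M $$ (i, j)) (f z) * g j z))"

lemma ex_mult_matrix: "\<exists>M. is_mult_matrix P M"
proof -
  have "\<exists>c. rep (\<lambda>z. ev P z * g i z) c" for i
  proof -
    have "(\<lambda>z. ev P z * g i z) = ev (P * qmono (gs ! i))" by (simp add: g_def fun_eq_iff)
    then show ?thesis using rep_ev by metis
  qed
  then obtain c where c: "\<And>i. rep (\<lambda>z. ev P z * g i z) (c i)" by metis
  have "is_mult_matrix P (mat D D (\<lambda>(i, j). c i j))"
    unfolding is_mult_matrix_def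
  proof (intro conjI allI impI)
    fix i z assume i: "i < D"
    show "ev P z * g i z = (\<Sum>j<D. ev (mat D D (\<lambda>(i, j). c i j) $$ (i, j)) (f z) * g j z)"
      using c[of i, unfolded rep_def, rule_format, of z] i by simp
  qed simp
  then show ?thesis by blast
qed

lemma mult_matrix_unique:
  assumes "is_mult_matrix P M" "is_mult_matrix P N"
  shows "M = N"
proof (rule eq_matI)
  fix i j assume "i < dim_row N" "j < dim_col N"
  then have ij: "i < D" "j < D" using assms by (auto simp: is_mult_matrix_def)
  have "M $$ (i, j) - N $$ (i, j) = 0"
  proof (rule rep_independent[OF _ ij(2)])
    fix z
    have "(\<Sum>j<D. ev (M $$ (i, j)) (f z) * g j z) = (\<Sum>j<D. ev (N $$ (i, j)) (f z) * g j z)"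
      using assms(1)[unfolded is_mult_matrix_def, THEN conjunct2, rule_format, OF ij(1), of z]
        assms(2)[unfolded is_mult_matrix_def, THEN conjunct2, rule_format, OF ij(1), of z] by simp
    then show "(\<Sum>j<D. ev (M $$ (i, j) - N $$ (i, j)) (f z) * g j z) = 0"
      by (simp add: left_diff_distrib sum_subtractf)
  qed
  then show "M $$ (i, j) = N $$ (i, j)" by simp
qed (use assms in \<open>auto simp: is_mult_matrix_def\<close>)

definition mmat :: "qpoly \<Rightarrow> qpoly mat" where
  "mmat P = (SOME M. is_mult_matrix P M)"

lemma mmat: "is_mult_matrix P (mmat P)"
  unfolding mmat_def using ex_mult_matrix by (rule someI_ex)

lemma mmat_carrier [simp]: "mmat P \<in> carrier_mat D D"
  using mmat[of P] by (simp add: is_mult_matrix_def)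

lemma mmat_dim [simp]: "dim_row (mmat P) = D" "dim_col (mmat P) = D"
  by (rule carrier_matD[OF mmat_carrier])+

lemma mmat_eq: "i < D \<Longrightarrow> ev P z * g i z = (\<Sum>j<D. ev (mmat P $$ (i, j)) (f z) * g j z)"
  using mmat[of P] unfolding is_mult_matrix_def by blast

lemma mmat_eqI: "is_mult_matrix P M \<Longrightarrow> mmat P = M"
  using mult_matrix_unique mmat by blast

text \<open>The order is reversed because row i holds the coordinates of P g_i. Commutativity of
  multiplication makes these matrices commute.\<close>

lemma mmat_mult: "mmat (P * Q) = mmat Q * mmat P"
proof (rule mmat_eqI, unfold is_mult_matrix_def, intro conjI allI impI)
  show "mmat Q * mmat P \<in> carrier_mat D D" by (meson mult_carrier_mat mmat_carrier)
  fix i z assume i: "i < D"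
  have "ev (P * Q) z * g i z = (\<Sum>j<D. ev (mmat Q $$ (i, j)) (f z) * (ev P z * g j z))"
    using mmat_eq[OF i, of Q z] by (simp add: mult.assoc sum_distrib_left mult.left_commute)
  also have "\<dots> = (\<Sum>j<D. \<Sum>k<D. ev (mmat Q $$ (i, j)) (f z) * (ev (mmat P $$ (j, k)) (f z) * g k z))"
    by (intro sum.cong refl) (simp add: mmat_eq sum_distrib_left)
  also have "\<dots> = (\<Sum>k<D. \<Sum>j<D. ev (mmat Q $$ (i, j)) (f z) * (ev (mmat P $$ (j, k)) (f z) * g k z))"
    by (rule sum.swap)
  also have "\<dots> = (\<Sum>k<D. ev ((mmat Q * mmat P) $$ (i, k)) (f z) * g k z)"
    using i by (intro sum.cong refl) (simp add: scalar_prod_def atLeast0LessThan sum_distrib_right mult.assoc)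
  finally show "ev (P * Q) z * g i z = (\<Sum>k<D. ev ((mmat Q * mmat P) $$ (i, k)) (f z) * g k z)" .
qed

text \<open>Linearity of \<open>mmat\<close> over C[f1, f2].\<close>

lemma mmat_comp:
  assumes "\<And>z. ev P z = (\<Sum>k\<in>I. ev (c k) (f z) * ev (R k) z)"
  shows "mmat P = mat D D (\<lambda>(r, s). \<Sum>k\<in>I. c k * mmat (R k) $$ (r, s))"
proof (rule mmat_eqI, unfold is_mult_matrix_def, intro conjI allI impI)
  fix r z assume r: "r < D"
  have "ev P z * g r z = (\<Sum>k\<in>I. \<Sum>s<D. ev (c k) (f z) * (ev (mmat (R k) $$ (r, s)) (f z) * g s z))"
    by (simp add: assms sum_distrib_right mult.assoc mmat_eq[OF r] sum_distrib_left)
  also have "\<dots> = (\<Sum>s<D. \<Sum>k\<in>I. ev (c k) (f z) * (ev (mmat (R k) $$ (r, s)) (f z) * g s z))" by (rule sum.swap)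
  finally show "ev P z * g r z =
      (\<Sum>s<D. ev (mat D D (\<lambda>(r, s). \<Sum>k\<in>I. c k * mmat (R k) $$ (r, s)) $$ (r, s)) (f z) * g s z)"
    using r by (simp add: sum_distrib_right mult.assoc)
qed simp

text \<open>Multiplication by \<open>P\<close> on the fibre algebra, the quotient of C[z] by f -
  \<zeta>. Its dimension is d^2 for every \<zeta>, however many points the fibre has.\<close>

definition mmat_at :: "qpoly \<Rightarrow> complex \<times> complex \<Rightarrow> complex mat" where
  "mmat_at P \<zeta> = mat D D (\<lambda>(i, j). ev (mmat P $$ (i, j)) \<zeta>)"

lemma mmat_at_carrier [simp]: "mmat_at P \<zeta> \<in> carrier_mat D D"
  by (simp add: mmat_at_def)

lemma mmat_at_dim [simp]: "dim_row (mmat_at P \<zeta>) = D" "dim_col (mmat_at P \<zeta>) = D"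
  by (simp_all add: mmat_at_def)

lemma mmat_at_mult: "mmat_at (P * Q) \<zeta> = mmat_at Q \<zeta> * mmat_at P \<zeta>"
  unfolding mmat_at_def mmat_mult by (rule eq_matI) (auto simp: scalar_prod_def)

lemma mmat_at_commute: "mmat_at P \<zeta> * mmat_at Q \<zeta> = mmat_at Q \<zeta> * mmat_at P \<zeta>"
  by (metis mmat_at_mult mult.commute)

lemma mmat_at_one: "mmat_at 1 \<zeta> = 1\<^sub>m D"
proof -
  have "is_mult_matrix 1 (1\<^sub>m D)"
    by (auto simp: is_mult_matrix_def if_distrib[of "\<lambda>u. ev u _"] if_distrib[of "\<lambda>u. u * _"] cong: if_cong)
  then show ?thesis unfolding mmat_at_def by (subst mmat_eqI) auto
qed

lemma mmat_at_power: "mmat_at (P ^ k) \<zeta> = mmat_at P \<zeta> ^\<^sub>m k"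
  by (induction k) (simp_all add: mmat_at_one mmat_at_mult)

lemma mmat_at_add: "mmat_at (P + Q) \<zeta> = mmat_at P \<zeta> + mmat_at Q \<zeta>"
proof -
  have "is_mult_matrix (P + Q) (mmat P + mmat Q)"
    by (auto simp: is_mult_matrix_def ring_distribs mmat_eq sum.distrib)
  then show ?thesis unfolding mmat_at_def by (subst mmat_eqI) auto
qed

lemma mmat_at_const: "mmat_at [:[:a:]:] \<zeta> = a \<cdot>\<^sub>m 1\<^sub>m D"
proof -
  have "is_mult_matrix [:[:a:]:] ([:[:a:]:] \<cdot>\<^sub>m 1\<^sub>m D)"
    by (auto simp: is_mult_matrix_def if_distrib[of "\<lambda>u. ev u _"] if_distrib[of "\<lambda>u. u * _"] if_distrib[of "\<lambda>u. _ * u"] cong: if_cong)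
  then show ?thesis unfolding mmat_at_def by (subst mmat_eqI) auto
qed

lemma mmat_at_comp:
  assumes "\<And>z. ev P z = ev C (f z)"
  shows "mmat_at P \<zeta> = ev C \<zeta> \<cdot>\<^sub>m 1\<^sub>m D"
proof -
  have "is_mult_matrix P (C \<cdot>\<^sub>m 1\<^sub>m D)"
    by (auto simp: is_mult_matrix_def assms if_distrib[of "\<lambda>u. ev u _"] if_distrib[of "\<lambda>u. u * _"] if_distrib[of "\<lambda>u. _ * u"] cong: if_cong)
  then show ?thesis unfolding mmat_at_def by (subst mmat_eqI) auto
qed

text \<open>The eigenvector is formed by the values of the generators at z. It is nonzero because 1
  is a generator.\<close>

lemma mmat_at_eigenvector: "eigenvalue (mmat_at P (f z)) (ev P z)"
proof -
  define v where "v = vec D (\<lambda>i. g i z)"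
  obtain k where k: "k < D" "gs ! k = (0, 0)" using zeroG gs(2) length_gs by (metis in_set_conv_nth)
  have "v $ k \<noteq> 0" using k by (simp add: v_def g_def monomial_at_def)
  then have "v \<noteq> 0\<^sub>v D" using k by auto
  moreover have "mmat_at P (f z) *\<^sub>v v = ev P z \<cdot>\<^sub>v v"
    by (rule eq_vecI) (auto simp: v_def scalar_prod_def mmat_at_def mmat_eq atLeast0LessThan)
  ultimately show ?thesis unfolding eigenvalue_def eigenvector_def
    by (intro exI[of _ v]) (auto simp: v_def)
qed

lemma ex_comp: "\<exists>P. \<forall>z. ev P z = ev C (f z)"
proof -
  have "\<exists>F1. ev F1 = f1" "\<exists>F2. ev F2 = f2"
  proof -
    have "f1 \<in> polys_below (Suc d)" "f2 \<in> polys_below (Suc d)"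
      using lead1 lead2 unfolding leads_def
      by (auto intro!: polys_below_add hform_in_polys_below intro: polys_below_mono)
    then show "\<exists>F1. ev F1 = f1" "\<exists>F2. ev F2 = f2" by (metis polys_below_imp_ev)+
  qed
  then obtain F1 F2 where F: "ev F1 = f1" "ev F2 = f2" by blast
  obtain N where N: "\<forall>z. ev C z = (\<Sum>\<alpha> | total_deg \<alpha> < N. qcoeff C \<alpha> * monomial_at \<alpha> z)"
    using ev_expand by blast
  show ?thesis
    by (rule exI[of _ "\<Sum>\<alpha> | total_deg \<alpha> < N. [:[:qcoeff C \<alpha>:]:] * (F1 ^ fst \<alpha> * F2 ^ snd \<alpha>)"])
       (simp add: N[rule_format] F monomial_at_def f_def del: split_paired_All)
qed

lemma smult_one_mult_vec:
  fixes a :: complex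
  assumes "v \<in> carrier_vec D"
  shows "(a \<cdot>\<^sub>m 1\<^sub>m D) *\<^sub>v v = a \<cdot>\<^sub>v v"
proof (rule eq_vecI)
  fix i assume "i < dim_vec (a \<cdot>\<^sub>v v)"
  then have i: "i < D" using assms by simp
  have "((a \<cdot>\<^sub>m 1\<^sub>m D) *\<^sub>v v) $ i = (\<Sum>j<D. (if i = j then a else 0) * v $ j)"
    using i assms by (auto simp: scalar_prod_def atLeast0LessThan intro!: sum.cong)
  then show "((a \<cdot>\<^sub>m 1\<^sub>m D) *\<^sub>v v) $ i = (a \<cdot>\<^sub>v v) $ i"
    using i assms by (simp add: if_distrib[of "\<lambda>u. u * _"] cong: if_cong)
qed (use assms in simp)

text \<open>The operators depend on \<open>P\<close> additively and multiplicatively, so a common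
  eigenvector of the two coordinates is an eigenvector for every polynomial, with eigenvalue its
  value at (x, y).\<close>

lemma mmat_at_common_eigenvector:
  assumes v: "v \<in> carrier_vec D" "mmat_at [:[:0, 1:]:] \<zeta> *\<^sub>v v = x \<cdot>\<^sub>v v" "mmat_at [:0, 1:] \<zeta> *\<^sub>v v = y \<cdot>\<^sub>v v"
  shows "mmat_at P \<zeta> *\<^sub>v v = ev P (x, y) \<cdot>\<^sub>v v"
proof -
  have add: "mmat_at (P + Q) \<zeta> *\<^sub>v v = ev (P + Q) (x, y) \<cdot>\<^sub>v v"
    if "mmat_at P \<zeta> *\<^sub>v v = ev P (x, y) \<cdot>\<^sub>v v" "mmat_at Q \<zeta> *\<^sub>v v = ev Q (x, y) \<cdot>\<^sub>v v" for P Q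
    using that v(1) add_mult_distrib_mat_vec[OF mmat_at_carrier mmat_at_carrier v(1)]
    by (simp add: mmat_at_add add_smult_distrib_vec)
  have mult: "mmat_at (P * Q) \<zeta> *\<^sub>v v = ev (P * Q) (x, y) \<cdot>\<^sub>v v"
    if "mmat_at P \<zeta> *\<^sub>v v = ev P (x, y) \<cdot>\<^sub>v v" "mmat_at Q \<zeta> *\<^sub>v v = ev Q (x, y) \<cdot>\<^sub>v v" for P Q
  proof -
    have "mmat_at (P * Q) \<zeta> *\<^sub>v v = mmat_at Q \<zeta> *\<^sub>v (mmat_at P \<zeta> *\<^sub>v v)"
      unfolding mmat_at_mult by (rule assoc_mult_mat_vec[OF mmat_at_carrier mmat_at_carrier v(1)])
    also have "\<dots> = ev P (x, y) \<cdot>\<^sub>v (mmat_at Q \<zeta> *\<^sub>v v)"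
      unfolding that(1) by (rule mult_mat_vec[OF mmat_at_carrier v(1)])
    finally show ?thesis using that(2) by (simp add: smult_smult_assoc)
  qed
  have const: "mmat_at [:[:a:]:] \<zeta> *\<^sub>v v = ev [:[:a:]:] (x, y) \<cdot>\<^sub>v v" for a
    using v(1) by (simp add: mmat_at_const smult_one_mult_vec)
  have X: "mmat_at [:[:0, 1:]:] \<zeta> *\<^sub>v v = ev [:[:0, 1:]:] (x, y) \<cdot>\<^sub>v v" "mmat_at [:0, 1:] \<zeta> *\<^sub>v v = ev [:0, 1:] (x, y) \<cdot>\<^sub>v v"
    using v by (simp_all add: ev_def)
  have 1: "mmat_at [:p:] \<zeta> *\<^sub>v v = ev [:p:] (x, y) \<cdot>\<^sub>v v" for p
  proof (induction p)
    case 0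
    then show ?case using const[of 0] by simp
  next
    case (pCons a p)
    have "[:pCons a p:] = [:[:a:]:] + [:[:0, 1:]:] * [:p:]" by simp
    then show ?case using add[OF const mult[OF X(1) pCons.IH]] by metis
  qed
  show ?thesis
  proof (induction P)
    case 0
    then show ?case using const[of 0] by simp
  next
    case (pCons a p)
    have "pCons a p = [:a:] + [:0, 1:] * p" by simp
    then show ?case using add[OF 1 mult[OF X(2) pCons.IH]] by metis
  qed
qed

text \<open>Converse to \<open>mmat_at_eigenvector\<close> and the source of all fibre points. The
  eigenspace for k is invariant under the commuting operators z1 and z2, hence contains a common
  eigenvector. Its two eigenvalues are the coordinates of a point with value k, and as polynomials
  in f act by scalars, this point lies over \<zeta>.\<close>

lemma eigenvalue_nn_imp_fibre:
  assumes "eigenvalue (mmat_at P \<zeta>) k"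
  obtains w where "f w = \<zeta>" "ev P w = k"
proof -
  obtain v where v: "v \<in> carrier_vec D" "v \<noteq> 0\<^sub>v D" "mmat_at P \<zeta> *\<^sub>v v = k \<cdot>\<^sub>v v"
    using assms by (auto simp: eigenvalue_def eigenvector_def)
  have step: "\<exists>w x. w \<in> W \<and> w \<noteq> 0\<^sub>v D \<and> mmat_at X \<zeta> *\<^sub>v w = x \<cdot>\<^sub>v w"
    if W: "W \<subseteq> carrier_vec D" "u \<in> W" "u \<noteq> 0\<^sub>v D" "\<And>u w. u \<in> W \<Longrightarrow> w \<in> W \<Longrightarrow> u + w \<in> W"
      "\<And>c w. w \<in> W \<Longrightarrow> c \<cdot>\<^sub>v w \<in> W" "\<And>w. w \<in> W \<Longrightarrow> mmat_at X \<zeta> *\<^sub>v w \<in> W" for W u X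
    by (rule invariant_subspace_eigenvector[OF mmat_at_carrier W])
  \<comment> \<open>Simultaneous eigenspace for the prescribed pairs of operator and eigenvalue. It
    is invariant under every \<open>mmat_at X\<close> because these commute, so further eigenvalues
    can be prescribed one at a time.\<close>
  define W where "W S = {w \<in> carrier_vec D. \<forall>(Q, c)\<in>S. mmat_at Q \<zeta> *\<^sub>v w = c \<cdot>\<^sub>v w}" for S
  have W: "W S \<subseteq> carrier_vec D" "\<And>u w. u \<in> W S \<Longrightarrow> w \<in> W S \<Longrightarrow> u + w \<in> W S"
      "\<And>c w. w \<in> W S \<Longrightarrow> c \<cdot>\<^sub>v w \<in> W S" "\<And>w X. w \<in> W S \<Longrightarrow> mmat_at X \<zeta> *\<^sub>v w \<in> W S" for S
  proof -
    show "W S \<subseteq> carrier_vec D" by (auto simp: W_def)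
    show "u + w \<in> W S" if "u \<in> W S" "w \<in> W S" for u w
    proof -
      have c: "u \<in> carrier_vec D" "w \<in> carrier_vec D" using that by (auto simp: W_def)
      have "mmat_at Q \<zeta> *\<^sub>v (u + w) = k \<cdot>\<^sub>v (u + w)" if Qk: "(Q, k) \<in> S" for Q k
      proof -
        have "mmat_at Q \<zeta> *\<^sub>v (u + w) = mmat_at Q \<zeta> *\<^sub>v u + mmat_at Q \<zeta> *\<^sub>v w"
          by (rule mult_add_distrib_mat_vec[OF mmat_at_carrier c])
        also have "\<dots> = k \<cdot>\<^sub>v u + k \<cdot>\<^sub>v w" using that(1) \<open>w \<in> W S\<close> \<open>u \<in> W S\<close> Qk unfolding W_def by fastforce
        also have "\<dots> = k \<cdot>\<^sub>v (u + w)" by (rule smult_add_distrib_vec[OF c, symmetric])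
        finally show ?thesis .
      qed
      then show ?thesis using c by (auto simp: W_def)
    qed
    show "c \<cdot>\<^sub>v w \<in> W S" if "w \<in> W S" for c w
    proof -
      have wc: "w \<in> carrier_vec D" using that by (simp add: W_def)
      have "mmat_at Q \<zeta> *\<^sub>v (c \<cdot>\<^sub>v w) = k \<cdot>\<^sub>v (c \<cdot>\<^sub>v w)" if Qk: "(Q, k) \<in> S" for Q k
      proof -
        have "mmat_at Q \<zeta> *\<^sub>v w = k \<cdot>\<^sub>v w" using \<open>w \<in> W S\<close> Qk unfolding W_def by fastforce
        then show ?thesis using mult_mat_vec[OF mmat_at_carrier wc, of Q \<zeta> c] by (simp add: smult_smult_assoc mult.commute)
      qed
      then show ?thesis using wc by (auto simp: W_def)
    qed
    show "mmat_at X \<zeta> *\<^sub>v w \<in> W S" if w: "w \<in> W S" for w X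
    proof -
      have wc: "w \<in> carrier_vec D" using w by (simp add: W_def)
      have "mmat_at Q \<zeta> *\<^sub>v (mmat_at X \<zeta> *\<^sub>v w) = c \<cdot>\<^sub>v (mmat_at X \<zeta> *\<^sub>v w)" if "(Q, c) \<in> S" for Q c
      proof -
        have "mmat_at Q \<zeta> *\<^sub>v (mmat_at X \<zeta> *\<^sub>v w) = mmat_at X \<zeta> *\<^sub>v (mmat_at Q \<zeta> *\<^sub>v w)"
          by (simp only: assoc_mult_mat_vec[OF mmat_at_carrier mmat_at_carrier wc, symmetric] mmat_at_commute[of Q \<zeta> X])
        also have "mmat_at Q \<zeta> *\<^sub>v w = c \<cdot>\<^sub>v w" using w that by (auto simp: W_def)
        finally show ?thesis using mult_mat_vec[OF mmat_at_carrier wc] by simp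
      qed
      moreover have "mmat_at X \<zeta> *\<^sub>v w \<in> carrier_vec D" by (rule mult_mat_vec_carrier[OF mmat_at_carrier wc])
      ultimately show ?thesis by (auto simp: W_def)
    qed
  qed
  have "v \<in> W {(P, k)}" using v by (simp add: W_def)
  from step[OF W(1) this v(2) W(2,3,4)] obtain v1 x
    where v1: "v1 \<in> W {(P, k)}" "v1 \<noteq> 0\<^sub>v D" "mmat_at [:[:0, 1:]:] \<zeta> *\<^sub>v v1 = x \<cdot>\<^sub>v v1" by blast
  then have "v1 \<in> W {(P, k), ([:[:0, 1:]:], x)}" by (simp add: W_def)
  from step[OF W(1) this v1(2) W(2,3,4)] obtain v2 y
    where v2: "v2 \<in> W {(P, k), ([:[:0, 1:]:], x)}" "v2 \<noteq> 0\<^sub>v D" "mmat_at [:0, 1:] \<zeta> *\<^sub>v v2 = y \<cdot>\<^sub>v v2" by blast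
  have c: "v2 \<in> carrier_vec D" and ce: "mmat_at [:[:0, 1:]:] \<zeta> *\<^sub>v v2 = x \<cdot>\<^sub>v v2" "mmat_at P \<zeta> *\<^sub>v v2 = k \<cdot>\<^sub>v v2"
    using v2 by (auto simp: W_def)
  have inj: "a = b" if "a \<cdot>\<^sub>v v2 = b \<cdot>\<^sub>v v2" for a b
  proof -
    obtain i where i: "i < D" "v2 $ i \<noteq> 0"
    proof (rule ccontr)
      assume "\<not> thesis"
      then have "v2 = 0\<^sub>v D" using that c by (intro eq_vecI) auto
      with v2 show False by simp
    qed
    have "(a \<cdot>\<^sub>v v2) $ i = (b \<cdot>\<^sub>v v2) $ i" using that by simp
    then show ?thesis using i c by simp
  qed
  note ev2 = mmat_at_common_eigenvector[OF c ce(1) v2(3)]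
  have "ev P (x, y) = k" using ev2[of P] ce(2) by (intro inj) simp
  moreover have "f (x, y) = \<zeta>"
  proof -
    \<comment> \<open>The composition of C with f acts on the eigenvector both as its value at (x,
      y) and as the scalar C(\<zeta>).\<close>
    have eq: "ev C (f (x, y)) = ev C \<zeta>" for C
    proof -
      obtain Q where Q: "\<And>z. ev Q z = ev C (f z)" using ex_comp by blast
      have "ev Q (x, y) \<cdot>\<^sub>v v2 = mmat_at Q \<zeta> *\<^sub>v v2" by (rule ev2[symmetric])
      also have "\<dots> = ev C \<zeta> \<cdot>\<^sub>v v2"
        unfolding mmat_at_comp[OF Q] by (rule smult_one_mult_vec[OF c])
      finally have "ev Q (x, y) = ev C \<zeta>" by (rule inj)
      then show ?thesis using Q by simp
    qed
    show ?thesis using eq[of "[:[:0, 1:]:]"] eq[of "[:0, 1:]"] by (simp add: ev_def prod_eq_iff)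
  qed
  ultimately show thesis using that by blast
qed

text \<open>The trace of C[z] over C[f1, f2]. As a polynomial it is defined at every \<zeta>,
  including those with degenerate fibre.\<close>

definition tau :: "qpoly \<Rightarrow> qpoly" where "tau P = mtrace (mmat P)"

lemma ev_tau: "ev (tau P) \<zeta> = mtrace (mmat_at P \<zeta>)"
  by (simp add: tau_def mtrace_def mmat_at_def)

text \<open>The trace at \<zeta> is a sum of D eigenvalues, and every eigenvalue is a value of
  \<open>P\<close> on the fibre.\<close>

lemma ev_tau_le:
  obtains w where "f w = \<zeta>" "cmod (ev (tau P) \<zeta>) \<le> real D * cmod (ev P w)"
proof -
  obtain k where k: "eigenvalue (mmat_at P \<zeta>) k" "cmod (mtrace (mmat_at P \<zeta>)) \<le> real D * cmod k"
    by (rule mtrace_le_eigenvalue[OF mmat_at_carrier D_pos])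
  obtain w where "f w = \<zeta>" "ev P w = k" by (rule eigenvalue_nn_imp_fibre[OF k(1)])
  then show thesis using k(2) that[of w] by (simp add: ev_tau)
qed

lemma tau_comp:
  assumes "\<And>z. ev P z = (\<Sum>k\<in>I. ev (c k) (f z) * ev (R k) z)"
  shows "tau P = (\<Sum>k\<in>I. c k * tau (R k))"
proof -
  have "tau P = (\<Sum>i<D. \<Sum>k\<in>I. c k * mmat (R k) $$ (i, i))"
    unfolding tau_def mtrace_def mmat_comp[OF assms] by simp
  also have "\<dots> = (\<Sum>k\<in>I. c k * tau (R k))"
    by (subst sum.swap) (simp add: tau_def mtrace_def sum_distrib_left)
  finally show ?thesis .
qed

text \<open>Gram matrix of the trace form in the basis of generators; its determinant is the
  discriminant, a polynomial on the target.\<close>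

definition gram :: "qpoly mat" where
  "gram = mat D D (\<lambda>(i, j). tau (qmono (gs ! i) * qmono (gs ! j)))"

text \<open>The trace form is nondegenerate: an element \<open>p\<close> of its radical has nilpotent multiplication
  matrices over every point, hence vanishes.\<close>

lemma det_gram_nonzero: "det gram \<noteq> 0"
proof
  assume "det gram = 0"
  then obtain v where v: "v \<in> carrier_vec D" "v \<noteq> 0\<^sub>v D" "gram *\<^sub>v v = 0\<^sub>v D"
    using det_0_iff_vec_prod_zero[of gram D] by (auto simp: gram_def)
  \<comment> \<open>The kernel vector has entries on the target side; composed with f they become
    the coordinates of an element p of C[z] in the radical of the trace form.\<close>
  have "\<forall>j. \<exists>C. \<forall>z. ev C z = ev (v $ j) (f z)" using ex_comp by blast
  then obtain C where C: "\<And>j z. ev (C j) z = ev (v $ j) (f z)" by metis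
  define p where "p = (\<Sum>j<D. C j * qmono (gs ! j))"
  have p: "ev p z = (\<Sum>j<D. ev (v $ j) (f z) * ev (qmono (gs ! j)) z)" for z
    by (simp add: p_def C)
  have tau0: "tau (p * q) = 0" for q
  proof -
    obtain b where b: "rep (ev q) b" using rep_ev by blast
    have "tau (p * q) = (\<Sum>(k, j)\<in>{..<D} \<times> {..<D}. b k * v $ j * tau (qmono (gs ! k) * qmono (gs ! j)))"
    proof -
      have "tau (p * q) = (\<Sum>x\<in>{..<D} \<times> {..<D}. (b (fst x) * v $ snd x) * tau (qmono (gs ! fst x) * qmono (gs ! snd x)))"
      proof (rule tau_comp)
        fix z
        have "ev (p * q) z = (\<Sum>k<D. ev (b k) (f z) * g k z) * (\<Sum>j<D. ev (v $ j) (f z) * ev (qmono (gs ! j)) z)"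
          using b[unfolded rep_def, rule_format, of z] p[of z] by (simp add: mult.commute)
        also have "\<dots> = (\<Sum>x\<in>{..<D} \<times> {..<D}. ev (b (fst x) * v $ snd x) (f z) * ev (qmono (gs ! fst x) * qmono (gs ! snd x)) z)"
          unfolding sum_product sum.cartesian_product
          by (intro sum.cong refl) (auto simp: g_def mult_ac)
        finally show "ev (p * q) z = (\<Sum>x\<in>{..<D} \<times> {..<D}. ev (b (fst x) * v $ snd x) (f z) * ev (qmono (gs ! fst x) * qmono (gs ! snd x)) z)" .
      qed
      then show ?thesis by (simp add: case_prod_unfold)
    qed
    also have "\<dots> = (\<Sum>k<D. b k * (\<Sum>j<D. tau (qmono (gs ! k) * qmono (gs ! j)) * v $ j))"
      by (simp add: sum.cartesian_product[symmetric] sum_distrib_left mult_ac)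
    also have "\<dots> = 0"
    proof (rule sum.neutral, rule ballI)
      fix k assume "k \<in> {..<D}"
      then have k: "k < D" by simp
      have "(\<Sum>j<D. tau (qmono (gs ! k) * qmono (gs ! j)) * v $ j) = (gram *\<^sub>v v) $ k"
        using k v(1) by (simp add: gram_def scalar_prod_def atLeast0LessThan)
      then show "b k * (\<Sum>j<D. tau (qmono (gs ! k) * qmono (gs ! j)) * v $ j) = 0" using v(3) k by simp
    qed
    finally show ?thesis .
  qed
  have "ev p z = 0" for z
  proof (rule eigenvalue_zero_if_traces_vanish[OF mmat_at_carrier _ mmat_at_eigenvector])
    fix m :: nat assume "0 < m"
    then have "p ^ m = p * p ^ (m - 1)" by (simp add: power_eq_if)
    then have "tau (p ^ m) = 0" using tau0 by metis
    then show "mtrace (mmat_at p (f z) ^\<^sub>m m) = 0"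
      using ev_tau[of "p ^ m" "f z"] by (simp add: mmat_at_power)
  qed
  then have "(\<Sum>j<D. ev (v $ j) (f z) * g j z) = 0" for z
    using p[of z] by (simp add: g_def)
  then have "v $ j = 0" if "j < D" for j using rep_independent[of "\<lambda>j. v $ j" j] that by blast
  then have "v = 0\<^sub>v D" using v(1) by (intro eq_vecI) auto
  with v(2) show False by simp
qed

end

section \<open>Properness of f and choice of points in the fibres\<close>

lemma ev_bounded:
  assumes "\<And>z. z \<in> K \<Longrightarrow> cmod (fst z) \<le> c \<and> cmod (snd z) \<le> c"
  obtains C where "1 \<le> C" "\<And>z. z \<in> K \<Longrightarrow> cmod (ev P z) \<le> C"
proof -
  obtain N where N: "\<forall>z. ev P z = (\<Sum>\<alpha> | total_deg \<alpha> < N. qcoeff P \<alpha> * monomial_at \<alpha> z)"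
    using ev_expand by blast
  define C where "C = 1 + (\<Sum>\<alpha> | total_deg \<alpha> < N. cmod (qcoeff P \<alpha>) * max 1 c ^ N)"
  show thesis
  proof (rule that[of C])
    show "1 \<le> C" by (auto simp: C_def intro!: sum_nonneg)
    fix z assume z: "z \<in> K"
    have "cmod (ev P z) \<le> (\<Sum>\<alpha> | total_deg \<alpha> < N. cmod (qcoeff P \<alpha> * monomial_at \<alpha> z))"
      unfolding N[rule_format] by (rule norm_sum)
    also have "\<dots> \<le> (\<Sum>\<alpha> | total_deg \<alpha> < N. cmod (qcoeff P \<alpha>) * max 1 c ^ N)"
    proof (rule sum_mono)
      fix \<alpha> assume "\<alpha> \<in> {\<alpha>. total_deg \<alpha> < N}"
      then have "cmod (monomial_at \<alpha> z) \<le> max 1 c ^ N"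
        using assms[OF z] by (intro cmod_monomial_at_le) auto
      then show "cmod (qcoeff P \<alpha> * monomial_at \<alpha> z) \<le> cmod (qcoeff P \<alpha>) * max 1 c ^ N"
        unfolding norm_mult by (rule mult_left_mono) simp
    qed
    finally show "cmod (ev P z) \<le> C" by (simp add: C_def)
  qed
qed

context graded_pair
begin

text \<open>Reads the eigenvector equation in a row where the modulus of g_i(z) is largest. This
  modulus is at least 1, since 1 is among the generators, and can be cancelled.\<close>

lemma eigenvalue_bound:
  assumes "\<And>i j. i < D \<Longrightarrow> j < D \<Longrightarrow> cmod (ev (mmat P $$ (i, j)) (f z)) \<le> C"
  shows "cmod (ev P z) \<le> real D * C"
proof -
  have "finite ((\<lambda>i. cmod (g i z)) ` {..<D})" "(\<lambda>i. cmod (g i z)) ` {..<D} \<noteq> {}" using D_pos by auto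
  from Max_in[OF this] obtain i where i: "i < D" "Max ((\<lambda>i. cmod (g i z)) ` {..<D}) = cmod (g i z)" by auto
  have le: "cmod (g j z) \<le> cmod (g i z)" if "j < D" for j
    unfolding i(2)[symmetric] using that by (intro Max_ge) auto
  obtain k where k: "k < D" "gs ! k = (0, 0)" using zeroG gs(2) length_gs by (metis in_set_conv_nth)
  have "1 \<le> cmod (g i z)" using le[OF k(1)] k(2) by (simp add: g_def monomial_at_def)
  have "cmod (ev P z) * cmod (g i z) = cmod (\<Sum>j<D. ev (mmat P $$ (i, j)) (f z) * g j z)"
    unfolding norm_mult[symmetric] mmat_eq[OF i(1)] ..
  also have "\<dots> \<le> (\<Sum>j<D. cmod (ev (mmat P $$ (i, j)) (f z) * g j z))" by (rule norm_sum)
  also have "\<dots> \<le> (\<Sum>j<D. C * cmod (g i z))"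
    unfolding norm_mult using assms[OF i(1)] le order_trans[OF norm_ge_zero assms[OF i(1)]]
    by (intro sum_mono mult_mono) auto
  finally have "cmod (ev P z) * cmod (g i z) \<le> (real D * C) * cmod (g i z)" by simp
  then show ?thesis by (rule mult_right_le_imp_le) (use \<open>1 \<le> cmod (g i z)\<close> in linarith)
qed

text \<open>Properness of f: the coordinates of z are eigenvalues of matrices whose entries are
  polynomials in f(z), hence bounded for f(z) in \<open>K\<close>.\<close>

lemma preimage_bounded:
  assumes K: "\<And>z. z \<in> K \<Longrightarrow> cmod (fst z) \<le> c \<and> cmod (snd z) \<le> c"
  obtains C where "1 \<le> C" "\<And>z. f z \<in> K \<Longrightarrow> cmod (fst z) \<le> C \<and> cmod (snd z) \<le> C"
proof -
  have "\<exists>C\<ge>1. \<forall>z. f z \<in> K \<longrightarrow> cmod (ev P z) \<le> C" for P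
  proof -
    have "\<forall>x. \<exists>C\<ge>1. \<forall>z\<in>K. cmod (ev (mmat P $$ x) z) \<le> C" by (metis ev_bounded[OF K])
    then obtain C where C: "\<And>x. 1 \<le> C x" "\<And>x z. z \<in> K \<Longrightarrow> cmod (ev (mmat P $$ x) z) \<le> C x" by metis
    define M where "M = (\<Sum>x\<in>{..<D} \<times> {..<D}. C x)"
    have "C x \<le> M" if "x \<in> {..<D} \<times> {..<D}" for x
      unfolding M_def using that C(1) by (intro member_le_sum) (auto intro: order_trans[OF zero_le_one])
    then have CM: "cmod (ev (mmat P $$ (i, j)) z) \<le> M" if "z \<in> K" "i < D" "j < D" for z i j
      using C(2)[OF that(1), of "(i, j)"] that by (meson SigmaI lessThan_iff order_trans)
    have "cmod (ev P z) \<le> max 1 (real D * M)" if "f z \<in> K" for z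
      using eigenvalue_bound[of P z M] CM[OF that] by auto
    then show ?thesis by (intro exI[of _ "max 1 (real D * M)"]) auto
  qed
  then obtain C where C: "\<And>P. 1 \<le> C P" "\<And>P z. f z \<in> K \<Longrightarrow> cmod (ev P z) \<le> C P" by metis
  show thesis
  proof (rule that[of "max (C [:[:0, 1:]:]) (C [:0, 1:])"])
    fix z assume "f z \<in> K"
    then show "cmod (fst z) \<le> max (C [:[:0, 1:]:]) (C [:0, 1:]) \<and> cmod (snd z) \<le> max (C [:[:0, 1:]:]) (C [:0, 1:])"
      using C(2)[of z "[:[:0, 1:]:]"] C(2)[of z "[:0, 1:]"] by (auto simp: ev_def)
  qed (use C(1) in \<open>simp add: max.coboundedI1\<close>)
qed

text \<open>Starts from the Gram matrix at \<zeta> and replaces its trace columns one after another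
  by columns g_i(w) with w in the fibre. The determinant is linear in the column concerned, so with
  the trace column it is the trace of a polynomial p g_k, at most D times the modulus of p(w) g_k(w)
  for some w in the fibre; and p(w) is the determinant with the new column. Each column costs a
  factor D G. The points may coincide, and then the discriminant vanishes at \<zeta>.\<close>

lemma fibre_points:
  assumes G: "\<And>w i. f w = \<zeta> \<Longrightarrow> i < D \<Longrightarrow> cmod (g i w) \<le> G"
  obtains ws where "length ws = D" "\<And>w. w \<in> set ws \<Longrightarrow> f w = \<zeta>"
    "cmod (ev (det gram) \<zeta>) \<le> (real D * G) ^ D * vdm (map monomial_at gs) ws"
proof -
  define b where "b i j = ev (tau (qmono (gs ! i) * qmono (gs ! j))) \<zeta>" for i j
  define M where "M k ws = mat D D (\<lambda>(i, j). if j < k then g i (ws ! j) else b i j)" for k ws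
  have Mc: "M k ws \<in> carrier_mat D D" for k ws by (simp add: M_def)
  interpret h: comm_ring_hom "\<lambda>q. ev q \<zeta>" by unfold_locales auto
  have "map_mat (\<lambda>q. ev q \<zeta>) gram = M 0 []"
    by (rule eq_matI) (auto simp: gram_def M_def b_def)
  then have base: "ev (det gram) \<zeta> = det (M 0 [])" using h.hom_det[of gram] by simp
  \<comment> \<open>The trace estimate for the constant 1 provides a point of the fibre, at which
    \<open>G\<close> bounds a modulus.\<close>
  have G0: "0 \<le> G"
  proof -
    obtain w where "f w = \<zeta>" by (rule ev_tau_le[of \<zeta> 1])
    then show ?thesis using G[of w 0] D_pos by (meson norm_ge_zero order_trans)
  qed
  have "\<exists>ws. length ws = k \<and> (\<forall>w\<in>set ws. f w = \<zeta>) \<and>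
      cmod (ev (det gram) \<zeta>) \<le> (real D * G) ^ k * cmod (det (M k ws))" if "k \<le> D" for k
    using that
  proof (induction k)
    case 0
    then show ?case using base by auto
  next
    case (Suc k)
    then have k: "k < D" by simp
    from Suc obtain ws where ws: "length ws = k" "\<forall>w\<in>set ws. f w = \<zeta>"
      "cmod (ev (det gram) \<zeta>) \<le> (real D * G) ^ k * cmod (det (M k ws))" by auto
    define co where "co i = cofactor (M k ws) i k" for i
    \<comment> \<open>The cofactors of column k do not see that column, so they serve for the old
      trace column and for the new one alike.\<close>
    define p where "p = (\<Sum>i<D. [:[:co i:]:] * qmono (gs ! i))"
    have col: "det (M (Suc k) (ws @ [w])) = ev p w" for w
    proof -
      have "det (M (Suc k) (ws @ [w])) = (\<Sum>i<D. M (Suc k) (ws @ [w]) $$ (i, k) * cofactor (M (Suc k) (ws @ [w])) i k)"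
        by (rule laplace_expansion_column[OF Mc k])
      also have "\<dots> = (\<Sum>i<D. co i * ev (qmono (gs ! i)) w)"
      proof (rule sum.cong[OF refl])
        fix i assume "i \<in> {..<D}"
        then have i: "i < D" by simp
        have "mat_delete (M (Suc k) (ws @ [w])) i k = mat_delete (M k ws) i k"
          using k ws(1) by (intro eq_matI) (auto simp: mat_delete_def M_def nth_append)
        then show "M (Suc k) (ws @ [w]) $$ (i, k) * cofactor (M (Suc k) (ws @ [w])) i k = co i * ev (qmono (gs ! i)) w"
          using i k ws(1) by (simp add: co_def cofactor_def M_def g_def nth_append)
      qed
      finally show ?thesis by (simp add: p_def)
    qed
    have "det (M k ws) = (\<Sum>i<D. M k ws $$ (i, k) * cofactor (M k ws) i k)"
      by (rule laplace_expansion_column[OF Mc k])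
    also have "\<dots> = (\<Sum>i<D. co i * b i k)"
      using k by (intro sum.cong) (auto simp: M_def co_def)
    also have "\<dots> = ev (\<Sum>i<D. [:[:co i:]:] * tau (qmono (gs ! i) * qmono (gs ! k))) \<zeta>"
      by (simp add: b_def)
    also have "(\<Sum>i<D. [:[:co i:]:] * tau (qmono (gs ! i) * qmono (gs ! k))) = tau (p * qmono (gs ! k))"
      by (rule tau_comp[symmetric]) (simp add: p_def sum_distrib_right mult.assoc)
    finally have detk: "det (M k ws) = ev (tau (p * qmono (gs ! k))) \<zeta>" .
    obtain w where w: "f w = \<zeta>" "cmod (ev (tau (p * qmono (gs ! k))) \<zeta>) \<le> real D * cmod (ev (p * qmono (gs ! k)) w)"
      by (rule ev_tau_le)
    have "cmod (ev (p * qmono (gs ! k)) w) = cmod (det (M (Suc k) (ws @ [w]))) * cmod (g k w)"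
      by (simp add: col norm_mult g_def)
    also have "\<dots> \<le> cmod (det (M (Suc k) (ws @ [w]))) * G"
      using G[OF w(1) k] by (rule mult_left_mono) simp
    finally have "cmod (det (M k ws)) \<le> real D * (cmod (det (M (Suc k) (ws @ [w]))) * G)"
      using w(2) detk by (simp add: order_trans mult_left_mono)
    then have "(real D * G) ^ k * cmod (det (M k ws)) \<le> (real D * G) ^ k * (real D * (cmod (det (M (Suc k) (ws @ [w]))) * G))"
      using G0 by (intro mult_left_mono) auto
    with ws(3) have "cmod (ev (det gram) \<zeta>) \<le> (real D * G) ^ Suc k * cmod (det (M (Suc k) (ws @ [w])))"
      by (simp add: mult_ac)
    then show ?case using ws w(1) by (intro exI[of _ "ws @ [w]"]) auto
  qed
  from this[of D] obtain ws where ws: "length ws = D" "\<forall>w\<in>set ws. f w = \<zeta>"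
      "cmod (ev (det gram) \<zeta>) \<le> (real D * G) ^ D * cmod (det (M D ws))" by auto
  have "M D ws = mat D D (\<lambda>(i, j). (map monomial_at gs ! i) (ws ! j))"
    by (intro eq_matI) (auto simp: M_def g_def length_gs)
  then have "cmod (det (M D ws)) = vdm (map monomial_at gs) ws" by (simp add: vdm_def length_gs)
  with ws show thesis by (intro that[of ws]) auto
qed

end

section \<open>Estimates for several blocks of rows and Kronecker products\<close>

lemma vdm_concat_le:
  assumes "length xs = length (concat fss) + length rest" "length xs \<le> N" "0 \<le> b" "0 \<le> r"
    and "\<And>fs ys. fs \<in> set fss \<Longrightarrow> set ys \<subseteq> set xs \<Longrightarrow> length ys = length fs \<Longrightarrow> vdm fs ys \<le> b"
    and "\<And>ys. set ys \<subseteq> set xs \<Longrightarrow> length ys = length rest \<Longrightarrow> vdm rest ys \<le> r"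
  shows "vdm (concat fss @ rest) xs \<le> (2 ^ N * b) ^ length fss * r"
  using assms
proof (induction fss arbitrary: xs)
  case Nil
  then show ?case by simp
next
  case (Cons fs fss)
  have "vdm (fs @ (concat fss @ rest)) xs \<le> 2 ^ length xs * (b * ((2 ^ N * b) ^ length fss * r))"
  proof (rule vdm_append_le)
    fix ys assume ys: "set ys \<subseteq> set xs"
    show "vdm fs ys \<le> b" if "length ys = length fs" using Cons.prems(5) ys that by simp
    show "vdm (concat fss @ rest) ys \<le> (2 ^ N * b) ^ length fss * r" if "length ys = length (concat fss @ rest)"
    proof (rule Cons.IH)
      show "length ys = length (concat fss) + length rest" "length ys \<le> N" using that Cons.prems by auto
      show "vdm fs' zs \<le> b" if "fs' \<in> set fss" "set zs \<subseteq> set ys" "length zs = length fs'" for fs' zs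
        using that ys by (intro Cons.prems(5)) auto
      show "vdm rest zs \<le> r" if "set zs \<subseteq> set ys" "length zs = length rest" for zs
        using that ys by (intro Cons.prems(6)) auto
    qed (use Cons.prems in auto)
  qed (use Cons.prems in auto)
  also have "\<dots> \<le> 2 ^ N * (b * ((2 ^ N * b) ^ length fss * r))"
    using Cons.prems by (intro mult_right_mono power_increasing mult_nonneg_nonneg) auto
  finally show ?case by (simp add: mult_ac)
qed

lemma fact_le_two_power: "(fact r :: real) \<le> 2 ^ (r * r)"
proof -
  have "(fact r :: real) \<le> real r ^ r" using fact_le_power[of r, where ?'a = real] by simp
  also have "\<dots> \<le> (2 ^ r) ^ r"
    using of_nat_less_two_power[of r, where ?'a = real] by (intro power_mono) auto
  finally show ?thesis by (simp add: power_mult)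
qed

text \<open>For the rows left over by an index comparison: O(n) functions of size exp (O(n)) have
  determinants of size exp (O(n^2)), negligible against l_n. With O(n) rows even the bound 2^(r^2)
  for the factorial is good enough.\<close>

lemma vdm_crude_bound:
  assumes "length xs = length fs" "length fs \<le> L * n" "1 \<le> C"
    and "\<And>f x. f \<in> set fs \<Longrightarrow> x \<in> set xs \<Longrightarrow> cmod (f x) \<le> C ^ n"
  shows "vdm fs xs \<le> (2 ^ (L * L) * C ^ L) ^ n\<^sup>2"
proof -
  have "vdm fs xs \<le> fact (length fs) * (C ^ n) ^ length fs"
    using assms by (intro vdm_le_fact) auto
  also have "\<dots> \<le> 2 ^ (length fs * length fs) * C ^ (n * length fs)"
    using assms(3) fact_le_two_power by (intro mult_mono) (auto simp: power_mult)
  also have "\<dots> \<le> 2 ^ ((L * n) * (L * n)) * C ^ (n * (L * n))"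
    using assms(2,3) by (intro mult_mono power_increasing mult_le_mono) auto
  also have "\<dots> = (2 ^ (L * L) * C ^ L) ^ n\<^sup>2"
    by (simp add: power_mult_distrib power_mult[symmetric] power2_eq_square mult_ac)
  finally show ?thesis .
qed

lemma mset_concat_append:
  "mset (concat (map (\<lambda>x. F x @ G x) xs)) = mset (concat (map F xs) @ concat (map G xs))"
  by (induction xs) (auto simp: add_ac)

lemma mset_concat_swap:
  "mset (concat (map (\<lambda>x. map (\<lambda>y. F x y) ys) xs)) = mset (concat (map (\<lambda>y. map (\<lambda>x. F x y) xs) ys))"
proof (induction xs)
  case (Cons x xs)
  have "mset (concat (map (\<lambda>y. map (\<lambda>x. F x y) (x # xs)) ys)) =
      mset (concat (map (\<lambda>y. [F x y] @ map (\<lambda>x. F x y) xs) ys))" by simp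
  also have "\<dots> = mset (map (F x) ys) + mset (concat (map (\<lambda>y. map (\<lambda>x. F x y) xs) ys))"
    unfolding mset_concat_append by simp
  finally show ?case using Cons.IH by simp
qed (induction ys, auto)

text \<open>Writes g(x) h(\<phi> x) as the sum over l of h(\<zeta>_l) times the function equal to g
  over \<zeta>_l and 0 elsewhere. The transition matrix is the Vandermonde matrix of
  \<open>hl\<close>, once for each g, and the new functions give a block diagonal matrix with one
  block per fibre.\<close>

lemma vdm_kronecker:
  fixes \<phi> :: "'x \<Rightarrow> 'y"
  assumes dist: "distinct \<zeta>s" and len: "length \<zeta>s = length hl"
    and ws: "\<And>\<zeta>. \<zeta> \<in> set \<zeta>s \<Longrightarrow> length (ws \<zeta>) = length gl"
      "\<And>\<zeta> w. \<zeta> \<in> set \<zeta>s \<Longrightarrow> w \<in> set (ws \<zeta>) \<Longrightarrow> \<phi> w = \<zeta>"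
  shows "vdm (concat (map (\<lambda>g. map (\<lambda>h x. g x * h (\<phi> x)) hl) gl)) (concat (map ws \<zeta>s)) =
    vdm hl \<zeta>s ^ length gl * (\<Prod>\<zeta>\<leftarrow>\<zeta>s. vdm gl (ws \<zeta>))"
proof -
  define m where "m = length hl"
  define H where "H g = map (\<lambda>h x. g x * h (\<phi> x)) hl" for g :: "'x \<Rightarrow> complex"
  define e where "e g \<zeta> x = (if \<phi> x = \<zeta> then g x else 0)" for g :: "'x \<Rightarrow> complex" and \<zeta> x
  \<comment> \<open>Treats one g at a time; \<open>Y\<close> holds the functions that are already
    replaced.\<close>
  have step1: "vdm (Y @ concat (map H gl')) xs = vdm hl \<zeta>s ^ length gl' * vdm (Y @ concat (map (\<lambda>g. map (e g) \<zeta>s) gl')) xs"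
    if "length xs = length Y + length gl' * m" "\<phi> ` set xs \<subseteq> set \<zeta>s" for Y gl' xs
    using that
  proof (induction gl' arbitrary: Y)
    case Nil
    then show ?case by simp
  next
    case (Cons g gl')
    let ?R = "concat (map H gl')"
    have lR: "length ?R = length gl' * m" by (induction gl') (auto simp: H_def m_def)
    have "vdm (Y @ concat (map H (g # gl'))) xs = vdm ((Y @ ?R) @ H g) xs"
      by (rule vdm_perm_rows) (simp add: add_ac)
    also have "\<dots> = vdm (map (\<lambda>j l. (hl ! j) (\<zeta>s ! l)) [0..<m]) [0..<m] * vdm ((Y @ ?R) @ map (e g) \<zeta>s) xs"
    proof (rule vdm_transition[where Y = "\<lambda>_ _. 0"])
      fix j x assume j: "j < m" and x: "x \<in> set xs"
      obtain l where l: "l < m" "\<zeta>s ! l = \<phi> x" 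
      proof -
        have "\<phi> x \<in> set \<zeta>s" using Cons.prems(2) x by auto
        then show thesis using len that by (auto simp: in_set_conv_nth m_def)
      qed
      have "(\<Sum>k<m. (hl ! j) (\<zeta>s ! k) * (map (e g) \<zeta>s ! k) x) = (\<Sum>k<m. if k = l then (hl ! j) (\<phi> x) * g x else 0)"
      proof (rule sum.cong[OF refl])
        fix k assume "k \<in> {..<m}"
        then have "\<phi> x = \<zeta>s ! k \<longleftrightarrow> k = l"
          using l dist len by (auto simp: m_def nth_eq_iff_index_eq)
        then show "(hl ! j) (\<zeta>s ! k) * (map (e g) \<zeta>s ! k) x = (if k = l then (hl ! j) (\<phi> x) * g x else 0)"
          using \<open>k \<in> {..<m}\<close> len l by (auto simp: m_def e_def)
      qed
      then show "(H g ! j) x = (\<Sum>k<length (Y @ ?R). 0 * ((Y @ ?R) ! k) x) + (\<Sum>k<m. (hl ! j) (\<zeta>s ! k) * (map (e g) \<zeta>s ! k) x)"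
        using l(1) j by (simp add: H_def m_def)
    qed (use Cons.prems lR len in \<open>auto simp: H_def m_def\<close>)
    also have "vdm (map (\<lambda>j l. (hl ! j) (\<zeta>s ! l)) [0..<m]) [0..<m] = vdm hl \<zeta>s"
      using len by (intro vdm_cong) (auto simp: m_def)
    also have "vdm ((Y @ ?R) @ map (e g) \<zeta>s) xs = vdm ((Y @ map (e g) \<zeta>s) @ ?R) xs"
      by (rule vdm_perm_rows) (simp add: add_ac)
    also have "\<dots> = vdm hl \<zeta>s ^ length gl' * vdm ((Y @ map (e g) \<zeta>s) @ concat (map (\<lambda>g. map (e g) \<zeta>s) gl')) xs"
      using Cons.prems len by (intro Cons.IH) (auto simp: m_def)
    finally show ?case by simp
  qed
  have step2: "vdm (concat (map (\<lambda>\<zeta>. map (\<lambda>g. e g \<zeta>) gl) \<zeta>s')) (concat (map ws \<zeta>s')) = (\<Prod>\<zeta>\<leftarrow>\<zeta>s'. vdm gl (ws \<zeta>))"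
    if "distinct \<zeta>s'" "set \<zeta>s' \<subseteq> set \<zeta>s" for \<zeta>s'
    using that
  proof (induction \<zeta>s')
    case Nil
    then show ?case by (simp add: vdm_def)
  next
    case (Cons \<zeta> \<zeta>s')
    have l: "length (concat (map ws \<zeta>s')) = length (concat (map (\<lambda>\<zeta>. map (\<lambda>g. e g \<zeta>) gl) \<zeta>s'))"
      using Cons.prems(2) ws(1) by (induction \<zeta>s') auto
    have "vdm (map (\<lambda>g. e g \<zeta>) gl @ concat (map (\<lambda>\<zeta>. map (\<lambda>g. e g \<zeta>) gl) \<zeta>s')) (ws \<zeta> @ concat (map ws \<zeta>s')) =
      vdm (map (\<lambda>g. e g \<zeta>) gl) (ws \<zeta>) * vdm (concat (map (\<lambda>\<zeta>. map (\<lambda>g. e g \<zeta>) gl) \<zeta>s')) (concat (map ws \<zeta>s'))"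
    proof (rule vdm_block)
      fix h y assume "h \<in> set (map (\<lambda>g. e g \<zeta>) gl)" "y \<in> set (concat (map ws \<zeta>s'))"
      then obtain g \<zeta>' where "h = e g \<zeta>" "\<zeta>' \<in> set \<zeta>s'" "y \<in> set (ws \<zeta>')" by auto
      moreover have "\<phi> y = \<zeta>'" using ws(2) Cons.prems(2) calculation by auto
      ultimately show "h y = 0" using Cons.prems(1) by (auto simp: e_def)
    qed (use Cons.prems ws(1) l in auto)
    also have "vdm (map (\<lambda>g. e g \<zeta>) gl) (ws \<zeta>) = vdm gl (ws \<zeta>)"
      using ws Cons.prems(2) by (intro vdm_cong) (auto simp: e_def)
    finally show ?case using Cons by simp
  qed
  have lx: "length (concat (map ws \<zeta>s)) = length gl * m"
  proof -
    have "length (concat (map ws \<zeta>s')) = length gl * length \<zeta>s'" if "set \<zeta>s' \<subseteq> set \<zeta>s" for \<zeta>s'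
      using that ws(1) by (induction \<zeta>s') auto
    then show ?thesis using len by (simp add: m_def)
  qed
  have "vdm (concat (map H gl)) (concat (map ws \<zeta>s)) =
      vdm hl \<zeta>s ^ length gl * vdm (concat (map (\<lambda>g. map (e g) \<zeta>s) gl)) (concat (map ws \<zeta>s))"
    using step1[of "concat (map ws \<zeta>s)" "[]" gl] lx ws(2) by auto
  also have "vdm (concat (map (\<lambda>g. map (e g) \<zeta>s) gl)) (concat (map ws \<zeta>s)) =
      vdm (concat (map (\<lambda>\<zeta>. map (\<lambda>g. e g \<zeta>) gl) \<zeta>s)) (concat (map ws \<zeta>s))"
    by (rule vdm_perm_rows[OF mset_concat_swap])
  also have "\<dots> = (\<Prod>\<zeta>\<leftarrow>\<zeta>s. vdm gl (ws \<zeta>))" using step2 dist by simp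
  finally show ?thesis by (simp only: H_def)
qed

section \<open>Comparison of Vandermonde maxima\<close>

lemma two_monomial_count: "2 * monomial_count n = (n + 1) * (n + 2)"
  using length_all_exps[of "Suc n"] by (simp add: monomial_count_eq)

lemma monomial_count_le: "monomial_count n \<le> (n + 1)\<^sup>2"
proof -
  have "2 * monomial_count n \<le> 2 * (n + 1)\<^sup>2"
    unfolding two_monomial_count by (simp add: power2_eq_square algebra_simps)
  then show ?thesis by simp
qed

lemma polys_below_Suc_leads:
  assumes "F \<in> polys_below (Suc n)"
  shows "\<exists>p. leads n p F"
proof -
  obtain c where F: "F = (\<lambda>z. \<Sum>\<gamma> | total_deg \<gamma> < Suc n. c \<gamma> * monomial_at \<gamma> z)" by (rule polys_belowE[OF assms])
  define p where "p = (\<Sum>b\<le>n. monom (c (b, n - b)) b)"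
  have cp: "coeff p b = (if b \<le> n then c (b, n - b) else 0)" for b by (simp add: p_def coeff_sum)
  have "F z = hform n p z + (\<Sum>\<gamma> | total_deg \<gamma> < n. c \<gamma> * monomial_at \<gamma> z)" for z
  proof -
    have "{\<gamma>. total_deg \<gamma> < Suc n} = (\<lambda>b. (b, n - b)) ` {..n} \<union> {\<gamma>. total_deg \<gamma> < n}"
      by (auto simp: total_deg_def image_iff)
    moreover have "(\<lambda>b. (b, n - b)) ` {..n} \<inter> {\<gamma>. total_deg \<gamma> < n} = {}" by (auto simp: total_deg_def)
    ultimately have "F z = (\<Sum>\<gamma>\<in>(\<lambda>b. (b, n - b)) ` {..n}. c \<gamma> * monomial_at \<gamma> z) + (\<Sum>\<gamma> | total_deg \<gamma> < n. c \<gamma> * monomial_at \<gamma> z)"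
      unfolding F by (simp add: sum.union_disjoint finite_total_deg)
    also have "(\<Sum>\<gamma>\<in>(\<lambda>b. (b, n - b)) ` {..n}. c \<gamma> * monomial_at \<gamma> z) = hform n p z"
      by (subst sum.reindex) (auto simp: inj_on_def hform_def cp)
    finally show ?thesis .
  qed
  moreover have "(\<lambda>z. \<Sum>\<gamma> | total_deg \<gamma> < n. c \<gamma> * monomial_at \<gamma> z) \<in> polys_below n"
    by (intro polys_below_sum polys_below_monomial) simp
  moreover have "degree p \<le> n" by (rule degree_le) (simp add: cp)
  ultimately show ?thesis unfolding leads_def by (intro exI[of _ p] conjI bexI) auto
qed

lemma ex_leads:
  assumes "q \<noteq> (0 :: qpoly)"
  obtains n p where "leads n p (ev q)" "p \<noteq> 0"
proof -
  obtain N where "\<forall>z. ev q z = (\<Sum>\<alpha> | total_deg \<alpha> < N. qcoeff q \<alpha> * monomial_at \<alpha> z)"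
    using ev_expand by blast
  then have "ev q \<in> polys_below N" unfolding polys_below_def by blast
  \<comment> \<open>The least such m makes the part of degree m - 1 nonzero.\<close>
  then have "\<exists>m. ev q \<in> polys_below m \<and> (\<forall>k<m. ev q \<notin> polys_below k)"
    using exists_least_iff[of "\<lambda>m. ev q \<in> polys_below m"] by blast
  then obtain m where m: "ev q \<in> polys_below m" "\<And>k. k < m \<Longrightarrow> ev q \<notin> polys_below k" by blast
  have "m \<noteq> 0"
  proof
    assume "m = 0"
    then have "ev q z = 0" for z using m(1) unfolding polys_below_def by (simp del: split_paired_All)
    with ev_eq_0_imp assms show False by blast
  qed
  then obtain n where n: "m = Suc n" by (cases m) auto
  obtain p where p: "leads n p (ev q)" using polys_below_Suc_leads m(1) n by blast
  have "p \<noteq> 0"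
  proof
    assume "p = 0"
    then have "ev q \<in> polys_below n" using p by (auto simp: leads_def hform_def)
    with m(2) n show False by simp
  qed
  with p show thesis by (rule that)
qed

text \<open>The added monomials fill the exponents outside the window from \<open>degree p\<close>
  to \<open>degree p + m\<close>; on the window the multiples of \<open>p\<close> are triangular
  with its leading coefficient on the diagonal. The degree of \<open>p\<close> falls below n when
  the form is divisible by z2.\<close>

lemma cvd_shifted_extend:
  assumes "degree p \<le> n"  "p \<noteq> 0"
  shows "cvd (map (\<lambda>b. p * monom 1 b) [0..<Suc m] @
      map (monom 1) (filter (\<lambda>b. b < degree p \<or> degree p + m < b) [0..<Suc (n + m)])) = cmod (lead_coeff p) ^ Suc m"
proof -
  define s where "s = degree p"
  define bs where "bs = filter (\<lambda>b. b < s \<or> s + m < b) [0..<Suc (n + m)]"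
  define cs where "cs = [s..<s + Suc m]"
  define R where "R = map (\<lambda>b. p * monom 1 b) [0..<Suc m]"
  have ms: "mset (bs @ cs) = mset [0..<Suc (n + m)]"
  proof -
    have "set (bs @ cs) = set [0..<Suc (n + m)]" using assms(1) by (auto simp: bs_def cs_def s_def simp del: upt_Suc)
    moreover have "distinct (bs @ cs)" by (auto simp: bs_def cs_def simp del: upt_Suc)
    ultimately show ?thesis by (metis distinct_upt set_eq_iff_mset_eq_distinct)
  qed
  have len: "length (R @ map (monom 1) bs) = Suc (n + m)"
    using arg_cong[OF ms, of size] by (simp add: R_def cs_def del: upt_Suc)
  have "cvd (R @ map (monom 1) bs) = cvd (map (monom 1) bs @ R)" by (rule cvd_perm) simp
  also have "\<dots> = vdm (map coeff (map (monom 1) bs) @ map coeff R) [0..<Suc (n + m)]"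
    using len by (simp add: cvd_def add.commute del: upt_Suc)
  also have "\<dots> = vdm (map coeff (map (monom 1) bs) @ map coeff R) (bs @ cs)"
    using len by (intro vdm_perm_cols ms[symmetric]) (simp add: add.commute del: upt_Suc)
  also have "\<dots> = vdm (map coeff (map (monom 1) bs)) bs * vdm (map coeff R) cs"
    by (rule vdm_block) (auto simp: bs_def cs_def R_def simp del: upt_Suc)
  also have "vdm (map coeff (map (monom 1) bs)) bs = 1"
    by (subst vdm_lower_triangular) (auto simp: bs_def nth_eq_iff_index_eq simp del: upt_Suc)
  also have "vdm (map coeff R) cs = cmod (lead_coeff p) ^ Suc m"
    by (subst vdm_lower_triangular)
      (auto simp: R_def cs_def s_def coeff_monom_mult mult.commute[of p] coeff_eq_0 simp del: upt_Suc)
  finally show ?thesis by (simp add: R_def bs_def s_def)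
qed

lemma concat_shifted_exps:
  "concat (map (\<lambda>m. if m < a then [] else map F (exps (m - a))) [0..<a + k]) = map F (all_exps k)"
  by (induction k) (auto simp: all_exps_def)

text \<open>With a the degree of q, the products of q with the monomials of degree at most k,
  completed by O(k) monomials, form a graded basis in degrees up to k + a; its determinant is a
  power of one leading coefficient. Laplace expansion separates the completing rows. For q the
  discriminant this turns a bound for weighted determinants into one for \<open>Van\<close>.\<close>

lemma Van_le_multiplied:
  assumes e: "graded_enumeration e" and q: "q \<noteq> (0 :: qpoly)"
    and K: "\<And>z. z \<in> K \<Longrightarrow> cmod (fst z) \<le> c \<and> cmod (snd z) \<le> c"
  obtains a C where "1 \<le> C"
    "\<And>k B. 0 \<le> B \<Longrightarrow> (\<And>\<zeta>s. set \<zeta>s \<subseteq> K \<Longrightarrow> length \<zeta>s = monomial_count k \<Longrightarrow>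
        (\<Prod>\<zeta>\<leftarrow>\<zeta>s. cmod (ev q \<zeta>)) * vdm (mons k) \<zeta>s \<le> B) \<Longrightarrow>
      Van e (monomial_count (k + a)) K \<le> C ^ (k + 1)\<^sup>2 * B"
proof -
  obtain a p where lp: "leads a p (ev q)" "p \<noteq> 0" by (rule ex_leads[OF q])
  have deg: "degree p \<le> a" using lp by (simp add: leads_def)
  define c0 where "c0 = max 1 c"
  define l where "l = cmod (lead_coeff p)"
  have l: "0 < l" using lp(2) by (simp add: l_def)
  \<comment> \<open>\<open>L * (k + 1)\<close> bounds the number a k + (a^2 + 3 a) / 2 of completing
    monomials.\<close>
  define L where "L = 3 * (a + 1) * (a + 1)"
  \<comment> \<open>The factors account for the change of basis, for the number of column sets in
    the Laplace expansion, and for the minors of the completing rows.\<close>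
  define C where "C = max 1 (1 / l) * 2 ^ ((a + 1) * (a + 1)) * (2 ^ (L * L) * (c0 ^ (a + 1)) ^ L)"
  have "1 \<le> C"
    unfolding C_def by (intro mult_ge1_I) (auto simp: c0_def intro!: one_le_power mult_ge1_I)
  moreover have "Van e (monomial_count (k + a)) K \<le> C ^ (k + 1)\<^sup>2 * B"
    if B: "0 \<le> B" "\<And>\<zeta>s. set \<zeta>s \<subseteq> K \<Longrightarrow> length \<zeta>s = monomial_count k \<Longrightarrow>
        (\<Prod>\<zeta>\<leftarrow>\<zeta>s. cmod (ev q \<zeta>)) * vdm (mons k) \<zeta>s \<le> B" for k B
  proof (rule Van_least[OF e])
    show "0 \<le> C ^ (k + 1)\<^sup>2 * B" using B(1) \<open>1 \<le> C\<close> by simp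
    fix xs assume xs: "set xs \<subseteq> K" "length xs = monomial_count (k + a)"
    define F where "F = (\<lambda>\<gamma> z. ev q z * monomial_at \<gamma> z)"
    define fl where "fl m = filter (\<lambda>b. b < degree p \<or> degree p + (m - a) < b) [0..<Suc m]" for m
    \<comment> \<open>In degree m, \<open>r1\<close> holds the multiples of q, of which there are
      none below a, and \<open>r2\<close> the completing monomials; \<open>ps\<close> lists their
      leading parts in the same order.\<close>
    define r1 where "r1 m = (if m < a then [] else map F (exps (m - a)))" for m
    define r2 where "r2 m = map (\<lambda>b. monomial_at (b, m - b)) (if m < a then [0..<Suc m] else fl m)" for m
    define ps where "ps m = (if m < a then map (monom 1) [0..<Suc m]
        else map (\<lambda>b. p * monom 1 b) [0..<Suc (m - a)] @ map (monom 1) (fl m))" for m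
    have cv: "cvd (ps m) = (if m < a then 1 else l ^ Suc (m - a))" for m
    proof (cases "m < a")
      case True
      have "vdm (map coeff (map (monom 1) [0..<Suc m])) [0..<Suc m] = 1"
        by (subst vdm_lower_triangular) (auto simp del: upt_Suc)
      then show ?thesis using True by (simp add: ps_def cvd_def del: upt_Suc)
    next
      case False
      then show ?thesis using cvd_shifted_extend[OF deg lp(2), of "m - a"] by (simp add: ps_def fl_def l_def del: upt_Suc power_Suc)
    qed
    have lfl: "length (fl m) + Suc (m - a) = Suc m" if "\<not> m < a" for m
    proof -
      have "card {b \<in> {..m}. \<not> (b < degree p \<or> degree p + (m - a) < b)} = card {degree p..degree p + (m - a)}"
        using deg that by (intro arg_cong[where f = card]) auto
      moreover have "length (filter (\<lambda>b. \<not> (b < degree p \<or> degree p + (m - a) < b)) [0..<Suc m]) =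
          card {b \<in> {..m}. \<not> (b < degree p \<or> degree p + (m - a) < b)}"
        by (subst distinct_length_filter) (auto intro!: arg_cong[where f = card] simp del: upt_Suc)
      ultimately show ?thesis
        using sum_length_filter_compl[of "\<lambda>b. b < degree p \<or> degree p + (m - a) < b" "[0..<Suc m]"]
        by (simp add: fl_def del: upt_Suc)
    qed
    have lps: "length (ps m) = Suc m" for m using lfl[of m] by (auto simp: ps_def simp del: upt_Suc)
    have lrw: "length (r1 m @ r2 m) = Suc m" for m
      using lfl[of m] by (auto simp: r1_def r2_def exps_def simp del: upt_Suc)
    have mono_leads: "leads m (monom 1 b) (monomial_at (b, m - b))" if "b \<le> m" for b m
      using leads_monomial[of "(b, m - b)"] that by (simp add: total_deg_def)
    have lead: "leads m (ps m ! i) ((r1 m @ r2 m) ! i)" if i: "i \<le> m" for m i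
    proof (cases "m < a")
      case True
      then show ?thesis using mono_leads[OF i] i by (simp add: ps_def r1_def r2_def del: upt_Suc)
    next
      case False
      show ?thesis
      proof (cases "i < Suc (m - a)")
        case True
        have "leads (a + (m - a)) (p * monom 1 i) (\<lambda>z. ev q z * monomial_at (i, m - a - i) z)"
          by (rule leads_mult[OF lp(1) mono_leads]) (use True in simp)
        then show ?thesis using False True by (simp add: ps_def r1_def exps_def F_def nth_append del: upt_Suc)
      next
        case False': False
        define j where "j = i - Suc (m - a)"
        have j: "j < length (fl m)" using lfl[OF False] False' i by (simp add: j_def)
        then have "fl m ! j \<le> m" using nth_mem[OF j] by (auto simp: fl_def simp del: upt_Suc)
        from mono_leads[OF this] show ?thesis
          using False False' j by (simp add: ps_def r1_def r2_def exps_def nth_append j_def[symmetric] del: upt_Suc)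
      qed
    qed
    define n where "n = a + Suc k"
    define rest where "rest = concat (map r2 [0..<n])"
    have c1: "concat (map r1 [0..<n]) = map F (all_exps (Suc k))"
      unfolding r1_def n_def by (rule concat_shifted_exps)
    have mc: "monomial_count (k + a) = length (all_exps n)" by (simp add: monomial_count_eq n_def add.commute)
    have "vdm (concat (map (\<lambda>m. r1 m @ r2 m) [0..<n]) @ []) xs = (\<Prod>m<n. cvd (ps m)) * vdm (map monomial_at (all_exps n) @ []) xs"
      using xs(2) mc by (intro vdm_graded lrw lps lead) auto
    also have "(\<Prod>m<n. cvd (ps m)) = l ^ monomial_count k"
    proof -
      have "(\<Prod>m<a + j. cvd (ps m)) = l ^ length (all_exps j)" for j
      proof (induction j)
        case (Suc j)
        have "length (all_exps (Suc j)) = length (all_exps j) + Suc j" by (simp add: all_exps_def exps_def)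
        then show ?case using Suc.IH by (simp add: cv power_add)
      qed (simp add: cv all_exps_def)
      then show ?thesis by (simp only: n_def monomial_count_eq)
    qed
    also have "map monomial_at (all_exps n) = mons (k + a)" by (simp add: mons_def n_def add.commute)
    finally have eq: "vdm (concat (map (\<lambda>m. r1 m @ r2 m) [0..<n])) xs = l ^ monomial_count k * vdm (mons (k + a)) xs" by simp
    have "vdm (concat (map (\<lambda>m. r1 m @ r2 m) [0..<n])) xs = vdm (map F (all_exps (Suc k)) @ rest) xs"
      unfolding c1[symmetric] rest_def by (rule vdm_perm_rows[OF mset_concat_append])
    also have "\<dots> \<le> 2 ^ length xs * (B * (2 ^ (L * L) * (c0 ^ (a + 1)) ^ L) ^ (k + 1)\<^sup>2)"
    proof (rule vdm_append_le)
      have "length (map F (all_exps (Suc k)) @ rest) = length (all_exps n)"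
      proof -
        have "length (concat (map (\<lambda>m. r1 m @ r2 m) [0..<j])) = length (all_exps j)" for j
        proof (induction j)
          case (Suc j)
          have "length (all_exps (Suc j)) = length (all_exps j) + Suc j" by (simp add: all_exps_def exps_def)
          then show ?case using Suc.IH lrw[of j] by simp
        qed (simp add: all_exps_def)
        then show ?thesis
          unfolding c1[symmetric] rest_def using arg_cong[OF mset_concat_append[of r1 r2 "[0..<n]"], of size] by simp
      qed
      then show lx: "length xs = length (map F (all_exps (Suc k))) + length rest" using xs(2) mc by simp
      fix ys assume ys: "set ys \<subseteq> set xs"
      show "vdm (map F (all_exps (Suc k))) ys \<le> B" if "length ys = length (map F (all_exps (Suc k)))"
      proof -
        have "vdm (map F (all_exps (Suc k))) ys = vdm (map (\<lambda>f x. ev q x * f x) (mons k)) ys"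
          by (simp add: F_def mons_def o_def)
        also have "\<dots> = (\<Prod>\<zeta>\<leftarrow>ys. cmod (ev q \<zeta>)) * vdm (mons k) ys"
          using that by (intro vdm_scale) (simp add: mons_def)
        also have "\<dots> \<le> B" using ys xs that by (intro B(2)) (auto simp: monomial_count_eq)
        finally show ?thesis .
      qed
      show "vdm rest ys \<le> (2 ^ (L * L) * (c0 ^ (a + 1)) ^ L) ^ (k + 1)\<^sup>2" if "length ys = length rest"
      proof (rule vdm_crude_bound[OF that])
        have "2 * (monomial_count k + length rest) = (k + a + 1) * (k + a + 2)"
          using lx xs(2) two_monomial_count[of "k + a"] by (simp add: monomial_count_eq)
        then have "(k + 1) * (k + 2) + 2 * length rest = (k + a + 1) * (k + a + 2)"
          using two_monomial_count[of k] by simp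
        then have "2 * length rest = 2 * a * k + 3 * a + a * a" by (simp add: algebra_simps)
        also have "\<dots> \<le> 2 * (L * (k + 1))" by (simp add: L_def algebra_simps)
        finally show "length rest \<le> L * (k + 1)" by simp
        show "1 \<le> c0 ^ (a + 1)" by (rule one_le_power) (simp add: c0_def)
        fix h x assume "h \<in> set rest" "x \<in> set ys"
        then obtain m b where h: "h = monomial_at (b, m - b)" "m < n" "b \<le> m"
          by (auto simp: rest_def r2_def fl_def simp del: upt_Suc split: if_splits)
        have "total_deg (b, m - b) \<le> k + a" using h by (simp add: total_deg_def n_def)
        then have "cmod (h x) \<le> c0 ^ (k + a)"
        proof -
          have "x \<in> K" using xs(1) ys \<open>x \<in> set ys\<close> by blast
          from K[OF this] show ?thesis
            using \<open>total_deg (b, m - b) \<le> k + a\<close> unfolding h(1) by (intro cmod_monomial_at_le) (auto simp: c0_def)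
        qed
        also have "\<dots> \<le> c0 ^ ((a + 1) * (k + 1))" by (intro power_increasing) (auto simp: c0_def)
        finally show "cmod (h x) \<le> (c0 ^ (a + 1)) ^ (k + 1)" by (simp only: power_mult)
      qed
    qed (use B(1) in \<open>auto simp: c0_def\<close>)
    also have "\<dots> \<le> (2 ^ ((a + 1) * (a + 1))) ^ (k + 1)\<^sup>2 * (B * (2 ^ (L * L) * (c0 ^ (a + 1)) ^ L) ^ (k + 1)\<^sup>2)"
    proof (rule mult_right_mono)
      have "(k + a + 1) \<le> (a + 1) * (k + 1)" by simp
      then have "(k + a + 1)\<^sup>2 \<le> ((a + 1) * (k + 1))\<^sup>2" by (rule power_mono) simp
      then have "length xs \<le> (a + 1) * (a + 1) * (k + 1)\<^sup>2"
        using monomial_count_le[of "k + a"] xs(2) unfolding power_mult_distrib power2_eq_square[of "a + 1"] by linarith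
      then show "(2 :: real) ^ length xs \<le> (2 ^ ((a + 1) * (a + 1))) ^ (k + 1)\<^sup>2"
        unfolding power_mult[symmetric] by (rule power_increasing) simp
    qed (use B(1) in \<open>auto simp: c0_def\<close>)
    finally have le: "l ^ monomial_count k * vdm (mons (k + a)) xs \<le>
      (2 ^ ((a + 1) * (a + 1))) ^ (k + 1)\<^sup>2 * (B * (2 ^ (L * L) * (c0 ^ (a + 1)) ^ L) ^ (k + 1)\<^sup>2)" unfolding eq .
    have "vdm (mons (k + a)) xs = (1 / l) ^ monomial_count k * (l ^ monomial_count k * vdm (mons (k + a)) xs)"
      using l by (simp add: power_divide)
    also have "\<dots> \<le> (max 1 (1 / l)) ^ (k + 1)\<^sup>2 * ((2 ^ ((a + 1) * (a + 1))) ^ (k + 1)\<^sup>2 * (B * (2 ^ (L * L) * (c0 ^ (a + 1)) ^ L) ^ (k + 1)\<^sup>2))"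
    proof (rule mult_mono)
      have "(1 / l) ^ monomial_count k \<le> (max 1 (1 / l)) ^ monomial_count k" using l by (intro power_mono) auto
      also have "\<dots> \<le> (max 1 (1 / l)) ^ (k + 1)\<^sup>2" by (intro power_increasing monomial_count_le) auto
      finally show "(1 / l) ^ monomial_count k \<le> (max 1 (1 / l)) ^ (k + 1)\<^sup>2" .
    qed (use le l in auto)
    also have "\<dots> = C ^ (k + 1)\<^sup>2 * B" by (simp only: C_def power_mult_distrib mult_ac)
    finally show "vdm (mons (k + a)) xs \<le> C ^ (k + 1)\<^sup>2 * B" .
  qed
  ultimately show thesis by (rule that)
qed

lemma prod_list_mono_real:
  fixes a b :: "'x \<Rightarrow> real"
  assumes "\<And>x. x \<in> set xs \<Longrightarrow> 0 \<le> a x \<and> a x \<le> b x"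
  shows "(\<Prod>x\<leftarrow>xs. a x) \<le> (\<Prod>x\<leftarrow>xs. b x) \<and> 0 \<le> (\<Prod>x\<leftarrow>xs. a x)"
  using assms
proof (induction xs)
  case (Cons x xs)
  have "(\<Prod>x\<leftarrow>xs. a x) \<le> (\<Prod>x\<leftarrow>xs. b x)" "0 \<le> (\<Prod>x\<leftarrow>xs. a x)" using Cons by auto
  moreover have "0 \<le> a x" "a x \<le> b x" using Cons.prems by auto
  ultimately show ?case by (auto intro!: mult_mono)
qed simp

lemma prod_list_power: "(\<Prod>x\<leftarrow>xs. a x) ^ n = (\<Prod>x\<leftarrow>xs. a x ^ n)" for a :: "'x \<Rightarrow> real"
  by (induction xs) (auto simp: power_mult_distrib)

lemma prod_list_const_mult: "(\<Prod>x\<leftarrow>xs. c * a x) = c ^ length xs * (\<Prod>x\<leftarrow>xs. a x)" for a :: "'x \<Rightarrow> real"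
  by (induction xs) (auto simp: mult_ac)

section \<open>Vandermonde maxima of a set and of its preimage\<close>

context graded_pair
begin

text \<open>The product index set, on which determinants split over the generators, as opposed to
  \<open>all_is\<close>, which is cut by total degree. It contains \<open>all_is (d * k)\<close> and
  lies in \<open>all_is n\<close> once d (k + 2) is at most n, with O(n) indices of difference when
  n is close to these bounds.\<close>

definition block :: "nat \<Rightarrow> ((nat \<times> nat) \<times> (nat \<times> nat)) list" where
  "block k = concat (map (\<lambda>\<beta>. map (Pair \<beta>) (all_exps (Suc k))) gs)"

lemma set_block: "set (block k) = {(\<beta>, \<alpha>). \<beta> \<in> \<Gamma> \<and> total_deg \<alpha> \<le> k}"
  by (auto simp: block_def set_all_exps gs(2))

lemma length_block: "length (block k) = D * monomial_count k"
proof -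
  have "length (concat (map (\<lambda>\<beta>. map (Pair \<beta>) (all_exps (Suc k))) l)) = length l * monomial_count k" for l :: "(nat \<times> nat) list"
    by (induction l) (auto simp: monomial_count_eq)
  then show ?thesis by (simp add: block_def length_gs)
qed

lemma distinct_block: "distinct (block k)"
proof -
  have "distinct (concat (map (\<lambda>\<beta>. map (Pair \<beta>) (all_exps (Suc k))) l))" if "distinct l" for l :: "(nat \<times> nat) list"
    using that by (induction l) (auto simp: distinct_map inj_on_def distinct_all_exps)
  then show ?thesis by (simp add: block_def gs(1))
qed

lemma cmod_nw_le:
  assumes "cmod (fst z) \<le> C" "cmod (snd z) \<le> C" "cmod (fst (f z)) \<le> C" "cmod (snd (f z)) \<le> C" "1 \<le> C"
    "total_deg (fst x) + total_deg (snd x) \<le> n"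
  shows "cmod (nw x z) \<le> C ^ n"
proof -
  have "cmod (nw x z) \<le> C ^ total_deg (fst x) * C ^ total_deg (snd x)"
    unfolding nw_def norm_mult using assms(1-5) by (intro mult_mono cmod_monomial_at_le) auto
  also have "\<dots> \<le> C ^ n" unfolding power_add[symmetric] using assms(5,6) by (intro power_increasing) auto
  finally show ?thesis .
qed

lemma map_nw_block: "map nw (block k) = concat (map (\<lambda>\<beta>. map (\<lambda>h x. \<beta> x * h (f x)) (mons k)) (map monomial_at gs))"
  by (simp add: block_def map_concat o_def mons_def nw_def[abs_def])

lemma mset_append_filter:
  assumes "distinct xs" "distinct ys" "set xs \<subseteq> set ys"
  shows "mset ys = mset (xs @ filter (\<lambda>y. y \<notin> set xs) ys)"
proof -
  have "distinct (xs @ filter (\<lambda>y. y \<notin> set xs) ys)" "set (xs @ filter (\<lambda>y. y \<notin> set xs) ys) = set ys"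
    using assms by auto
  then show ?thesis using assms(2) by (metis set_eq_iff_mset_eq_distinct)
qed

text \<open>In the new basis the rows of \<open>block k\<close> form one group for each generator,
  and the O(n) remaining rows are estimated crudely. In a group the generator is a column factor,
  which leaves a Vandermonde determinant of the monomials of degree at most k at the image points,
  all of them in \<open>K\<close>.\<close>

lemma Van_preimage_le:
  assumes e: "graded_enumeration e"
    and K: "\<And>z. z \<in> K \<Longrightarrow> cmod (fst z) \<le> c \<and> cmod (snd z) \<le> c"
  obtains C where "1 \<le> C"
    "\<And>n. 2 * d \<le> n \<Longrightarrow> Delta n * Van e (monomial_count n) (f -` K) \<le>
       C ^ (n + 1)\<^sup>2 * Van e (monomial_count (n div d - 2)) K ^ D"
proof -
  obtain c1 where c1: "1 \<le> c1" "\<And>z. f z \<in> K \<Longrightarrow> cmod (fst z) \<le> c1 \<and> cmod (snd z) \<le> c1"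
    by (rule preimage_bounded[of K, OF K]) auto
  define c0 where "c0 = max c1 c"
  have c0: "1 \<le> c0" using c1(1) by (simp add: c0_def)
  have c0E: "cmod (fst z) \<le> c0" "cmod (snd z) \<le> c0" "cmod (fst (f z)) \<le> c0" "cmod (snd (f z)) \<le> c0" if "f z \<in> K" for z
    using c1(2)[OF that] K[OF that] by (auto simp: c0_def)
  define L where "L = 3 * d + 3"
  define C where "C = (2 * c0 ^ (2 * d)) ^ D * (2 ^ (L * L) * c0 ^ L)"
  have C1: "1 \<le> C" unfolding C_def using c0 by (intro mult_ge1_I one_le_power) auto
  moreover have "Delta n * Van e (monomial_count n) (f -` K) \<le>
       C ^ (n + 1)\<^sup>2 * Van e (monomial_count (n div d - 2)) K ^ D" if n: "2 * d \<le> n" for n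
  proof -
    \<comment> \<open>Subtracting 2 leaves room for the generators, whose degree is at most 2 d, so
      that \<open>block k\<close> stays within degree n.\<close>
    define k where "k = n div d - 2"
    have "2 \<le> n div d" using n d by (metis div_le_mono nonzero_mult_div_cancel_right not_one_le_zero)
    then have k2: "n div d = k + 2" by (simp add: k_def)
    have dk: "d * (k + 2) \<le> n" "n < d * (k + 2) + d"
      using k2 d mult_div_mod_eq[of d n] mod_less_divisor[of d n] by (metis le_add1, metis nat_add_left_cancel_less not_one_le_zero neq0_conv)
    define V where "V = Van e (monomial_count k) K"
    have V0: "0 \<le> V" unfolding V_def by (rule Van_nonneg(1)[OF e K])
    have "Van e (monomial_count n) (f -` K) \<le> C ^ (n + 1)\<^sup>2 * V ^ D / Delta n"
    proof (rule Van_least[OF e])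
      show "0 \<le> C ^ (n + 1)\<^sup>2 * V ^ D / Delta n" using C1 V0 Delta_pos[of n] by simp
      fix xs assume xs: "set xs \<subseteq> f -` K" "length xs = monomial_count n"
      define rest where "rest = filter (\<lambda>y. y \<notin> set (block k)) (all_is n)"
      have sub: "set (block k) \<subseteq> set (all_is n)"
      proof -
        have "total_deg \<beta> + d * total_deg \<alpha> \<le> n" if "\<beta> \<in> \<Gamma>" "total_deg \<alpha> \<le> k" for \<beta> \<alpha>
        proof -
          have "total_deg \<beta> + d * total_deg \<alpha> \<le> 2 * d + d * k" using degG[OF that(1)] that(2) by (intro add_mono) auto
          then show ?thesis using dk(1) by (simp add: algebra_simps)
        qed
        then show ?thesis by (auto simp: set_block set_all_is)
      qed
      have ms: "mset (all_is n) = mset (block k @ rest)"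
        unfolding rest_def by (rule mset_append_filter[OF distinct_block distinct_all_is sub])
      have lr: "monomial_count n = D * monomial_count k + length rest"
        using arg_cong[OF ms, of size] by (simp add: length_all_is length_block)
      have lrL: "length rest \<le> L * (n + 1)"
      proof -
        \<comment> \<open>In terms of a, \<open>block k\<close> has (a - d) a / 2 rows, and a > n -
          d. Subtracted from (n + 1) (n + 2) / 2, this leaves a number linear in n.\<close>
        define a where "a = d * (k + 2)"
        have "d \<le> a" by (simp add: a_def)
        have "d * d * ((k + 1) * (k + 2)) + 2 * length rest = (n + 1) * (n + 2)"
        proof -
          have "d * d * ((k + 1) * (k + 2)) = 2 * (d * d * monomial_count k)"
            unfolding two_monomial_count[symmetric] by simp
          moreover have "2 * monomial_count n = 2 * (d * d * monomial_count k) + 2 * length rest"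
            using lr by (simp add: D_def power2_eq_square)
          ultimately show ?thesis using two_monomial_count[of n] by linarith
        qed
        moreover have "d * d * ((k + 1) * (k + 2)) = (a - d) * a" by (simp add: a_def algebra_simps)
        moreover have "n < a + d" using dk(2) by (simp add: a_def)
        then have "int n - 2 * int d \<le> int a - int d" "int n - int d \<le> int a" "int d \<le> int a" using \<open>d \<le> a\<close> by linarith+
        then have "(int n - 2 * int d) * (int n - int d) \<le> (int a - int d) * int a"
          using n by (intro mult_mono) auto
        then have "int n * int n + 2 * (int d * int d) \<le> int ((a - d) * a) + 3 * (int d * int n)"
          using \<open>d \<le> a\<close> by (simp add: of_nat_diff algebra_simps)
        ultimately have "int n * int n + 2 * (int d * int d) + 2 * int (length rest) \<le> int ((n + 1) * (n + 2)) + 3 * (int d * int n)"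
          by linarith
        then have "2 * int (length rest) + 2 * (int d * int d) \<le> 3 * int n + 2 + 3 * (int d * int n)" by (simp add: algebra_simps)
        moreover have "int (L * (n + 1)) = 3 * (int d * int n) + 3 * int n + 3 * int d + 3" by (simp add: L_def algebra_simps)
        moreover have "0 \<le> int d * int d" "0 \<le> int d" by auto
        ultimately have "2 * int (length rest) \<le> int (L * (n + 1))" by linarith
        then show ?thesis by linarith
      qed
      have "Delta n * vdm (mons n) xs = vdm (map nw (all_is n)) xs"
        using vdm_all_is[of xs n "[]"] xs(2) by simp
      also have "\<dots> = vdm (map nw (block k) @ map nw rest) xs"
        unfolding map_append[symmetric] by (rule vdm_perm_rows) (simp only: mset_map ms)
      also have "map nw (block k) = concat (map (\<lambda>\<beta>. map (\<lambda>h x. monomial_at \<beta> x * h (f x)) (mons k)) gs)"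
        by (simp add: map_nw_block o_def)
      also have "vdm (concat (map (\<lambda>\<beta>. map (\<lambda>h x. monomial_at \<beta> x * h (f x)) (mons k)) gs) @ map nw rest) xs \<le>
          (2 ^ (n + 1)\<^sup>2 * ((c0 ^ (2 * d)) ^ (n + 1)\<^sup>2 * V)) ^ length (map (\<lambda>\<beta>. map (\<lambda>h x. monomial_at \<beta> x * h (f x)) (mons k)) gs)
          * (2 ^ (L * L) * c0 ^ L) ^ (n + 1)\<^sup>2"
      proof (rule vdm_concat_le)
        have "length (concat (map (\<lambda>\<beta>. map (\<lambda>h x. monomial_at \<beta> x * h (f x)) (mons k)) gs)) = length (map nw (block k))"
          by (simp add: map_nw_block o_def)
        then show "length xs = length (concat (map (\<lambda>\<beta>. map (\<lambda>h x. monomial_at \<beta> x * h (f x)) (mons k)) gs)) + length (map nw rest)"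
          using xs(2) lr by (simp add: length_block)
        show "length xs \<le> (n + 1)\<^sup>2" using xs(2) monomial_count_le by simp
        show "0 \<le> (c0 ^ (2 * d)) ^ (n + 1)\<^sup>2 * V" using c0 V0 by simp
        show "0 \<le> (2 ^ (L * L) * c0 ^ L) ^ (n + 1)\<^sup>2" using c0 by simp
      next
        fix fs ys assume fs: "fs \<in> set (map (\<lambda>\<beta>. map (\<lambda>h x. monomial_at \<beta> x * h (f x)) (mons k)) gs)"
          and ys: "set ys \<subseteq> set xs" "length ys = length fs"
        then obtain \<beta> where \<beta>: "\<beta> \<in> \<Gamma>" "fs = map (\<lambda>h x. monomial_at \<beta> x * h x) (map (\<lambda>h x. h (f x)) (mons k))"
          by (auto simp: gs(2) o_def)
        have lys: "length ys = monomial_count k" using ys(2) \<beta>(2) by (simp add: length_mons)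
        \<comment> \<open>The generator is pulled out of the columns; it is at most
          \<open>c0 ^ (2 * d)\<close> on the preimage.\<close>
        have "vdm fs ys = (\<Prod>x\<leftarrow>ys. cmod (monomial_at \<beta> x)) * vdm (map (\<lambda>h x. h (f x)) (mons k)) ys"
          unfolding \<beta>(2) using ys(2) \<beta>(2) by (intro vdm_scale) simp
        also have "vdm (map (\<lambda>h x. h (f x)) (mons k)) ys = vdm (mons k) (map f ys)"
          using lys by (intro vdm_cong) (auto simp: length_mons)
        also have "(\<Prod>x\<leftarrow>ys. cmod (monomial_at \<beta> x)) * vdm (mons k) (map f ys) \<le> (c0 ^ (2 * d)) ^ (n + 1)\<^sup>2 * V"
        proof (rule mult_mono)
          have "(\<Prod>x\<leftarrow>ys. cmod (monomial_at \<beta> x)) \<le> (\<Prod>x\<leftarrow>ys. c0 ^ (2 * d))"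
          proof (rule prod_list_mono_real[THEN conjunct1])
            fix x assume "x \<in> set ys"
            then have "f x \<in> K" using ys(1) xs(1) by auto
            then show "0 \<le> cmod (monomial_at \<beta> x) \<and> cmod (monomial_at \<beta> x) \<le> c0 ^ (2 * d)"
              using c0E[of x] c0 degG[OF \<beta>(1)] by (auto intro!: cmod_monomial_at_le)
          qed
          also have "\<dots> = (c0 ^ (2 * d)) ^ monomial_count k" using lys by (simp add: map_replicate_const)
          also have "\<dots> \<le> (c0 ^ (2 * d)) ^ (n + 1)\<^sup>2"
          proof (rule power_increasing)
            have "monomial_count k \<le> D * monomial_count k" using D_pos by simp
            also have "\<dots> \<le> (n + 1)\<^sup>2" using lr monomial_count_le[of n] by linarith
            finally show "monomial_count k \<le> (n + 1)\<^sup>2" .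
          qed (use c0 in simp)
          finally show "(\<Prod>x\<leftarrow>ys. cmod (monomial_at \<beta> x)) \<le> (c0 ^ (2 * d)) ^ (n + 1)\<^sup>2" .
          show "vdm (mons k) (map f ys) \<le> V"
            unfolding V_def using ys(1) xs(1) lys by (intro Van_nonneg(2)[OF e K]) auto
        qed (use c0 in auto)
        finally show "vdm fs ys \<le> (c0 ^ (2 * d)) ^ (n + 1)\<^sup>2 * V" .
      next
        fix ys assume ys: "set ys \<subseteq> set xs" "length ys = length (map nw rest)"
        show "vdm (map nw rest) ys \<le> (2 ^ (L * L) * c0 ^ L) ^ (n + 1)\<^sup>2"
        proof (rule vdm_crude_bound[OF ys(2)])
          show "length (map nw rest) \<le> L * (n + 1)" using lrL by simp
          fix h x assume "h \<in> set (map nw rest)" "x \<in> set ys"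
          then obtain y where y: "h = nw y" "y \<in> set (all_is n)" by (auto simp: rest_def)
          have "total_deg (snd y) \<le> d * total_deg (snd y)" using d by simp
          then have "total_deg (fst y) + total_deg (snd y) \<le> n + 1"
          proof -
            have "total_deg (fst y) + d * total_deg (snd y) \<le> n" using y(2) by (auto simp: set_all_is)
            then show ?thesis using \<open>total_deg (snd y) \<le> d * total_deg (snd y)\<close> by linarith
          qed
          moreover have "f x \<in> K" using \<open>x \<in> set ys\<close> ys(1) xs(1) by auto
          ultimately show "cmod (h x) \<le> c0 ^ (n + 1)"
            unfolding y(1) using c0E[of x] c0 by (intro cmod_nw_le) auto
        qed (rule c0)
      qed
      also have "\<dots> = C ^ (n + 1)\<^sup>2 * V ^ D"
        by (simp add: length_gs C_def power_mult_distrib power_mult[symmetric] mult_ac)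
      finally show "vdm (mons n) xs \<le> C ^ (n + 1)\<^sup>2 * V ^ D / Delta n"
        using Delta_pos[of n] by (simp add: pos_le_divide_eq mult.commute)
    qed
    then show ?thesis using Delta_pos[of n] by (simp add: pos_le_divide_eq mult.commute V_def k_def)
  qed
  ultimately show thesis by (rule that)
qed

text \<open>The determinant of \<open>block k\<close> at fibre points over all of
  \<open>\<zeta>s\<close> is estimated twice: from below as a Kronecker product, with the fibre
  factors controlled by the discriminant; from above by Laplace expansion into
  \<open>all_is (d * k)\<close> and O(k) further rows.\<close>

lemma fibre_configuration_le:
  assumes e: "graded_enumeration e"
    and K: "\<And>z. z \<in> K \<Longrightarrow> cmod (fst z) \<le> c \<and> cmod (snd z) \<le> c"
  obtains C where "1 \<le> C"
    "\<And>k \<zeta>s. set \<zeta>s \<subseteq> K \<Longrightarrow> length \<zeta>s = monomial_count k \<Longrightarrow>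
      ((\<Prod>\<zeta>\<leftarrow>\<zeta>s. cmod (ev (det gram) \<zeta>)) * vdm (mons k) \<zeta>s) ^ D \<le>
        C ^ (k + 1)\<^sup>2 * (Delta (d * k) * Van e (monomial_count (d * k)) (f -` K))"
proof -
  obtain c1 where c1: "1 \<le> c1" "\<And>z. f z \<in> K \<Longrightarrow> cmod (fst z) \<le> c1 \<and> cmod (snd z) \<le> c1"
    by (rule preimage_bounded[of K, OF K]) auto
  define c0 where "c0 = max c1 c"
  have c0: "1 \<le> c0" using c1(1) by (simp add: c0_def)
  have c0E: "cmod (fst z) \<le> c0" "cmod (snd z) \<le> c0" "cmod (fst (f z)) \<le> c0" "cmod (snd (f z)) \<le> c0" if "f z \<in> K" for z
    using c1(2)[OF that] K[OF that] by (auto simp: c0_def)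
  obtain q0 where q0: "1 \<le> q0" "\<And>z. z \<in> K \<Longrightarrow> cmod (ev (det gram) z) \<le> q0" by (rule ev_bounded[of K, OF K]) auto
  define G where "G = c0 ^ (2 * d)"
  define H where "H = (real D * G) ^ D"
  define L where "L = 3 * D"
  have G1: "1 \<le> G" using c0 by (simp add: G_def)
  have H1: "1 \<le> H" unfolding H_def using G1 D_pos by (intro one_le_power mult_ge1_I) auto
  define C where "C = (q0 ^ D * H) * (2 ^ D * (2 ^ (L * L) * G ^ L))"
  have C1: "1 \<le> C" unfolding C_def using q0(1) H1 G1 by (intro mult_ge1_I one_le_power) auto
  moreover have "((\<Prod>\<zeta>\<leftarrow>\<zeta>s. cmod (ev (det gram) \<zeta>)) * vdm (mons k) \<zeta>s) ^ D \<le>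
        C ^ (k + 1)\<^sup>2 * (Delta (d * k) * Van e (monomial_count (d * k)) (f -` K))"
    if \<zeta>s: "set \<zeta>s \<subseteq> K" "length \<zeta>s = monomial_count k" for k \<zeta>s
  proof -
    define V where "V = Van e (monomial_count (d * k)) (f -` K)"
    have E: "cmod (fst z) \<le> c1 \<and> cmod (snd z) \<le> c1" if "z \<in> f -` K" for z using c1(2) that by simp
    have V0: "0 \<le> V" unfolding V_def by (rule Van_nonneg(1)[OF e E])
    show ?thesis
    proof (cases "vdm (mons k) \<zeta>s = 0")
      case True
      then show ?thesis using C1 V0 Delta_pos[of "d * k"] by (simp add: V_def[symmetric] zero_power[OF D_pos])
    next
      case False
      then have pos: "vdm (mons k) \<zeta>s > 0" using vdm_nonneg[of "mons k" \<zeta>s] by linarith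
      \<comment> \<open>A vanishing left side is trivial; otherwise the base points are distinct,
        which is what keeps the fibres apart in the Kronecker formula.\<close>
      have dist: "distinct \<zeta>s" by (rule vdm_pos_distinct_columns[OF pos]) (simp add: length_mons \<zeta>s(2))
      have "\<forall>\<zeta>\<in>K. \<exists>ws. length ws = D \<and> (\<forall>w\<in>set ws. f w = \<zeta>) \<and> cmod (ev (det gram) \<zeta>) \<le> H * vdm (map monomial_at gs) ws"
      proof
        fix \<zeta> assume "\<zeta> \<in> K"
        have "cmod (g i w) \<le> G" if "f w = \<zeta>" "i < D" for w i
        proof -
          have "gs ! i \<in> \<Gamma>" using that(2) length_gs gs(2) nth_mem by metis
          then show ?thesis using c0E[of w] \<open>\<zeta> \<in> K\<close> that(1) c0 degG unfolding g_def G_def by (intro cmod_monomial_at_le) auto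
        qed
        then show "\<exists>ws. length ws = D \<and> (\<forall>w\<in>set ws. f w = \<zeta>) \<and> cmod (ev (det gram) \<zeta>) \<le> H * vdm (map monomial_at gs) ws"
          unfolding H_def by (metis fibre_points)
      qed
      then obtain ws where ws: "\<And>\<zeta>. \<zeta> \<in> K \<Longrightarrow> length (ws \<zeta>) = D" "\<And>\<zeta> w. \<zeta> \<in> K \<Longrightarrow> w \<in> set (ws \<zeta>) \<Longrightarrow> f w = \<zeta>"
        "\<And>\<zeta>. \<zeta> \<in> K \<Longrightarrow> cmod (ev (det gram) \<zeta>) \<le> H * vdm (map monomial_at gs) (ws \<zeta>)" by metis
      define xs where "xs = concat (map ws \<zeta>s)"
      have xsK: "f x \<in> K" if "x \<in> set xs" for x
      proof -
        obtain \<zeta> where "\<zeta> \<in> set \<zeta>s" "x \<in> set (ws \<zeta>)" using \<open>x \<in> set xs\<close> by (auto simp: xs_def)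
        then show ?thesis using ws(2)[of \<zeta> x] \<zeta>s(1) by auto
      qed
      have kron: "vdm (map nw (block k)) xs = vdm (mons k) \<zeta>s ^ D * (\<Prod>\<zeta>\<leftarrow>\<zeta>s. vdm (map monomial_at gs) (ws \<zeta>))"
        using vdm_kronecker[of \<zeta>s "mons k" ws "map monomial_at gs" f] dist \<zeta>s ws
        by (auto simp: map_nw_block xs_def length_gs length_mons subset_eq)
      have lxs: "length xs = D * monomial_count k"
      proof -
        have "length (concat (map ws l)) = D * length l" if "set l \<subseteq> K" for l
          using that ws(1) by (induction l) auto
        then show ?thesis using \<zeta>s by (simp add: xs_def)
      qed
      define rest where "rest = filter (\<lambda>y. y \<notin> set (all_is (d * k))) (block k)"
      have sub: "set (all_is (d * k)) \<subseteq> set (block k)"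
      proof -
        have "total_deg \<alpha> \<le> k" if "total_deg \<beta> + d * total_deg \<alpha> \<le> d * k" for \<alpha> \<beta>
        proof -
          have "d * total_deg \<alpha> \<le> d * k" using that by linarith
          then show ?thesis using d by simp
        qed
        then show ?thesis by (auto simp: set_block set_all_is)
      qed
      have ms: "mset (block k) = mset (all_is (d * k) @ rest)"
        unfolding rest_def by (rule mset_append_filter[OF distinct_all_is distinct_block sub])
      have lr: "D * monomial_count k = monomial_count (d * k) + length rest"
        using arg_cong[OF ms, of size] by (simp add: length_all_is length_block)
      have lrL: "length rest \<le> L * (k + 1)"
      proof -
        have "D * ((k + 1) * (k + 2)) = (d * k + 1) * (d * k + 2) + 2 * length rest"
          using lr two_monomial_count[of k] two_monomial_count[of "d * k"] by (metis add_mult_distrib2 mult.left_commute)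
        then have "D * (3 * k + 2) = 3 * d * k + 2 + 2 * length rest" by (simp add: D_def power2_eq_square algebra_simps)
        moreover have "D * (3 * k + 2) \<le> L * (k + 1)" by (simp add: L_def algebra_simps)
        ultimately show ?thesis by linarith
      qed
      have "vdm (map nw (block k)) xs = vdm (map nw (all_is (d * k)) @ map nw rest) xs"
        unfolding map_append[symmetric] by (rule vdm_perm_rows) (simp only: mset_map ms)
      also have "\<dots> \<le> 2 ^ length xs * ((Delta (d * k) * V) * (2 ^ (L * L) * G ^ L) ^ (k + 1)\<^sup>2)"
      proof (rule vdm_append_le)
        show "length xs = length (map nw (all_is (d * k))) + length (map nw rest)"
          using lxs lr by (simp add: length_all_is)
        fix ys assume ys: "set ys \<subseteq> set xs"
        show "vdm (map nw (all_is (d * k))) ys \<le> Delta (d * k) * V" if l: "length ys = length (map nw (all_is (d * k)))"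
        proof -
          have "vdm (map nw (all_is (d * k))) ys = Delta (d * k) * vdm (mons (d * k)) ys"
            using vdm_all_is[of ys "d * k" "[]"] l by (simp add: length_all_is)
          also have "\<dots> \<le> Delta (d * k) * V"
            unfolding V_def using Delta_pos[of "d * k"] ys xsK l
            by (intro mult_left_mono Van_nonneg(2)[OF e E]) (auto simp: length_all_is)
          finally show ?thesis .
        qed
        show "vdm (map nw rest) ys \<le> (2 ^ (L * L) * G ^ L) ^ (k + 1)\<^sup>2" if l: "length ys = length (map nw rest)"
        proof (rule vdm_crude_bound[OF l])
          show "length (map nw rest) \<le> L * (k + 1)" using lrL by simp
          fix h x assume "h \<in> set (map nw rest)" "x \<in> set ys"
          then obtain y where y: "h = nw y" "y \<in> set (block k)" by (auto simp: rest_def)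
          have "total_deg (fst y) \<le> 2 * d" "total_deg (snd y) \<le> k" using y(2) degG by (auto simp: set_block)
          moreover have "k \<le> 2 * d * k" using d by simp
          ultimately have "total_deg (fst y) + total_deg (snd y) \<le> 2 * d + 2 * d * k" by linarith
          then have "total_deg (fst y) + total_deg (snd y) \<le> 2 * d * (k + 1)" by simp
          then have "cmod (h x) \<le> c0 ^ (2 * d * (k + 1))"
            unfolding y(1) using c0E[of x] c0 xsK[of x] ys \<open>x \<in> set ys\<close> by (intro cmod_nw_le) auto
          then show "cmod (h x) \<le> G ^ (k + 1)" by (simp only: G_def power_mult)
        qed (rule G1)
      qed (use Delta_pos[of "d * k"] V0 G1 in auto)
      also have "\<dots> \<le> (2 ^ D) ^ (k + 1)\<^sup>2 * ((Delta (d * k) * V) * (2 ^ (L * L) * G ^ L) ^ (k + 1)\<^sup>2)"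
      proof (rule mult_right_mono)
        have "length xs \<le> D * (k + 1)\<^sup>2" unfolding lxs by (intro mult_left_mono monomial_count_le) simp
        then show "(2 :: real) ^ length xs \<le> (2 ^ D) ^ (k + 1)\<^sup>2"
          unfolding power_mult[symmetric] by (rule power_increasing) simp
      qed (use Delta_pos[of "d * k"] V0 G1 in auto)
      finally have up: "vdm (map nw (block k)) xs \<le> (2 ^ D) ^ (k + 1)\<^sup>2 * ((Delta (d * k) * V) * (2 ^ (L * L) * G ^ L) ^ (k + 1)\<^sup>2)" .
      \<comment> \<open>The fibre estimate uses the discriminant only once per point. The other D -
        1 factors are absorbed by its bound \<open>q0\<close>, so that discriminant and Vandermonde
        determinant carry the same exponent D and a root can be taken.\<close>
      have "(\<Prod>\<zeta>\<leftarrow>\<zeta>s. cmod (ev (det gram) \<zeta>)) ^ D = (\<Prod>\<zeta>\<leftarrow>\<zeta>s. cmod (ev (det gram) \<zeta>) ^ D)"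
        by (rule prod_list_power)
      also have "\<dots> \<le> (\<Prod>\<zeta>\<leftarrow>\<zeta>s. (q0 ^ D * H) * vdm (map monomial_at gs) (ws \<zeta>))"
      proof (rule prod_list_mono_real[THEN conjunct1], intro conjI)
        fix \<zeta> assume "\<zeta> \<in> set \<zeta>s"
        then have \<zeta>: "\<zeta> \<in> K" using \<zeta>s(1) by auto
        obtain D' where D': "D = Suc D'" using D_pos by (cases D) auto
        have "cmod (ev (det gram) \<zeta>) ^ D = cmod (ev (det gram) \<zeta>) ^ D' * cmod (ev (det gram) \<zeta>)" by (simp add: D')
        also have "\<dots> \<le> q0 ^ D * (H * vdm (map monomial_at gs) (ws \<zeta>))"
        proof (rule mult_mono)
          have "cmod (ev (det gram) \<zeta>) ^ D' \<le> q0 ^ D'" using q0(2)[OF \<zeta>] by (rule power_mono) simp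
          also have "\<dots> \<le> q0 ^ D" using q0(1) by (intro power_increasing) (auto simp: D')
          finally show "cmod (ev (det gram) \<zeta>) ^ D' \<le> q0 ^ D" .
        qed (use ws(3)[OF \<zeta>] q0(1) in auto)
        finally show "cmod (ev (det gram) \<zeta>) ^ D \<le> (q0 ^ D * H) * vdm (map monomial_at gs) (ws \<zeta>)" by (simp add: mult.assoc)
      qed simp
      also have "\<dots> = (q0 ^ D * H) ^ monomial_count k * (\<Prod>\<zeta>\<leftarrow>\<zeta>s. vdm (map monomial_at gs) (ws \<zeta>))"
        by (simp add: prod_list_const_mult \<zeta>s(2))
      also have "\<dots> \<le> (q0 ^ D * H) ^ (k + 1)\<^sup>2 * (\<Prod>\<zeta>\<leftarrow>\<zeta>s. vdm (map monomial_at gs) (ws \<zeta>))"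
      proof (rule mult_right_mono)
        show "(q0 ^ D * H) ^ monomial_count k \<le> (q0 ^ D * H) ^ (k + 1)\<^sup>2"
          using q0(1) H1 by (intro power_increasing monomial_count_le mult_ge1_I one_le_power) auto
        show "0 \<le> (\<Prod>\<zeta>\<leftarrow>\<zeta>s. vdm (map monomial_at gs) (ws \<zeta>))"
          by (rule prod_list_mono_real[THEN conjunct2, of _ _ "\<lambda>\<zeta>. vdm (map monomial_at gs) (ws \<zeta>)"]) auto
      qed
      finally have qle: "(\<Prod>\<zeta>\<leftarrow>\<zeta>s. cmod (ev (det gram) \<zeta>)) ^ D \<le> (q0 ^ D * H) ^ (k + 1)\<^sup>2 * (\<Prod>\<zeta>\<leftarrow>\<zeta>s. vdm (map monomial_at gs) (ws \<zeta>))" .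
      have "((\<Prod>\<zeta>\<leftarrow>\<zeta>s. cmod (ev (det gram) \<zeta>)) * vdm (mons k) \<zeta>s) ^ D \<le>
          ((q0 ^ D * H) ^ (k + 1)\<^sup>2 * (\<Prod>\<zeta>\<leftarrow>\<zeta>s. vdm (map monomial_at gs) (ws \<zeta>))) * vdm (mons k) \<zeta>s ^ D"
        unfolding power_mult_distrib[of "prod_list _"] using qle by (rule mult_right_mono) simp
      also have "\<dots> = (q0 ^ D * H) ^ (k + 1)\<^sup>2 * vdm (map nw (block k)) xs"
        unfolding kron by (simp only: mult_ac)
      also have "\<dots> \<le> (q0 ^ D * H) ^ (k + 1)\<^sup>2 * ((2 ^ D) ^ (k + 1)\<^sup>2 * ((Delta (d * k) * V) * (2 ^ (L * L) * G ^ L) ^ (k + 1)\<^sup>2))"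
        using up q0(1) H1 by (intro mult_left_mono) auto
      also have "\<dots> = C ^ (k + 1)\<^sup>2 * (Delta (d * k) * V)"
        unfolding C_def power_mult_distrib[of "q0 ^ D * H"] power_mult_distrib[of "2 ^ D"] by (simp only: mult_ac)
      finally show ?thesis by (simp only: V_def)
    qed
  qed
  ultimately show thesis by (rule that)
qed

lemma Van_le_preimage:
  assumes e: "graded_enumeration e"
    and K: "\<And>z. z \<in> K \<Longrightarrow> cmod (fst z) \<le> c \<and> cmod (snd z) \<le> c"
  obtains a C where "1 \<le> C"
    "\<And>k. Van e (monomial_count (k + a)) K ^ D \<le>
       C ^ (k + 1)\<^sup>2 * (Delta (d * k) * Van e (monomial_count (d * k)) (f -` K))"
proof -
  obtain C1 where C1: "1 \<le> C1" "\<And>k \<zeta>s. set \<zeta>s \<subseteq> K \<Longrightarrow> length \<zeta>s = monomial_count k \<Longrightarrow>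
      ((\<Prod>\<zeta>\<leftarrow>\<zeta>s. cmod (ev (det gram) \<zeta>)) * vdm (mons k) \<zeta>s) ^ D \<le>
        C1 ^ (k + 1)\<^sup>2 * (Delta (d * k) * Van e (monomial_count (d * k)) (f -` K))"
    by (rule fibre_configuration_le[of e K c, OF e K]) auto
  obtain a C2 where C2: "1 \<le> C2" "\<And>k B. 0 \<le> B \<Longrightarrow> (\<And>\<zeta>s. set \<zeta>s \<subseteq> K \<Longrightarrow> length \<zeta>s = monomial_count k \<Longrightarrow>
        (\<Prod>\<zeta>\<leftarrow>\<zeta>s. cmod (ev (det gram) \<zeta>)) * vdm (mons k) \<zeta>s \<le> B) \<Longrightarrow>
      Van e (monomial_count (k + a)) K \<le> C2 ^ (k + 1)\<^sup>2 * B"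
    by (rule Van_le_multiplied[of e "det gram" K c, OF e det_gram_nonzero K]) auto
  obtain c1 where c1: "\<And>z. f z \<in> K \<Longrightarrow> cmod (fst z) \<le> c1 \<and> cmod (snd z) \<le> c1"
    by (rule preimage_bounded[of K, OF K]) auto
  have "Van e (monomial_count (k + a)) K ^ D \<le>
       (C2 ^ D * C1) ^ (k + 1)\<^sup>2 * (Delta (d * k) * Van e (monomial_count (d * k)) (f -` K))" for k
  proof -
    define X where "X = C1 ^ (k + 1)\<^sup>2 * (Delta (d * k) * Van e (monomial_count (d * k)) (f -` K))"
    have "0 \<le> Van e (monomial_count (d * k)) (f -` K)" by (rule Van_nonneg(1)[OF e, of _ c1]) (use c1 in auto)
    then have X0: "0 \<le> X" using C1(1) Delta_pos[of "d * k"] by (simp add: X_def)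
    \<comment> \<open>The multiplication estimate is linear in its bound, so the D-th root is taken
      before it is applied and undone afterwards.\<close>
    have "Van e (monomial_count (k + a)) K \<le> C2 ^ (k + 1)\<^sup>2 * root D X"
    proof (rule C2(2))
      show "0 \<le> root D X" using X0 D_pos by simp
      fix \<zeta>s assume \<zeta>s: "set \<zeta>s \<subseteq> K" "length \<zeta>s = monomial_count k"
      let ?p = "(\<Prod>\<zeta>\<leftarrow>\<zeta>s. cmod (ev (det gram) \<zeta>)) * vdm (mons k) \<zeta>s"
      have "0 \<le> (\<Prod>\<zeta>\<leftarrow>\<zeta>s. cmod (ev (det gram) \<zeta>))"
        by (rule prod_list_mono_real[THEN conjunct2, of _ _ "\<lambda>\<zeta>. cmod (ev (det gram) \<zeta>)"]) auto
      then have "?p = root D (?p ^ D)" using D_pos by (simp add: real_root_power_cancel)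
      also have "\<dots> \<le> root D X" using C1(2)[OF \<zeta>s] D_pos by (simp add: X_def)
      finally show "?p \<le> root D X" .
    qed
    moreover have "0 \<le> Van e (monomial_count (k + a)) K" by (rule Van_nonneg(1)[OF e K])
    ultimately have "Van e (monomial_count (k + a)) K ^ D \<le> (C2 ^ (k + 1)\<^sup>2 * root D X) ^ D" by (rule power_mono)
    also have "\<dots> = (C2 ^ (k + 1)\<^sup>2) ^ D * X"
      using X0 D_pos by (simp add: power_mult_distrib)
    also have "(C2 ^ (k + 1)\<^sup>2) ^ D = (C2 ^ D) ^ (k + 1)\<^sup>2" by (simp only: power_mult[symmetric] mult.commute)
    also have "(C2 ^ D) ^ (k + 1)\<^sup>2 * X = (C2 ^ D * C1) ^ (k + 1)\<^sup>2 * (Delta (d * k) * Van e (monomial_count (d * k)) (f -` K))"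
      by (simp only: X_def power_mult_distrib mult.assoc)
    finally show ?thesis .
  qed
  moreover have "1 \<le> C2 ^ D * C1" using C1(1) C2(1) by (intro mult_ge1_I one_le_power)
  ultimately show thesis by (intro that[of "C2 ^ D * C1" a])
qed

end

section \<open>Asymptotics\<close>

lemma monomial_count_diff: "0 < \<nu> \<Longrightarrow> monomial_count \<nu> - monomial_count (\<nu> - 1) = \<nu> + 1"
proof -
  assume "0 < \<nu>"
  then obtain m where m: "\<nu> = Suc m" by (cases \<nu>) auto
  have "2 * monomial_count (Suc m) = 2 * monomial_count m + 2 * (m + 2)"
    unfolding two_monomial_count by simp
  then show ?thesis by (simp add: m)
qed

lemma degree_sum_eq: "real (degree_sum n) = real n * (real n + 1) * (real n + 2) / 3"
proof (induction n)
  case 0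
  show ?case by (simp add: degree_sum_def)
next
  case (Suc n)
  have "degree_sum (Suc n) = degree_sum n + Suc n * (Suc n + 1)"
    using monomial_count_diff[of "Suc n"] by (simp add: degree_sum_def)
  then have "real (degree_sum (Suc n)) = real (degree_sum n) + (real n + 1) * (real n + 2)" by (simp add: algebra_simps)
  then show ?case unfolding Suc.IH by (simp add: field_simps)
qed

lemma degree_sum_pos: "0 < n \<Longrightarrow> 0 < real (degree_sum n)"
  by (simp add: degree_sum_eq)

text \<open>The reason why all factors of the form C^((n + 1)^2) disappear after taking roots of
  order l_n.\<close>

lemma LIMSEQ_squares_over_degree_sum: "(\<lambda>n. real ((n + 1)\<^sup>2) / real (degree_sum n)) \<longlonglongrightarrow> 0"
  unfolding degree_sum_eq of_nat_power of_nat_add of_nat_1 by real_asymp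

text \<open>The exponent of the resultant in \<open>Delta n\<close>, collected over all degrees up
  to n.\<close>

definition res_exponent :: "nat \<Rightarrow> nat \<Rightarrow> nat" where
  "res_exponent d n = (\<Sum>m<Suc n. m div d * (m div d - 1) div 2)"

text \<open>Replacing m div d by m / d changes each term by O(m), so the sum is n^3 / (6 d^2) +
  O(n^2), while l_n is n^3 / 3 + O(n^2).\<close>

lemma LIMSEQ_res_exponent:
  assumes d: "1 \<le> d"
  shows "(\<lambda>n. real (res_exponent d n) / real (degree_sum n)) \<longlonglongrightarrow> 1 / (2 * (real d)\<^sup>2)"
proof -
  define a where "a = 1 / real d"
  have a: "0 < a" using d by (simp add: a_def)
  have q: "real (q * (q - 1) div 2) = real q * (real q - 1) / 2" for q :: nat
  proof (cases q)
    case (Suc m)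
    have "even (q * (q - 1))" by (cases "even q") auto
    then have "real (q * (q - 1) div 2) = real (q * (q - 1)) / 2" by (simp add: real_of_nat_div)
    then show ?thesis using Suc by (simp add: algebra_simps)
  qed simp
  have bnd: "(a * m)\<^sup>2 / 2 - 3 * (a * m) / 2 - 1 \<le> real (m div d * (m div d - 1) div 2) \<and>
      real (m div d * (m div d - 1) div 2) \<le> (a * m)\<^sup>2 / 2" for m :: nat
  proof -
    define x where "x = real (m div d)"
    have x: "x \<le> a * m" "a * m < x + 1" "0 \<le> x"
    proof -
      have "real m = real d * x + real (m mod d)" unfolding x_def of_nat_mult[symmetric] of_nat_add[symmetric] by simp
      moreover have "real (m mod d) < real d" using d by simp
      ultimately show "x \<le> a * m" "a * m < x + 1" using d by (auto simp: a_def field_simps)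
    qed (simp add: x_def)
    define y where "y = a * real m"
    have y: "x \<le> y" "y < x + 1" using x by (auto simp: y_def)
    have "x * x \<le> y * y" using x(3) y by (intro mult_mono) auto
    moreover have "y * y \<le> (x + 1) * (x + 1)" using x(3) y by (intro mult_mono) auto
    ultimately have "y * y \<le> x * x + 2 * x + 1" "x * x \<le> y * y" by (auto simp: algebra_simps)
    then have "y * y / 2 - 3 * y / 2 - 1 \<le> (x * x - x) / 2 \<and> (x * x - x) / 2 \<le> y * y / 2" using y x(3) by auto
    then show ?thesis unfolding q x_def[symmetric] y_def[symmetric] by (simp add: power2_eq_square right_diff_distrib)
  qed
  have s2: "(\<Sum>m<Suc n. (real m)\<^sup>2) = real n * (real n + 1) * (2 * real n + 1) / 6" for n
    by (induction n) (auto simp: field_simps power2_eq_square)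
  have s1: "(\<Sum>m<Suc n. real m) = real n * (real n + 1) / 2" for n
    by (induction n) (auto simp: field_simps)
  have up: "real (res_exponent d n) \<le> a\<^sup>2 / 2 * (real n * (real n + 1) * (2 * real n + 1) / 6)" for n
  proof -
    have "real (res_exponent d n) \<le> (\<Sum>m<Suc n. (a * m)\<^sup>2 / 2)"
      unfolding res_exponent_def of_nat_sum using bnd by (intro sum_mono) auto
    also have "\<dots> = a\<^sup>2 / 2 * (\<Sum>m<Suc n. (real m)\<^sup>2)"
      unfolding sum_distrib_left by (intro sum.cong) (auto simp: power_mult_distrib)
    finally show ?thesis unfolding s2 .
  qed
  have low: "a\<^sup>2 / 2 * (real n * (real n + 1) * (2 * real n + 1) / 6) - 3 * a / 2 * (real n * (real n + 1) / 2) - (real n + 1) \<le> real (res_exponent d n)" for n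
  proof -
    have "a\<^sup>2 / 2 * (\<Sum>m<Suc n. (real m)\<^sup>2) - 3 * a / 2 * (\<Sum>m<Suc n. real m) - (\<Sum>m<Suc n. 1) = (\<Sum>m<Suc n. (a * m)\<^sup>2 / 2 - 3 * (a * m) / 2 - 1)"
      unfolding sum_distrib_left sum_subtractf[symmetric] by (intro sum.cong) (auto simp: power_mult_distrib)
    also have "\<dots> \<le> real (res_exponent d n)"
      unfolding res_exponent_def of_nat_sum using bnd by (intro sum_mono) auto
    finally show ?thesis unfolding s1 s2 by simp
  qed
  have "(\<lambda>n. real (res_exponent d n) / real (degree_sum n)) \<longlonglongrightarrow> a\<^sup>2 / 2"
  proof (rule tendsto_sandwich)
    show "eventually (\<lambda>n. (a\<^sup>2 / 2 * (real n * (real n + 1) * (2 * real n + 1) / 6) - 3 * a / 2 * (real n * (real n + 1) / 2) - (real n + 1)) / real (degree_sum n)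
        \<le> real (res_exponent d n) / real (degree_sum n)) sequentially"
      using low by (intro always_eventually allI divide_right_mono) auto
    show "eventually (\<lambda>n. real (res_exponent d n) / real (degree_sum n) \<le>
        a\<^sup>2 / 2 * (real n * (real n + 1) * (2 * real n + 1) / 6) / real (degree_sum n)) sequentially"
      using up by (intro always_eventually allI divide_right_mono) auto
    show "(\<lambda>n. (a\<^sup>2 / 2 * (real n * (real n + 1) * (2 * real n + 1) / 6) - 3 * a / 2 * (real n * (real n + 1) / 2) - (real n + 1)) / real (degree_sum n)) \<longlonglongrightarrow> a\<^sup>2 / 2"
      unfolding degree_sum_eq using a by real_asymp
    show "(\<lambda>n. a\<^sup>2 / 2 * (real n * (real n + 1) * (2 * real n + 1) / 6) / real (degree_sum n)) \<longlonglongrightarrow> a\<^sup>2 / 2"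
      unfolding degree_sum_eq using a by real_asymp
  qed
  then show ?thesis by (simp add: a_def power_divide mult.commute)
qed

text \<open>There are d^2 groups of degree about n / d, and d^2 (n / d)^3 = n^3 / d.\<close>

lemma LIMSEQ_degree_sum_div:
  assumes d: "1 \<le> d"
  shows "(\<lambda>n. real (d\<^sup>2 * degree_sum (n div d - 2)) / real (degree_sum n)) \<longlonglongrightarrow> 1 / real d"
proof -
  define a where "a = 1 / real d"
  have a: "0 < a" using d by (simp add: a_def)
  \<comment> \<open>Rounding down loses less than 1 and the truncated subtraction at most 2.\<close>
  have k: "a * n - 3 \<le> real (n div d - 2) \<and> real (n div d - 2) \<le> a * n" for n
  proof -
    have "real n = real d * real (n div d) + real (n mod d)" unfolding of_nat_mult[symmetric] of_nat_add[symmetric] by simp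
    moreover have "real (n mod d) < real d" using d by simp
    ultimately have "real (n div d) \<le> a * n" "a * n < real (n div d) + 1" using d by (auto simp: a_def field_simps)
    then show ?thesis by linarith
  qed
  have mono: "x * (x + 1) * (x + 2) \<le> y * (y + 1) * (y + 2)" if "0 \<le> x" "x \<le> y" for x y :: real
    using that by (intro mult_mono) auto
  have "(\<lambda>n. (real (n div d - 2) * (real (n div d - 2) + 1) * (real (n div d - 2) + 2) / 3) / real (degree_sum n)) \<longlonglongrightarrow> a * a * a"
  proof (rule tendsto_sandwich)
    have "eventually (\<lambda>n. 0 \<le> a * real n - 3) sequentially" using a by real_asymp
    then show "eventually (\<lambda>n. ((a * real n - 3) * (a * real n - 3 + 1) * (a * real n - 3 + 2) / 3) / real (degree_sum n) \<le>
       (real (n div d - 2) * (real (n div d - 2) + 1) * (real (n div d - 2) + 2) / 3) / real (degree_sum n)) sequentially"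
    proof eventually_elim
      case (elim n)
      have "(a * real n - 3) * (a * real n - 3 + 1) * (a * real n - 3 + 2) \<le>
          real (n div d - 2) * (real (n div d - 2) + 1) * (real (n div d - 2) + 2)"
        using elim k[of n] by (intro mono) auto
      then show ?case by (intro divide_right_mono) auto
    qed
    show "eventually (\<lambda>n. (real (n div d - 2) * (real (n div d - 2) + 1) * (real (n div d - 2) + 2) / 3) / real (degree_sum n) \<le>
       ((a * real n) * (a * real n + 1) * (a * real n + 2) / 3) / real (degree_sum n)) sequentially"
      using k by (intro always_eventually allI divide_right_mono mono) auto
    show "(\<lambda>n. ((a * real n - 3) * (a * real n - 3 + 1) * (a * real n - 3 + 2) / 3) / real (degree_sum n)) \<longlonglongrightarrow> a * a * a"
      unfolding degree_sum_eq using a by real_asymp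
    show "(\<lambda>n. ((a * real n) * (a * real n + 1) * (a * real n + 2) / 3) / real (degree_sum n)) \<longlonglongrightarrow> a * a * a"
      unfolding degree_sum_eq using a by real_asymp
  qed
  then have "(\<lambda>n. (real d)\<^sup>2 * ((real (n div d - 2) * (real (n div d - 2) + 1) * (real (n div d - 2) + 2) / 3) / real (degree_sum n))) \<longlonglongrightarrow> (real d)\<^sup>2 * (a * a * a)"
    by (rule tendsto_mult_left)
  moreover have "(real d)\<^sup>2 * (a * a * a) = 1 / real d" using d by (simp add: a_def power_divide power2_eq_square power3_eq_cube)
  ultimately show ?thesis by (simp add: degree_sum_eq)
qed

text \<open>The same ratio for the lower bound; the constant shift a, caused by the multiplication
  with the discriminant, has no influence on the limit.\<close>

lemma LIMSEQ_degree_sum_mult: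
  assumes d: "1 \<le> d"
  shows "(\<lambda>k. real (d\<^sup>2 * degree_sum (k + a)) / real (degree_sum (d * k))) \<longlonglongrightarrow> 1 / real d"
proof -
  define D A where "D = real d" and "A = real a"
  have D: "0 < D" using d by (simp add: D_def)
  have "(\<lambda>k. D\<^sup>2 * ((real k + A) * (real k + A + 1) * (real k + A + 2) / 3) / ((D * real k) * (D * real k + 1) * (D * real k + 2) / 3)) \<longlonglongrightarrow> 1 / D"
    using D by (real_asymp simp: power2_eq_square)
  then show ?thesis by (simp add: degree_sum_eq D_def A_def)
qed

section \<open>Limits superior of bounded real sequences\<close>

text \<open>Characterises a finite limit superior by its two defining inequalities, so that the
  comparison can be carried out in the reals.\<close>

definition is_limsup :: "(nat \<Rightarrow> real) \<Rightarrow> real \<Rightarrow> bool" where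
  "is_limsup x T \<longleftrightarrow> (\<forall>t>T. eventually (\<lambda>n. x n < t) sequentially) \<and> (\<forall>t<T. frequently (\<lambda>n. t < x n) sequentially)"

lemma is_limsup_real_of_ereal:
  assumes "\<And>n. 0 \<le> x n" "\<And>n. x n \<le> b"
  shows "is_limsup x (real_of_ereal (limsup (\<lambda>n. ereal (x n))))"
proof -
  define l where "l = limsup (\<lambda>n. ereal (x n))"
  have "l \<le> ereal b" unfolding l_def by (rule Limsup_bounded) (use assms in auto)
  moreover have "0 \<le> l"
    unfolding l_def using assms(1)
    by (intro order_trans[OF _ Liminf_le_Limsup] Liminf_bounded) auto
  ultimately have l: "l = ereal (real_of_ereal l)" by (cases l) auto
  have "eventually (\<lambda>n. x n < t) sequentially" if "real_of_ereal l < t" for t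
  proof -
    have "limsup (\<lambda>n. ereal (x n)) < ereal t" using that l unfolding l_def by (metis less_ereal.simps(1))
    from Limsup_lessD[OF this] show ?thesis by simp
  qed
  moreover have "frequently (\<lambda>n. t < x n) sequentially" if "t < real_of_ereal l" for t
  proof (rule ccontr)
    assume "\<not> ?thesis"
    then have "eventually (\<lambda>n. ereal (x n) \<le> ereal t) sequentially" by (simp add: not_frequently not_less)
    then have "limsup (\<lambda>n. ereal (x n)) \<le> ereal t" by (rule Limsup_bounded)
    then show False using that l unfolding l_def by (metis ereal_less_eq(3) not_less)
  qed
  ultimately show ?thesis unfolding is_limsup_def l_def by blast
qed

lemma is_limsup_le:
  assumes "is_limsup x T" "eventually (\<lambda>n. x n \<le> u n) sequentially" "u \<longlonglongrightarrow> U"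
  shows "T \<le> U"
proof (rule ccontr)
  assume "\<not> T \<le> U"
  then obtain t where t: "U < t" "t < T" using dense not_le by metis
  have "eventually (\<lambda>n. u n < t) sequentially" using assms(3) t(1) by (rule order_tendstoD(2))
  with assms(2) have "eventually (\<lambda>n. \<not> t < x n) sequentially" by eventually_elim auto
  then show False using assms(1) t(2) by (simp add: is_limsup_def frequently_def)
qed

text \<open>Frequent lower bounds along a sequence of indices tending to infinity suffice. The lower
  estimate needs both liberties: it lives in degrees d k, and only for those k where the maxima of
  \<open>K\<close> are large.\<close>

lemma is_limsup_ge:
  assumes "is_limsup x T" "frequently (\<lambda>k. u k \<le> x (h k)) sequentially" "u \<longlonglongrightarrow> U" "filterlim h at_top sequentially"
  shows "U \<le> T"
proof (rule ccontr)
  assume "\<not> U \<le> T"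
  then obtain t where t: "T < t" "t < U" using dense not_le by metis
  have "eventually (\<lambda>n. x n < t) sequentially" using assms(1) t(1) by (simp add: is_limsup_def)
  then have "eventually (\<lambda>k. x (h k) < t) sequentially" using assms(4) by (rule eventually_compose_filterlim)
  moreover have "eventually (\<lambda>k. t < u k) sequentially" using assms(3) t(2) by (rule order_tendstoD(1))
  ultimately have "eventually (\<lambda>k. \<not> u k \<le> x (h k)) sequentially" by eventually_elim auto
  then show False using assms(2) by (simp add: frequently_def)
qed

text \<open>Here the matrix has about n^2 / 2 rows, so the factorial needs the sharper bound m^m
  with m at most 4^(n + 1), which gives exp (O(n^3)); a bound of the form 2^(m^2) would be too
  large.\<close>

lemma Van_root_bounded:
  assumes e: "graded_enumeration e" and K: "\<And>z. z \<in> E \<Longrightarrow> cmod (fst z) \<le> c \<and> cmod (snd z) \<le> c"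
  obtains b where "\<And>n. Van e (monomial_count n) E powr (1 / real (degree_sum n)) \<le> b"
proof (rule that)
  fix n
  define C where "C = max 1 c"
  have C: "1 \<le> C" by (simp add: C_def)
  define m where "m = monomial_count n"
  have V0: "0 \<le> Van e m E" unfolding m_def by (rule Van_nonneg(1)[OF e K])
  \<comment> \<open>The exponent 4 stems from (n + 1)^3 \<le> 4 l_n for n \<ge> 1, with equality at
    n = 1. For n = 0 the root exponent 1 / 0 is 0 and the left side is at most 1.\<close>
  show "Van e (monomial_count n) E powr (1 / real (degree_sum n)) \<le> (4 * C) powr 4"
  proof (cases "n = 0")
    case True
    have "1 \<le> (4 * C) powr 4" using C by (intro ge_one_powr_ge_zero) auto
    then show ?thesis using True by (simp add: degree_sum_eq)
  next
    case False
    have l: "0 < real (degree_sum n)" using False by (intro degree_sum_pos) simp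
    have "Van e m E \<le> (4 * C) ^ (n + 1) ^ 3"
      unfolding m_def
    proof (rule Van_least[OF e])
      show "0 \<le> (4 * C) ^ (n + 1) ^ 3" using C by simp
      fix xs assume xs: "set xs \<subseteq> E" "length xs = monomial_count n"
      have "vdm (mons n) xs \<le> fact (length (mons n)) * (C ^ n) ^ length (mons n)"
      proof (rule vdm_le_fact)
        fix h x assume "h \<in> set (mons n)" "x \<in> set xs"
        then obtain \<gamma> where \<gamma>: "h = monomial_at \<gamma>" "total_deg \<gamma> \<le> n" "x \<in> E" using xs(1) by (auto simp: mons_def set_all_exps)
        show "cmod (h x) \<le> C ^ n" unfolding \<gamma>(1)
          using K[OF \<gamma>(3)] C \<gamma>(2) by (intro cmod_monomial_at_le) (auto simp: C_def)
      qed (use xs C in \<open>auto simp: length_mons\<close>)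
      also have "\<dots> = fact m * (C ^ n) ^ m" by (simp add: length_mons m_def)
      also have "\<dots> \<le> (4 ^ (n + 1)) ^ (n + 1)\<^sup>2 * (C ^ (n + 1)) ^ (n + 1)\<^sup>2"
      proof (rule mult_mono)
        have m: "m \<le> (n + 1)\<^sup>2" unfolding m_def by (rule monomial_count_le)
        have "n + 1 \<le> 2 ^ (n + 1)" using less_exp[of "n + 1"] by linarith
        then have "(n + 1)\<^sup>2 \<le> (2 ^ (n + 1))\<^sup>2" by (rule power_mono) simp
        also have "(2 ^ (n + 1))\<^sup>2 = (4 :: nat) ^ (n + 1)" by (simp add: power_mult[symmetric] power_even_eq[symmetric] power2_eq_square power_mult_distrib[symmetric] del: power_Suc)
        finally have m4: "m \<le> 4 ^ (n + 1)" using m by simp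
        have "(fact m :: real) \<le> real m ^ m" using fact_le_power[of m, where ?'a = real] by simp
        also have "\<dots> \<le> (4 ^ (n + 1)) ^ m"
        proof (rule power_mono)
          show "real m \<le> 4 ^ (n + 1)" using m4 by (metis of_nat_le_iff of_nat_numeral of_nat_power)
        qed simp
        also have "\<dots> \<le> (4 ^ (n + 1)) ^ (n + 1)\<^sup>2" using m by (intro power_increasing one_le_power) auto
        finally show "(fact m :: real) \<le> (4 ^ (n + 1)) ^ (n + 1)\<^sup>2" .
        have "(C ^ n) ^ m \<le> (C ^ (n + 1)) ^ m" using C by (intro power_mono power_increasing) auto
        also have "\<dots> \<le> (C ^ (n + 1)) ^ (n + 1)\<^sup>2" using m C by (intro power_increasing one_le_power) auto
        finally show "(C ^ n) ^ m \<le> (C ^ (n + 1)) ^ (n + 1)\<^sup>2" .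
      qed (use C in auto)
      also have "\<dots> = (4 * C) ^ (n + 1) ^ 3"
      proof -
        have "(n + 1) * (n + 1)\<^sup>2 = (n + 1) ^ 3" by (simp only: power3_eq_cube power2_eq_square mult.assoc)
        then show ?thesis by (simp only: power_mult_distrib[symmetric] power_mult[symmetric])
      qed
      finally show "vdm (mons n) xs \<le> (4 * C) ^ (n + 1) ^ 3" .
    qed
    then have "Van e m E powr (1 / real (degree_sum n)) \<le> ((4 * C) ^ (n + 1) ^ 3) powr (1 / real (degree_sum n))"
      using V0 by (intro powr_mono2) auto
    also have "\<dots> = (4 * C) powr (real ((n + 1) ^ 3) / real (degree_sum n))"
    proof -
      have "((4 * C) ^ N) powr (1 / x) = (4 * C) powr (real N / x)" for N x
        using C by (subst powr_realpow[symmetric]) (auto simp: powr_powr)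
      then show ?thesis .
    qed
    also have "\<dots> \<le> (4 * C) powr 4"
    proof (rule powr_mono)
      have "1 \<le> real n" using False by simp
      then have "1 \<le> real n * real n" using mult_mono[of 1 "real n" 1 "real n"] by simp
      then have "0 \<le> (real n + 1) * (real n * real n + 2 * real n - 3)" using \<open>1 \<le> real n\<close> by (intro mult_nonneg_nonneg) auto
      then have "real ((n + 1) ^ 3) \<le> 4 * real (degree_sum n)"
        by (simp add: degree_sum_eq power3_eq_cube algebra_simps)
      then show "real ((n + 1) ^ 3) / real (degree_sum n) \<le> 4" using l by (simp add: pos_divide_le_eq)
    qed (use C in simp)
    finally show ?thesis by (simp add: m_def)
  qed
qed

section \<open>The two inequalities between the transfinite diameters\<close>

context graded_pair
begin

text \<open>The values of \<kappa> are finitely many and enter n + 1 degrees with exponents at most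
  n, so up to exp (O(n^2)) in both directions only the power of the resultant remains.\<close>

lemma Delta_bounds:
  assumes R: "0 < R" and \<kappa>: "\<And>r. 0 < \<kappa> r"
    and cvd: "\<And>n. cvd (map (up A B) (is n)) = \<kappa> (n mod d) ^ (n div d) * R ^ (n div d * (n div d - 1) div 2)"
  obtains M where "1 \<le> M" "\<And>n. Delta n \<le> M ^ (n + 1)\<^sup>2 * R ^ res_exponent d n"
    "\<And>n. R ^ res_exponent d n \<le> M ^ (n + 1)\<^sup>2 * Delta n"
proof -
  define M where "M = 1 + (\<Sum>r<d. \<kappa> r + 1 / \<kappa> r)"
  have nn: "0 \<le> \<kappa> r + 1 / \<kappa> r" for r using \<kappa>[of r] by simp
  have "0 \<le> (\<Sum>r<d. \<kappa> r + 1 / \<kappa> r)" by (rule sum_nonneg) (rule nn)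
  then have M1: "1 \<le> M" unfolding M_def by linarith
  have M: "\<kappa> r \<le> M" "1 / \<kappa> r \<le> M" if "r < d" for r
  proof -
    have "\<kappa> r + 1 / \<kappa> r \<le> (\<Sum>r<d. \<kappa> r + 1 / \<kappa> r)"
      using that nn by (intro member_le_sum) auto
    moreover have "0 < \<kappa> r" "0 < 1 / \<kappa> r" using \<kappa> by auto
    ultimately show "\<kappa> r \<le> M" "1 / \<kappa> r \<le> M" unfolding M_def by linarith+
  qed
  define s where "s m = m div d * (m div d - 1) div 2" for m
  have Rs: "R ^ res_exponent d n = (\<Prod>m<Suc n. R ^ s m)" for n
    unfolding res_exponent_def s_def by (rule power_sum)
  have MM: "M ^ (n + 1)\<^sup>2 = (\<Prod>m<Suc n. M ^ (n + 1))" for n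
    by (simp only: prod_constant card_lessThan power_mult[symmetric] power2_eq_square Suc_eq_plus1)
  have q: "m div d \<le> n + 1" "m mod d < d" if "m < Suc n" for m n
  proof -
    show "m div d \<le> n + 1" using that div_le_dividend[of m d] by linarith
    show "m mod d < d" using d by simp
  qed
  have "Delta n \<le> M ^ (n + 1)\<^sup>2 * R ^ res_exponent d n" for n
    unfolding Delta_def MM Rs prod.distrib[symmetric]
  proof (rule prod_mono, intro conjI)
    fix m assume "m \<in> {..<Suc n}"
    then have m: "m < Suc n" by simp
    show "0 \<le> cvd (map (up A B) (is m))" using cvd_is[of m] by simp
    have "\<kappa> (m mod d) ^ (m div d) \<le> M ^ (m div d)" by (rule power_mono[OF M(1)[OF q(2)[OF m]] less_imp_le[OF \<kappa>]])
    also have "\<dots> \<le> M ^ (n + 1)" using q(1)[OF m] M1 by (rule power_increasing)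
    finally show "cvd (map (up A B) (is m)) \<le> M ^ (n + 1) * R ^ s m"
      unfolding cvd s_def using R by (intro mult_right_mono) auto
  qed
  moreover have "R ^ res_exponent d n \<le> M ^ (n + 1)\<^sup>2 * Delta n" for n
    unfolding Delta_def MM Rs prod.distrib[symmetric]
  proof (rule prod_mono, intro conjI)
    fix m assume "m \<in> {..<Suc n}"
    then have m: "m < Suc n" by simp
    show "0 \<le> R ^ s m" using R by simp
    have "(1 / \<kappa> (m mod d)) ^ (m div d) \<le> M ^ (m div d)" using M(2)[OF q(2)[OF m]] \<kappa> by (intro power_mono) (auto intro: less_imp_le)
    also have "\<dots> \<le> M ^ (n + 1)" using q(1)[OF m] M1 by (rule power_increasing)
    finally have "1 \<le> M ^ (n + 1) * \<kappa> (m mod d) ^ (m div d)"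
      using \<kappa>[of "m mod d"] by (simp add: power_divide pos_divide_le_eq del: power_Suc)
    then have "1 * R ^ s m \<le> (M ^ (n + 1) * \<kappa> (m mod d) ^ (m div d)) * R ^ s m"
      using R by (intro mult_right_mono) auto
    then show "R ^ s m \<le> M ^ (n + 1) * cvd (map (up A B) (is m))"
      unfolding cvd s_def by (simp add: mult.assoc)
  qed
  ultimately show thesis using M1 by (intro that)
qed

text \<open>For t > T the maxima of \<open>K\<close> in degree k are eventually at most t^(l_k).
  Since n div d - 2 tends to infinity with n, this enters the estimate for the preimage in all large
  degrees n; finally t decreases to T.\<close>

lemma limsup_preimage_le:
  assumes e: "graded_enumeration e" and R: "0 < R" and M: "1 \<le> M"
    and low: "\<And>n. R ^ res_exponent d n \<le> M ^ (n + 1)\<^sup>2 * Delta n"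
    and K: "\<And>z. z \<in> K \<Longrightarrow> cmod (fst z) \<le> c \<and> cmod (snd z) \<le> c"
    and T: "is_limsup (\<lambda>n. Van e (monomial_count n) K powr (1 / real (degree_sum n))) T" "0 \<le> T"
    and S: "is_limsup (\<lambda>n. Van e (monomial_count n) (f -` K) powr (1 / real (degree_sum n))) S"
  shows "S \<le> R powr (- 1 / (2 * (real d)\<^sup>2)) * T powr (1 / real d)"
proof -
  obtain C where C: "1 \<le> C" "\<And>n. 2 * d \<le> n \<Longrightarrow> Delta n * Van e (monomial_count n) (f -` K) \<le>
       C ^ (n + 1)\<^sup>2 * Van e (monomial_count (n div d - 2)) K ^ D"
    by (rule Van_preimage_le[of e K c, OF e K]) auto
  obtain c1 where c1: "\<And>z. z \<in> f -` K \<Longrightarrow> cmod (fst z) \<le> c1 \<and> cmod (snd z) \<le> c1"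
    using preimage_bounded[of K, OF K] by (metis vimageD)
  define l where "l n = real (degree_sum n)" for n
  define k where "k n = n div d - 2" for n
  define V where "V n = Van e (monomial_count n) K" for n
  define W where "W n = Van e (monomial_count n) (f -` K)" for n
  have V0: "0 \<le> V n" for n unfolding V_def by (rule Van_nonneg(1)[OF e K])
  have W0: "0 \<le> W n" for n unfolding W_def by (rule Van_nonneg(1)[OF e c1])
  have bound: "S \<le> R powr (- 1 / (2 * (real d)\<^sup>2)) * t powr (1 / real d)" if t: "T < t" for t
  proof (rule is_limsup_le[OF S])
    have t0: "0 < t" using t T(2) by simp
    \<comment> \<open>The root of order l_n of the estimate for the preimage, with the maximum for
      \<open>K\<close> replaced by a power of t. The first factor tends to 1.\<close>
    let ?u = "\<lambda>n. (M * C) powr (real ((n + 1)\<^sup>2) / real (degree_sum n)) *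
        (R powr (- (real (res_exponent d n) / real (degree_sum n))) * t powr (real (d\<^sup>2 * degree_sum (n div d - 2)) / real (degree_sum n)))"
    have "?u \<longlonglongrightarrow> (M * C) powr 0 * (R powr (- (1 / (2 * (real d)\<^sup>2))) * t powr (1 / real d))"
      using M C(1) R t0
      by (intro tendsto_mult tendsto_powr tendsto_const tendsto_minus LIMSEQ_squares_over_degree_sum
          LIMSEQ_res_exponent LIMSEQ_degree_sum_div d) auto
    moreover have "(M * C) powr 0 = 1" using M C(1) by simp
    ultimately show "?u \<longlonglongrightarrow> R powr (- 1 / (2 * (real d)\<^sup>2)) * t powr (1 / real d)" by simp
    have "filterlim k at_top sequentially"
      unfolding filterlim_at_top
    proof
      fix Z
      have "Z \<le> k n" if "(Z + 2) * d \<le> n" for n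
      proof -
        have "(Z + 2) * d div d \<le> n div d" using that by (rule div_le_mono)
        then show ?thesis using d by (simp add: k_def)
      qed
      then show "\<forall>\<^sub>F n in sequentially. Z \<le> k n" unfolding eventually_sequentially by blast
    qed
    moreover have "eventually (\<lambda>m. V m powr (1 / l m) < t \<and> 0 < m) sequentially"
      using T(1) t unfolding is_limsup_def V_def l_def by (intro eventually_conj eventually_gt_at_top) auto
    ultimately have "eventually (\<lambda>n. V (k n) powr (1 / l (k n)) < t \<and> 0 < k n) sequentially"
      by (rule eventually_compose_filterlim[rotated])
    then show "eventually (\<lambda>n. Van e (monomial_count n) (f -` K) powr (1 / real (degree_sum n)) \<le> ?u n) sequentially"
      using eventually_ge_at_top[of "2 * d"]
    proof eventually_elim
      case (elim n)
      have n0: "0 < n" using elim d by (auto intro: ccontr)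
      have lk: "0 < l (k n)" "0 < l n" unfolding l_def using elim n0 by (intro degree_sum_pos, simp)+
      have "V (k n) = (V (k n) powr (1 / l (k n))) powr l (k n)"
        using lk V0[of "k n"] by (simp add: powr_powr)
      also have "\<dots> \<le> t powr l (k n)" using elim lk by (intro powr_mono2) auto
      finally have "V (k n) ^ D \<le> (t powr l (k n)) ^ D" using V0 by (intro power_mono)
      also have "\<dots> = t powr (real D * l (k n))" using t0 by (simp add: powr_power mult.commute)
      finally have VD: "V (k n) ^ D \<le> t powr (real D * l (k n))" .
      have "R ^ res_exponent d n * W n \<le> (M ^ (n + 1)\<^sup>2 * Delta n) * W n"
        using low W0 by (intro mult_right_mono)
      also have "\<dots> \<le> M ^ (n + 1)\<^sup>2 * (C ^ (n + 1)\<^sup>2 * V (k n) ^ D)"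
        unfolding mult.assoc using C(2)[of n] elim M by (intro mult_left_mono) (auto simp: V_def W_def k_def)
      also have "\<dots> \<le> M ^ (n + 1)\<^sup>2 * (C ^ (n + 1)\<^sup>2 * t powr (real D * l (k n)))"
        using VD M C(1) by (intro mult_left_mono) auto
      finally have "R ^ res_exponent d n * W n \<le> (M * C) ^ (n + 1)\<^sup>2 * t powr (real D * l (k n))"
        by (simp only: power_mult_distrib mult.assoc)
      then have "W n \<le> (M * C) ^ (n + 1)\<^sup>2 * t powr (real D * l (k n)) / R ^ res_exponent d n"
        using R by (simp add: pos_le_divide_eq mult.commute)
      also have "\<dots> = (M * C) powr real ((n + 1)\<^sup>2) * (R powr (- real (res_exponent d n)) * t powr (real D * l (k n)))"
      proof -
        have "R powr (- real s) = 1 / R ^ s" for s using R by (simp add: powr_minus powr_realpow inverse_eq_divide)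
        moreover have "(M * C) powr real m = (M * C) ^ m" for m using M C(1) by (intro powr_realpow) (auto intro: mult_pos_pos)
        ultimately show ?thesis by (simp del: of_nat_power)
      qed
      finally have "W n powr (1 / l n) \<le> ((M * C) powr real ((n + 1)\<^sup>2) * (R powr (- real (res_exponent d n)) * t powr (real D * l (k n)))) powr (1 / l n)"
        using W0 lk by (intro powr_mono2) auto
      also have "\<dots> = (M * C) powr (real ((n + 1)\<^sup>2) / l n) * (R powr (- (real (res_exponent d n) / l n)) * t powr (real D * l (k n) / l n))"
        by (simp add: powr_mult powr_powr del: of_nat_power)
      finally show ?case by (simp add: W_def l_def k_def D_def)
    qed
  qed
  \<comment> \<open>t = T + 1 / (j + 1) decreases to T. The power with positive exponent 1 / d is
    continuous there also when T = 0.\<close>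
  have "(\<lambda>j. R powr (- 1 / (2 * (real d)\<^sup>2)) * (T + inverse (real (Suc j))) powr (1 / real d)) \<longlonglongrightarrow>
      R powr (- 1 / (2 * (real d)\<^sup>2)) * (T + 0) powr (1 / real d)"
    using T(2) d by (intro tendsto_mult tendsto_const tendsto_powr' tendsto_add LIMSEQ_inverse_real_of_nat) auto
  then have "S \<le> R powr (- 1 / (2 * (real d)\<^sup>2)) * (T + 0) powr (1 / real d)"
    by (rule LIMSEQ_le_const, intro exI[of _ 0] allI impI, intro bound) simp
  then show ?thesis by simp
qed

text \<open>If T = 0 the left side is 0. Otherwise, for 0 < t < T, the maxima of \<open>K\<close> in
  degree k + a exceed t^(l_(k + a)) for infinitely many k, and each such k yields a lower bound for
  the preimage in degree d k.\<close>

lemma limsup_preimage_ge: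
  assumes e: "graded_enumeration e" and R: "0 < R" and M: "1 \<le> M"
    and up: "\<And>n. Delta n \<le> M ^ (n + 1)\<^sup>2 * R ^ res_exponent d n"
    and K: "\<And>z. z \<in> K \<Longrightarrow> cmod (fst z) \<le> c \<and> cmod (snd z) \<le> c"
    and T: "is_limsup (\<lambda>n. Van e (monomial_count n) K powr (1 / real (degree_sum n))) T" "0 \<le> T"
    and S: "is_limsup (\<lambda>n. Van e (monomial_count n) (f -` K) powr (1 / real (degree_sum n))) S" "0 \<le> S"
  shows "R powr (- 1 / (2 * (real d)\<^sup>2)) * T powr (1 / real d) \<le> S"
proof (cases "T = 0")
  case True
  then show ?thesis using S(2) by simp
next
  case False
  then have T0: "0 < T" using T(2) by simp
  obtain a C where C: "1 \<le> C" "\<And>k. Van e (monomial_count (k + a)) K ^ D \<le>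
       C ^ (k + 1)\<^sup>2 * (Delta (d * k) * Van e (monomial_count (d * k)) (f -` K))"
    by (rule Van_le_preimage[of e K c, OF e K]) auto
  obtain c1 where c1: "\<And>z. z \<in> f -` K \<Longrightarrow> cmod (fst z) \<le> c1 \<and> cmod (snd z) \<le> c1"
    using preimage_bounded[of K, OF K] by (metis vimageD)
  define l where "l n = real (degree_sum n)" for n
  define V where "V n = Van e (monomial_count n) K" for n
  define W where "W n = Van e (monomial_count n) (f -` K)" for n
  have V0: "0 \<le> V n" for n unfolding V_def by (rule Van_nonneg(1)[OF e K])
  have W0: "0 \<le> W n" for n unfolding W_def by (rule Van_nonneg(1)[OF e c1])
  have dlim: "filterlim (\<lambda>k. d * k) at_top sequentially"
    unfolding filterlim_at_top
  proof
    fix Z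
    have "Z \<le> d * k" if "Z \<le> k" for k
    proof -
      have "1 * k \<le> d * k" using d by (intro mult_right_mono) auto
      then show ?thesis using that by linarith
    qed
    then show "\<forall>\<^sub>F k in sequentially. Z \<le> d * k" unfolding eventually_sequentially by blast
  qed
  have bound: "R powr (- 1 / (2 * (real d)\<^sup>2)) * t powr (1 / real d) \<le> S" if t: "0 < t" "t < T" for t
  proof (rule is_limsup_ge[OF S(1) _ _ dlim])
    let ?u = "\<lambda>k. (C * M) powr (- (real ((d * k + 1)\<^sup>2) / real (degree_sum (d * k)))) *
        (R powr (- (real (res_exponent d (d * k)) / real (degree_sum (d * k)))) * t powr (real (d\<^sup>2 * degree_sum (k + a)) / real (degree_sum (d * k))))"
    have "?u \<longlonglongrightarrow> (C * M) powr (- 0) * (R powr (- (1 / (2 * (real d)\<^sup>2))) * t powr (1 / real d))"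
      using M C(1) R t
      by (intro tendsto_mult tendsto_powr tendsto_const tendsto_minus LIMSEQ_degree_sum_mult d
          filterlim_compose[OF LIMSEQ_squares_over_degree_sum dlim] filterlim_compose[OF LIMSEQ_res_exponent[OF d] dlim]) auto
    moreover have "(C * M) powr (- 0) = 1" using M C(1) by simp
    ultimately show "?u \<longlonglongrightarrow> R powr (- 1 / (2 * (real d)\<^sup>2)) * t powr (1 / real d)" by simp
    have "frequently (\<lambda>m. t < V m powr (1 / l m)) sequentially"
      using T(1) t(2) by (simp add: is_limsup_def V_def l_def)
    \<comment> \<open>All but finitely many indices have the form k + a, so infinitely many of the
      good ones do.\<close>
    then have "frequently (\<lambda>k. t < V (k + a) powr (1 / l (k + a))) sequentially"
      unfolding frequently_def by (subst (asm) eventually_sequentially_seg[symmetric, of _ a]) simp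
    then have "frequently (\<lambda>k. t < V (k + a) powr (1 / l (k + a)) \<and> 0 < k) sequentially"
      using eventually_gt_at_top[of "0::nat"] by (rule frequently_eventually_frequently)
    then show "frequently (\<lambda>k. ?u k \<le> Van e (monomial_count (d * k)) (f -` K) powr (1 / real (degree_sum (d * k)))) sequentially"
    proof (rule frequently_elim1)
      fix k assume *: "t < V (k + a) powr (1 / l (k + a)) \<and> 0 < k"
      define n where "n = d * k"
      have n0: "0 < n" using * d by (simp add: n_def)
      have lk: "0 < l (k + a)" "0 < l n" unfolding l_def using * n0 by (intro degree_sum_pos, simp)+
      have "t powr l (k + a) \<le> (V (k + a) powr (1 / l (k + a))) powr l (k + a)"
        using * lk t by (intro powr_mono2) auto
      also have "\<dots> = V (k + a)" using lk V0 by (simp add: powr_powr)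
      finally have "(t powr l (k + a)) ^ D \<le> V (k + a) ^ D" by (intro power_mono) auto
      moreover have "(t powr l (k + a)) ^ D = t powr (real D * l (k + a))" using t by (simp add: powr_power mult.commute)
      ultimately have "t powr (real D * l (k + a)) \<le> C ^ (k + 1)\<^sup>2 * (Delta n * W n)"
        using C(2)[of k] by (simp add: V_def W_def n_def)
      also have "\<dots> \<le> C ^ (n + 1)\<^sup>2 * ((M ^ (n + 1)\<^sup>2 * R ^ res_exponent d n) * W n)"
      proof (intro mult_mono)
        have "1 * k \<le> d * k" using d by (intro mult_right_mono) auto
        then have "(k + 1)\<^sup>2 \<le> (n + 1)\<^sup>2" unfolding n_def by (intro power_mono) auto
        then show "C ^ (k + 1)\<^sup>2 \<le> C ^ (n + 1)\<^sup>2" using C(1) by (rule power_increasing)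
      qed (use up W0 C(1) Delta_pos[of n] R M in \<open>auto intro: less_imp_le mult_nonneg_nonneg\<close>)
      also have "\<dots> = (C * M) ^ (n + 1)\<^sup>2 * (R ^ res_exponent d n * W n)"
        by (simp only: power_mult_distrib mult_ac)
      finally have "(t powr (real D * l (k + a))) powr (1 / l n) \<le> ((C * M) ^ (n + 1)\<^sup>2 * (R ^ res_exponent d n * W n)) powr (1 / l n)"
        using lk by (intro powr_mono2) auto
      then have le: "t powr (real D * l (k + a) / l n) \<le>
          (C * M) powr (real ((n + 1)\<^sup>2) / l n) * (R powr (real (res_exponent d n) / l n) * W n powr (1 / l n))"
      proof -
        assume a1: "(t powr (real D * l (k + a))) powr (1 / l n) \<le> ((C * M) ^ (n + 1)\<^sup>2 * (R ^ res_exponent d n * W n)) powr (1 / l n)"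
        have p: "(x ^ m) powr y = x powr (real m * y)" if "0 < x" for x y :: real and m
          using that by (simp add: powr_realpow[symmetric] powr_powr)
        have CM: "0 < C * M" using C(1) M by (intro mult_pos_pos) auto
        show ?thesis using a1 W0[of n] R CM by (simp add: powr_mult powr_powr p[OF CM] p[OF R] del: of_nat_power)
      qed
      have CM: "0 < C * M" using C(1) M by (intro mult_pos_pos) auto
      have "(C * M) powr (- (real ((n + 1)\<^sup>2) / l n)) * (R powr (- (real (res_exponent d n) / l n)) * t powr (real D * l (k + a) / l n)) \<le>
        (C * M) powr (- (real ((n + 1)\<^sup>2) / l n)) * (R powr (- (real (res_exponent d n) / l n)) *
          ((C * M) powr (real ((n + 1)\<^sup>2) / l n) * (R powr (real (res_exponent d n) / l n) * W n powr (1 / l n))))"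
        using le by (intro mult_left_mono) auto
      also have "\<dots> = W n powr (1 / l n)"
      proof -
        have "C \<noteq> 0" "M \<noteq> 0" using C(1) M by auto
        then show ?thesis using R by (simp add: powr_minus field_simps del: of_nat_power)
      qed
      finally show "?u k \<le> Van e (monomial_count (d * k)) (f -` K) powr (1 / real (degree_sum (d * k)))"
        by (simp add: W_def l_def n_def D_def)
    qed
  qed
  \<comment> \<open>t = T (1 - 1 / (j + 2)) tends to T and lies strictly between 0 and T from j = 0
    on.\<close>
  have "(\<lambda>j. R powr (- 1 / (2 * (real d)\<^sup>2)) * (T * (1 - inverse (real (Suc (Suc j))))) powr (1 / real d)) \<longlonglongrightarrow>
      R powr (- 1 / (2 * (real d)\<^sup>2)) * (T * (1 - 0)) powr (1 / real d)"
    using T0 by (intro tendsto_mult tendsto_const tendsto_powr tendsto_diff LIMSEQ_Suc[OF LIMSEQ_inverse_real_of_nat]) auto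
  then have "R powr (- 1 / (2 * (real d)\<^sup>2)) * (T * (1 - 0)) powr (1 / real d) \<le> S"
  proof (rule LIMSEQ_le_const2, intro exI allI impI)
    fix j :: nat
    have "0 < 1 - inverse (real (Suc (Suc j)))" "1 - inverse (real (Suc (Suc j))) < 1" by (auto simp: field_simps)
    then show "R powr (- 1 / (2 * (real d)\<^sup>2)) * (T * (1 - inverse (real (Suc (Suc j))))) powr (1 / real d) \<le> S"
      using T0 by (intro bound) (auto simp: mult_less_cancel_left1)
  qed
  then show ?thesis by simp
qed

end

text \<open>The resultant lists coefficients in descending order. Reversing all columns, and the
  rows within each of the two blocks, gives the ascending coefficients of the shifts; both reversals
  change at most the sign.\<close>

lemma hat_resultant_eq_cvd:
  "cmod (hat_resultant d p q) = cvd (shifts (top_poly d p) d @ shifts (top_poly d q) d)"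
proof -
  define row where "row r i j = shifted_row d (top_coeff d r) i j" for r i j
  define fs where "fs = map (row p) [0..<d] @ map (row q) [0..<d]"
  have "cmod (hat_resultant d p q) = vdm fs [0..<2 * d]"
    unfolding hat_resultant_def form_resultant_def vdm_def
    by (rule arg_cong[where f = "\<lambda>M. cmod (det M)"]) (auto intro!: eq_matI simp: fs_def nth_append row_def)
  also have "\<dots> = vdm (rev (map (row p) [0..<d]) @ rev (map (row q) [0..<d])) [0..<2 * d]"
    by (rule vdm_perm_rows) (simp add: fs_def)
  also have "\<dots> = vdm (rev (map (row p) [0..<d]) @ rev (map (row q) [0..<d])) (rev [0..<2 * d])"
    by (rule vdm_perm_cols) auto
  also have "\<dots> = vdm (map coeff (shifts (top_poly d p) d @ shifts (top_poly d q) d)) [0..<2 * d]"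
  proof (rule vdm_cong)
    have entry: "row r (d - Suc i) (2 * d - Suc j) = coeff (top_poly d r * monom 1 i) j" if "i < d" "j < 2 * d" for r i j
      using that by (auto simp: row_def shifted_row_def mult.commute[of "top_poly d r"] coeff_monom_mult coeff_top_poly)
    fix i j assume "i < length (rev (map (row p) [0..<d]) @ rev (map (row q) [0..<d]))"
      "j < length (rev (map (row p) [0..<d]) @ rev (map (row q) [0..<d]))"
    then have ij: "i < 2 * d" "j < 2 * d" by auto
    show "((rev (map (row p) [0..<d]) @ rev (map (row q) [0..<d])) ! i) (rev [0..<2 * d] ! j) =
        (map coeff (shifts (top_poly d p) d @ shifts (top_poly d q) d) ! i) ([0..<2 * d] ! j)"
    proof (cases "i < d")
      case True
      then show ?thesis using ij entry[of i j p] by (simp add: nth_append rev_nth shifts_def)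
    next
      case False
      then have "i - d < d" using ij by simp
      then show ?thesis using False ij entry[of "i - d" j q] by (simp add: nth_append rev_nth shifts_def)
    qed
  qed auto
  also have "\<dots> = cvd (shifts (top_poly d p) d @ shifts (top_poly d q) d)"
    by (simp add: cvd_def mult_2)
  finally show ?thesis .
qed

lemma compact_coordinates_bounded:
  assumes "compact (K :: (complex \<times> complex) set)"
  obtains c where "\<And>z. z \<in> K \<Longrightarrow> cmod (fst z) \<le> c \<and> cmod (snd z) \<le> c"
proof (cases "K = {}")
  case True
  then show thesis by (intro that[of 0]) auto
next
  case False
  have "compact ((\<lambda>z. cmod (fst z)) ` K)" "compact ((\<lambda>z. cmod (snd z)) ` K)"
    using assms by (auto intro!: compact_continuous_image continuous_intros)
  with False obtain a b where "\<forall>x\<in>(\<lambda>z. cmod (fst z)) ` K. x \<le> a" "\<forall>x\<in>(\<lambda>z. cmod (snd z)) ` K. x \<le> b"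
    using compact_attains_sup by (metis image_is_empty)
  then show thesis by (intro that[of "max a b"]) (auto simp: le_max_iff_disj)
qed

theorem theorem6p2:
  fixes d :: nat and f\<^sub>1 f\<^sub>2 :: bipoly and K :: "(complex \<times> complex) set"
    and e :: "nat \<Rightarrow> nat \<times> nat"
  assumes "graded_enumeration e"
    and "d \<ge> 1"
    and "regular_map d f\<^sub>1 f\<^sub>2"
    and "compact K"
  shows "transfinite_diameter e (poly_map f\<^sub>1 f\<^sub>2 -` K) =
    cmod (hat_resultant d f\<^sub>1 f\<^sub>2) powr (- 1 / (2 * (real d)\<^sup>2)) *
    transfinite_diameter e K powr (1 / real d)"
proof -
  note e = assms(1) and d = assms(2)
  define A B where "A = top_poly d f\<^sub>1" and "B = top_poly d f\<^sub>2"
  have hat: "hat_map d f\<^sub>1 f\<^sub>2 z = (hform d A z, hform d B z)" for z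
    by (simp add: hat_map_def A_def B_def hform_top_poly)
  have zero: "z = (0, 0)" if "hform d A z = 0" "hform d B z = 0" for z
    using assms(3) that hat[of z] by (auto simp: regular_map_def vimage_def set_eq_iff simp del: split_paired_All)
  have lead1: "leads d A (bipoly_eval f\<^sub>1)" and lead2: "leads d B (bipoly_eval f\<^sub>2)"
    unfolding A_def B_def using assms(3) by (auto intro!: leads_bipoly_eval simp: regular_map_def)
  have deg: "deg_below (Suc d) A" "deg_below (Suc d) B" by (auto simp: A_def B_def coeff_top_poly)
  \<comment> \<open>The point (1, 0) is not a zero of the leading part, so there is no common root
    at infinity.\<close>
  have lead: "coeff A d \<noteq> 0 \<or> coeff B d \<noteq> 0"
    using zero[of "(1, 0)"] by (auto simp: hform_infinity)
  \<comment> \<open>A common root t would make (t, 1) a zero of the leading part.\<close>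
  have cop: "poly B t \<noteq> 0" if "poly A t = 0" for t
    using zero[of "(t, 1)"] that deg by (auto simp: hform_eq_poly deg_below_degree)
  obtain \<Gamma> \<kappa> "is" where g: "cvd (shifts A d @ shifts B d) > 0" "finite \<Gamma>" "card \<Gamma> = d\<^sup>2" "(0, 0) \<in> \<Gamma>"
    "\<And>\<beta>. \<beta> \<in> \<Gamma> \<Longrightarrow> total_deg \<beta> \<le> 2 * d" "\<And>r. (\<kappa> :: nat \<Rightarrow> real) r > 0" "\<And>n. distinct (is n)"
    "\<And>n. set (is n) = {(\<beta>, \<alpha>). \<beta> \<in> \<Gamma> \<and> total_deg \<beta> + d * total_deg \<alpha> = n}"
    "\<And>n. length (is n) = Suc n"
    "\<And>n. cvd (map (up A B) (is n)) = \<kappa> (n mod d) ^ (n div d) *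
        cvd (shifts A d @ shifts B d) ^ (n div d * (n div d - 1) div 2)"
    by (rule graded_basis[OF d deg lead cop]) blast+
  define R where "R = cmod (hat_resultant d f\<^sub>1 f\<^sub>2)"
  have R: "R = cvd (shifts A d @ shifts B d)" unfolding R_def A_def B_def by (rule hat_resultant_eq_cvd)
  interpret graded_pair d A B "bipoly_eval f\<^sub>1" "bipoly_eval f\<^sub>2" \<Gamma> "is"
    by unfold_locales (use d lead1 lead2 g in auto)
  have f: "poly_map f\<^sub>1 f\<^sub>2 = f" by (simp add: fun_eq_iff poly_map_def f_def)
  obtain c where c: "\<And>z. z \<in> K \<Longrightarrow> cmod (fst z) \<le> c \<and> cmod (snd z) \<le> c"
    by (rule compact_coordinates_bounded[OF assms(4)]) blast
  obtain c1 where c1: "\<And>z. z \<in> f -` K \<Longrightarrow> cmod (fst z) \<le> c1 \<and> cmod (snd z) \<le> c1"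
    using preimage_bounded[of K, OF c] by (metis vimageD)
  obtain M where M: "1 \<le> M" "\<And>n. Delta n \<le> M ^ (n + 1)\<^sup>2 * R ^ res_exponent d n"
    "\<And>n. R ^ res_exponent d n \<le> M ^ (n + 1)\<^sup>2 * Delta n"
    by (rule Delta_bounds[of R \<kappa>]) (use g R in auto)
  have lim: "is_limsup (\<lambda>n. Van e (monomial_count n) E powr (1 / real (degree_sum n))) (transfinite_diameter e E) \<and>
      0 \<le> transfinite_diameter e E"
    if E: "\<And>z. z \<in> E \<Longrightarrow> cmod (fst z) \<le> c \<and> cmod (snd z) \<le> c" for E c
  proof -
    obtain b where b: "\<And>n. Van e (monomial_count n) E powr (1 / real (degree_sum n)) \<le> b"
      by (rule Van_root_bounded[of e E c, OF e E]) auto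
    have l: "is_limsup (\<lambda>n. Van e (monomial_count n) E powr (1 / real (degree_sum n))) (transfinite_diameter e E)"
      unfolding transfinite_diameter_def by (rule is_limsup_real_of_ereal[OF _ b]) simp
    have "0 \<le> transfinite_diameter e E"
      by (rule is_limsup_ge[OF l, of "\<lambda>_. 0" "\<lambda>n. n"]) (auto simp: filterlim_ident)
    with l show ?thesis by blast
  qed
  have limK: "is_limsup (\<lambda>n. Van e (monomial_count n) K powr (1 / real (degree_sum n))) (transfinite_diameter e K)"
    "0 \<le> transfinite_diameter e K" using lim[of K c] c by blast+
  have limE: "is_limsup (\<lambda>n. Van e (monomial_count n) (f -` K) powr (1 / real (degree_sum n))) (transfinite_diameter e (f -` K))"
    "0 \<le> transfinite_diameter e (f -` K)" using lim[of "f -` K" c1] c1 by blast+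
  have R0: "0 < R" using g(1) R by simp
  show ?thesis unfolding f R_def[symmetric]
  proof (rule antisym)
    show "transfinite_diameter e (f -` K) \<le> R powr (- 1 / (2 * (real d)\<^sup>2)) * transfinite_diameter e K powr (1 / real d)"
      by (rule limsup_preimage_le[OF e R0 M(1) M(3) c limK limE(1)])
    show "R powr (- 1 / (2 * (real d)\<^sup>2)) * transfinite_diameter e K powr (1 / real d) \<le> transfinite_diameter e (f -` K)"
      by (rule limsup_preimage_ge[OF e R0 M(1) M(2) c limK limE])
  qed
qed

end
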